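(* Let $f:E_A^{\mathbb N}\to\mathbb R$ be a strongly regular Hölder-type function and let $\delta>0$ satisfy $P(\delta f)=0$. Then there exists $y_0>0$ such that, setting $$c_\delta:=y_0^{-1}\big(\exp(\delta y_0^{-1})-1\big)^{-1},$$ for every Borel set $B\subseteq E_A^{\mathbb N}$ and every $\rho\in E_A^{\mathbb N}$ we have $$c_{\delta}\frac{h_{\delta}(\rho)}{\chi_{\mu_{\delta}}}m_{\delta}(B^o)\le\liminf_{T\to\infty}\frac{N_{\rho}(B,T)}{\exp(\delta T)}\le\limsup_{T\to\infty}\frac{N_{\rho}(B,T)}{\exp(\delta T)}\le c_{\delta}\frac{h_{\delta}(\rho)}{\chi_{\mu_{\delta}}}m_{\delta}(\overline{B})+y_0^{-1}\frac{h_{\delta}(\rho)}{\chi_{\mu_{\delta}}},$$ and $$c_{\delta}\frac{1}{\chi_{\mu_{\delta}}}\mu_\delta(B^o)\le\liminf_{T\to\infty}\frac{N_{\mathrm{per}}(B,T)}{\exp(\delta T)}\le\limsup_{T\to\infty}\frac{N_{\mathrm{per}}(B,T)}{\exp(\delta T)}\le c_{\delta}\frac{1}{\chi_{\mu_{\delta}}}\mu_\delta(\overline{B})+y_0^{-1}\frac{1}{\chi_{\mu_{\delta}}}.$$ Here $B^o$ and $\overline B$ are the interior and closure of $B$.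
   Context: $E$ is a countable (finite or infinite) set and $A:E\times E\to\{0,1\}$. $E_A^{\mathbb N}$ is the set of sequences $\rho=\rho_1\rho_2\dots\in E^{\mathbb N}$ with $A_{\rho_i\rho_{i+1}}=1$ for all $i$; $E_A^n$ is the set of words $\omega=\omega_1\cdots\omega_n$ with $A_{\omega_i\omega_{i+1}}=1$, $E_A^*=\bigcup_{n\ge1}E_A^n$, $|\omega|$ is the length. A concatenation $\omega\rho$ is admissible if it lies in $E_A^{\mathbb N}$. The subshift is assumed finitely irreducible: there is a finite set $\Omega$ of words such that for all $e,e'\in E$ some $\omega\in\Omega$ makes $e\omega e'$ admissible. $\sigma$ is the left shift; $S_nf=\sum_{j=0}^{n-1}f\circ\sigma^j$; $[\omega]=\{\rho\in E_A^{\mathbb N}:\rho_1\cdots\rho_n=\omega\}$. $|\rho\wedge\rho'|$ is the length of the longest common initial block; fix $\alpha>0$, metric $d_\alpha(\rho,\rho')=e^{-\alpha|\rho\wedge\rho'|}$ (topology = product of discrete topologies). For $g:E_A^{\mathbb N}\to\mathbb C$, $V_\alpha(g)=\sup_{n\ge1}\sup\{|g(\rho)-g(\rho')|e^{\alpha(n-1)}:|\rho\wedge\rho'|\ge n\}$; $g$ is Hölder-type if $V_\alpha(g)<\infty$. $C^{0,\alpha}$ is the Banach space of bounded $g$ with $V_\alpha(g)<\infty$, norm $\|g\|_\infty+V_\alpha(g)$. A real $g$ is summable if $\sum_{e\in E}\exp(\sup_{[e]}g)<\infty$. Pressure: $P(g)=\lim_n\frac1n\log\sum_{\omega\in E_A^n}\exp(\sup_{[\omega]}S_ng)$;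 $\Gamma=\{x\in\mathbb R: xf \text{ summable}\}$, $P(x):=P(xf)$. $f$ is strongly regular if $P(x)=0$ for some $x>0$ and $0<P(x)<\infty$ for some $x>0$. Transfer operator: $\mathcal L_{sf}g(\rho)=\sum_{e\in E:A_{e\rho_1}=1}\exp(sf(e\rho))g(e\rho)$ on $C^{0,\alpha}$. $m_\delta$ is the Borel probability measure with $\mathcal L_{\delta f}^*m_\delta=m_\delta$ (a Gibbs state), $h_\delta\in C^{0,\alpha}$ the positive function with $\mathcal L_{\delta f}h_\delta=h_\delta$ and $\int h_\delta\,dm_\delta=1$, $\mu_\delta=h_\delta m_\delta$ the equilibrium state, $\chi_{\mu_\delta}=-\int f\,d\mu_\delta$. Counting functions for $B\subseteq E_A^{\mathbb N}$, $\rho\in E_A^{\mathbb N}$, $T>0$: $N_\rho(B,T)=\#\{\omega\in E_A^*:\omega\rho\text{ admissible},\ \omega\rho\in B,\ S_{|\omega|}f(\omega\rho)\ge -T\}$; $N_{\mathrm{per}}(B,T)=\#\{\omega\in E_A^*: A_{\omega_{|\omega|}\omega_1}=1,\ \overline\omega\in B,\ S_{|\omega|}f(\overline\omega)\ge-T\}$ where $\overline\omega=\omega\omega\omega\cdots$. *)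

theory Defs
  imports "HOL-Analysis.Analysis" "HOL-Probability.Probability" "HOL-Library.Liminf_Limsup"
begin

text \<open>Symbolic dynamics over a countable alphabet of type 'e.  The transition matrix is
  A :: 'e => 'e => bool (A a b means the entry A_ab equals 1).  Infinite sequences are
  functions nat => 'e, where position 0 is the first letter rho_1.  Finite words are
  lists.\<close>

definition shift_space :: "('e \<Rightarrow> 'e \<Rightarrow> bool) \<Rightarrow> (nat \<Rightarrow> 'e) set" where
  "shift_space A = {\<rho>. \<forall>i. A (\<rho> i) (\<rho> (Suc i))}"

definition adm_word :: "('e \<Rightarrow> 'e \<Rightarrow> bool) \<Rightarrow> 'e list \<Rightarrow> bool" where
  "adm_word A w \<longleftrightarrow> w \<noteq> [] \<and> (\<forall>i. Suc i < length w \<longrightarrow> A (w ! i) (w ! Suc i))"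

definition words :: "('e \<Rightarrow> 'e \<Rightarrow> bool) \<Rightarrow> nat \<Rightarrow> 'e list set" where
  "words A n = {w. adm_word A w \<and> length w = n}"

definition all_words :: "('e \<Rightarrow> 'e \<Rightarrow> bool) \<Rightarrow> 'e list set" where
  "all_words A = {w. adm_word A w}"

definition concat_seq :: "'e list \<Rightarrow> (nat \<Rightarrow> 'e) \<Rightarrow> (nat \<Rightarrow> 'e)" where
  "concat_seq w \<rho> = (\<lambda>i. if i < length w then w ! i else \<rho> (i - length w))"

definition per_seq :: "'e list \<Rightarrow> (nat \<Rightarrow> 'e)" where
  "per_seq w = (\<lambda>i. w ! (i mod length w))"

definition finitely_irreducible :: "('e \<Rightarrow> 'e \<Rightarrow> bool) \<Rightarrow> bool" where
  "finitely_irreducible A \<longleftrightarrow>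
     (\<exists>\<Omega>. finite \<Omega> \<and> \<Omega> \<subseteq> all_words A \<and>
        (\<forall>e e'. \<exists>\<omega>\<in>\<Omega>. adm_word A ([e] @ \<omega> @ [e'])))"

definition cyl :: "('e \<Rightarrow> 'e \<Rightarrow> bool) \<Rightarrow> 'e list \<Rightarrow> (nat \<Rightarrow> 'e) set" where
  "cyl A w = {\<rho> \<in> shift_space A. \<forall>i < length w. \<rho> i = w ! i}"

definition shift :: "(nat \<Rightarrow> 'e) \<Rightarrow> (nat \<Rightarrow> 'e)" where
  "shift \<rho> = (\<lambda>i. \<rho> (Suc i))"

definition birkhoff :: "nat \<Rightarrow> ((nat \<Rightarrow> 'e) \<Rightarrow> 'a::comm_monoid_add) \<Rightarrow> (nat \<Rightarrow> 'e) \<Rightarrow> 'a" where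
  "birkhoff n g \<rho> = (\<Sum>j<n. g ((shift ^^ j) \<rho>))"

text \<open>Topology on E_A^N: subspace of the product of discrete topologies
  (this is the topology of the metric d_alpha).\<close>
definition shift_top :: "('e \<Rightarrow> 'e \<Rightarrow> bool) \<Rightarrow> (nat \<Rightarrow> 'e) topology" where
  "shift_top A = subtopology (product_topology (\<lambda>_::nat. discrete_topology (UNIV::'e set)) UNIV)
                    (shift_space A)"

definition borel_sets_of :: "'a topology \<Rightarrow> 'a set set" where
  "borel_sets_of X = sigma_sets (topspace X) {U. openin X U}"

definition holder_type :: "('e \<Rightarrow> 'e \<Rightarrow> bool) \<Rightarrow> real \<Rightarrow> ((nat \<Rightarrow> 'e) \<Rightarrow> 'a::real_normed_vector) \<Rightarrow> bool" where
  "holder_type A \<alpha> g \<longleftrightarrow>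
     (\<exists>C. \<forall>n\<ge>1. \<forall>\<rho>\<in>shift_space A. \<forall>\<rho>'\<in>shift_space A.
        (\<forall>i<n. \<rho> i = \<rho>' i) \<longrightarrow> norm (g \<rho> - g \<rho>') * exp (\<alpha> * (real n - 1)) \<le> C)"

definition holder_space :: "('e \<Rightarrow> 'e \<Rightarrow> bool) \<Rightarrow> real \<Rightarrow> ((nat \<Rightarrow> 'e) \<Rightarrow> 'a::real_normed_vector) \<Rightarrow> bool" where
  "holder_space A \<alpha> g \<longleftrightarrow> (\<exists>M. \<forall>\<rho>\<in>shift_space A. norm (g \<rho>) \<le> M) \<and> holder_type A \<alpha> g"

definition summable_pot :: "('e \<Rightarrow> 'e \<Rightarrow> bool) \<Rightarrow> ((nat \<Rightarrow> 'e) \<Rightarrow> real) \<Rightarrow> bool" where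
  "summable_pot A g \<longleftrightarrow> (\<lambda>e. exp (Sup (g ` cyl A [e]))) summable_on UNIV"

definition partition_fun :: "('e \<Rightarrow> 'e \<Rightarrow> bool) \<Rightarrow> ((nat \<Rightarrow> 'e) \<Rightarrow> real) \<Rightarrow> nat \<Rightarrow> ennreal" where
  "partition_fun A g n = (\<Sum>\<^sub>\<infinity>w\<in>words A n. ennreal (exp (Sup (birkhoff n g ` cyl A w))))"

definition pressure_term :: "('e \<Rightarrow> 'e \<Rightarrow> bool) \<Rightarrow> ((nat \<Rightarrow> 'e) \<Rightarrow> real) \<Rightarrow> nat \<Rightarrow> ereal" where
  "pressure_term A g n =
     (let Z = partition_fun A g n in
      if Z = \<infinity> then \<infinity> else if Z = 0 then -\<infinity> else ereal (ln (enn2real Z) / real n))"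

definition pressure :: "('e \<Rightarrow> 'e \<Rightarrow> bool) \<Rightarrow> ((nat \<Rightarrow> 'e) \<Rightarrow> real) \<Rightarrow> ereal" where
  "pressure A g = lim (\<lambda>n. pressure_term A g (Suc n))"

definition strongly_regular :: "('e \<Rightarrow> 'e \<Rightarrow> bool) \<Rightarrow> ((nat \<Rightarrow> 'e) \<Rightarrow> real) \<Rightarrow> bool" where
  "strongly_regular A f \<longleftrightarrow>
     (\<exists>x>0. pressure A (\<lambda>\<rho>. x * f \<rho>) = 0) \<and>
     (\<exists>x>0. 0 < pressure A (\<lambda>\<rho>. x * f \<rho>) \<and> pressure A (\<lambda>\<rho>. x * f \<rho>) < \<infinity>)"

definition transfer_op :: "('e \<Rightarrow> 'e \<Rightarrow> bool) \<Rightarrow> real \<Rightarrow> ((nat \<Rightarrow> 'e) \<Rightarrow> real)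
     \<Rightarrow> ((nat \<Rightarrow> 'e) \<Rightarrow> 'a::{banach, real_normed_algebra_1}) \<Rightarrow> (nat \<Rightarrow> 'e) \<Rightarrow> 'a" where
  "transfer_op A s f g \<rho> =
     (\<Sum>\<^sub>\<infinity>e\<in>{e. A e (\<rho> 0)}. of_real (exp (s * f (concat_seq [e] \<rho>))) * g (concat_seq [e] \<rho>))"

definition ecard :: "'a set \<Rightarrow> ereal" where
  "ecard S = (if finite S then ereal (real (card S)) else \<infinity>)"

definition N_orbit :: "('e \<Rightarrow> 'e \<Rightarrow> bool) \<Rightarrow> ((nat \<Rightarrow> 'e) \<Rightarrow> real) \<Rightarrow> (nat \<Rightarrow> 'e) set
     \<Rightarrow> (nat \<Rightarrow> 'e) \<Rightarrow> real \<Rightarrow> ereal" where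
  "N_orbit A f B \<rho> T = ecard {w \<in> all_words A. concat_seq w \<rho> \<in> shift_space A \<and>
       concat_seq w \<rho> \<in> B \<and> birkhoff (length w) f (concat_seq w \<rho>) \<ge> - T}"

definition N_per :: "('e \<Rightarrow> 'e \<Rightarrow> bool) \<Rightarrow> ((nat \<Rightarrow> 'e) \<Rightarrow> real) \<Rightarrow> (nat \<Rightarrow> 'e) set
     \<Rightarrow> real \<Rightarrow> ereal" where
  "N_per A f B T = ecard {w \<in> all_words A. A (last w) (hd w) \<and>
       per_seq w \<in> B \<and> birkhoff (length w) f (per_seq w) \<ge> - T}"

end

theory Submission
  imports Defs
begin

text \<open>As \<open>y0\<close> tends to \<open>0\<close>, the constant \<open>c\<close> vanishes and \<open>1 / y0\<close> grows without bound, so it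
  suffices to compare both counting functions with \<open>exp (\<delta> T)\<close> up to uniform constants and no
  Tauberian theorem is needed.  The measure \<open>m\<close> has the Gibbs property: \<open>m [w]\<close> is comparable to
  \<open>exp (\<delta> S w)\<close>, where \<open>S w\<close> is the supremum over \<open>[w]\<close> of the Birkhoff sum of length \<open>|w|\<close>.
  If some letter has two successors, cylinder masses decay exponentially, hence
  \<open>S w \<le> C - c |w|\<close>; a shift without branching has pressure at most \<open>0\<close> everywhere, contradicting
  strong regularity.  Linear decay bounds the sum of \<open>exp (- \<delta> S w)\<close> over the prefixes \<open>w\<close> of a
  point with \<open>S w \<ge> - T\<close> by \<open>O(exp (\<delta> T))\<close>, and integration gives the upper bound.
  For the lower bound, most points of a cylinder have a prefix with \<open>S w\<close> in a window
  \<open>[-T, -T + M]\<close>: overshoots are rare because \<open>S [e]\<close> has a finite first moment, by strong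
  regularity.  Such words can be prolonged by finitely many connectors to admissible or
  periodic words.\<close>

section \<open>Words, cylinders and Birkhoff sums\<close>

text \<open>The order of quantifiers shapes the proof: \<open>y0\<close> is fixed before the Borel
  set and the base point, so every estimate needs constants free of both. Only the threshold from
  which a lower bound holds may depend on a cylinder; the lower limit forgets it, and open sets are
  exhausted from inside by finite disjoint families of cylinders. The factor h(rho) / chi becomes
  harmless once h is bounded above and away from 0 and chi > 0 is known. The obstacle is the
  infinite alphabet: f may be unbounded below, so a single letter can carry a Birkhoff sum far below
  -T. Finite irreducibility replaces compactness wherever a minimum over letters is wanted. The
  moment of \<open>S [e]\<close> comes from a gap: the pressure is at most 0 at and above \<delta>,
  so a parameter x with positive finite pressure lies strictly below \<delta>; the sum of exp (x S
  [e]) converges, and exp ((\<delta> - x) S [e]) absorbs the factor \<bar>S [e]\<bar>.\<close>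

definition pre :: "nat \<Rightarrow> (nat \<Rightarrow> 'e) \<Rightarrow> 'e list" where
  "pre n x = map x [0..<n]"

lemma length_pre [simp]: "length (pre n x) = n"
  by (simp add: pre_def)

lemma nth_pre [simp]: "i < n \<Longrightarrow> pre n x ! i = x i"
  by (simp add: pre_def)

lemma pre_eq_iff: "pre n x = w \<longleftrightarrow> length w = n \<and> (\<forall>i<n. x i = w ! i)"
  by (auto simp: list_eq_iff_nth_eq)

lemma take_pre: "m \<le> n \<Longrightarrow> take m (pre n x) = pre m x"
  by (auto simp: list_eq_iff_nth_eq)

lemma adm_word_iff: "adm_word A w \<longleftrightarrow> w \<noteq> [] \<and> successively A w"
  by (simp add: adm_word_def successively_conv_nth)

lemma successively_pre: "x \<in> shift_space A \<Longrightarrow> successively A (pre n x)"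
  by (simp add: successively_conv_nth shift_space_def)

lemma mem_cyl_iff: "x \<in> cyl A w \<longleftrightarrow> x \<in> shift_space A \<and> pre (length w) x = w"
  by (auto simp: cyl_def pre_eq_iff)

lemma cyl_subset: "cyl A w \<subseteq> shift_space A"
  by (auto simp: cyl_def)

lemma cyl_Nil [simp]: "cyl A [] = shift_space A"
  by (auto simp: cyl_def)

lemma cyl_append_subset: "cyl A (u @ v) \<subseteq> cyl A u"
  by (auto simp: cyl_def nth_append split: if_splits)

lemma mem_cyl_pre: "x \<in> shift_space A \<Longrightarrow> x \<in> cyl A (pre n x)"
  by (simp add: mem_cyl_iff)

lemma cyl_disjoint: "length u = length v \<Longrightarrow> u \<noteq> v \<Longrightarrow> cyl A u \<inter> cyl A v = {}"
  by (auto simp: mem_cyl_iff)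

lemma cyl_empty: "\<not> successively A w \<Longrightarrow> cyl A w = {}"
  by (metis equals0I mem_cyl_iff successively_pre)

lemma shift_in_shift_space: "x \<in> shift_space A \<Longrightarrow> shift x \<in> shift_space A"
  by (simp add: shift_space_def shift_def)

lemma shift_pow_apply: "(shift ^^ n) x i = x (i + n)"
  by (induction n arbitrary: x i) (simp_all add: shift_def funpow_Suc_right del: funpow.simps)

lemma shift_pow_in_shift_space: "x \<in> shift_space A \<Longrightarrow> (shift ^^ n) x \<in> shift_space A"
  by (simp add: shift_space_def shift_pow_apply)

lemma birkhoff_0 [simp]: "birkhoff 0 f x = 0"
  by (simp add: birkhoff_def)

lemma birkhoff_add: "birkhoff (m + n) f x = birkhoff m f x + birkhoff n f ((shift ^^ m) x)"
  for f :: "(nat \<Rightarrow> 'e) \<Rightarrow> 'a::comm_monoid_add"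
  by (induction n) (simp_all add: birkhoff_def add.assoc funpow_add add.commute[of m])

lemma birkhoff_Suc: "birkhoff (Suc n) f x = f x + birkhoff n f (shift x)"
  for f :: "(nat \<Rightarrow> 'e) \<Rightarrow> 'a::comm_monoid_add"
  using birkhoff_add[of 1 n f x] by (simp add: birkhoff_def)

lemma birkhoff_scale: "birkhoff n (\<lambda>\<rho>. c * f \<rho>) x = c * birkhoff n f x"
  for f :: "(nat \<Rightarrow> 'e) \<Rightarrow> real"
  by (simp add: birkhoff_def sum_distrib_left)

lemma shift_pow_in_cyl: "x \<in> cyl A (u @ v) \<Longrightarrow> (shift ^^ length u) x \<in> cyl A v"
  by (auto simp: cyl_def shift_pow_apply shift_pow_in_shift_space)
    (metis add.commute nat_add_left_cancel_less nth_append_length_plus)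

lemma shift_in_cyl: "x \<in> cyl A (e # w) \<Longrightarrow> shift x \<in> cyl A w"
  using shift_pow_in_cyl[of x A "[e]" w] by simp

lemma concat_seq_Nil [simp]: "concat_seq [] x = x"
  by (simp add: concat_seq_def)

lemma concat_seq_append: "concat_seq (u @ v) x = concat_seq u (concat_seq v x)"
  by (auto simp: concat_seq_def fun_eq_iff nth_append)

lemma shift_concat_Cons [simp]: "shift (concat_seq (e # w) x) = concat_seq w x"
  by (auto simp: concat_seq_def shift_def fun_eq_iff)

lemma concat_seq_0 [simp]: "concat_seq (e # w) x 0 = e"
  by (simp add: concat_seq_def)

lemma concat_seq_Cons_Suc [simp]: "concat_seq (e # w) x (Suc i) = concat_seq w x i"
  by (simp add: concat_seq_def)

lemma pre_concat_seq [simp]: "pre (length w) (concat_seq w x) = w"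
  by (simp add: pre_eq_iff concat_seq_def)

lemma concat_Cons_in_shift_space:
  "concat_seq (e # w) x \<in> shift_space A \<longleftrightarrow>
     A e (concat_seq w x 0) \<and> concat_seq w x \<in> shift_space A"
proof -
  have "(\<forall>i. P i) \<longleftrightarrow> P 0 \<and> (\<forall>i. P (Suc i))" for P :: "nat \<Rightarrow> bool"
    by (metis not0_implies_Suc)
  from this[of "\<lambda>i. A (concat_seq (e # w) x i) (concat_seq (e # w) x (Suc i))"]
  show ?thesis by (simp add: shift_space_def)
qed

lemma concat_in_shift_space:
  "concat_seq w x \<in> shift_space A \<longleftrightarrow>
     successively A w \<and> x \<in> shift_space A \<and> (w = [] \<or> A (last w) (x 0))"
proof (induction w)
  case (Cons e w)
  then show ?case
    by (cases w) (auto simp: concat_Cons_in_shift_space)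
qed simp

text \<open>Among the preimages of a point under the shift at most one lies in a given cylinder, so
  a single branch survives when the transfer operator acts on the indicator of a cylinder.\<close>

lemma concat_in_cyl_iff:
  assumes "x \<in> shift_space A" "A e (x 0)"
  shows "concat_seq [e] x \<in> cyl A (e' # w) \<longleftrightarrow> e' = e \<and> x \<in> cyl A w"
  using assms
  by (auto simp: cyl_def concat_in_shift_space less_Suc_eq_0_disj)

lemma per_seq_in_shift_space:
  assumes "adm_word A w" "A (last w) (hd w)"
  shows "per_seq w \<in> shift_space A"
proof -
  have w: "w \<noteq> []" and s: "successively A w" using assms by (auto simp: adm_word_iff)
  have "A (w ! (i mod length w)) (w ! (Suc i mod length w))" for i
  proof (cases "Suc (i mod length w) < length w")
    case True
    then show ?thesis using successively_nth[OF s True] by (simp add: mod_Suc)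
  next
    case False
    then have "Suc (i mod length w) = length w" using w
      by (metis Suc_lessI length_greater_0_conv mod_less_divisor)
    then show ?thesis using assms(2) w
      by (metis diff_Suc_1 hd_conv_nth last_conv_nth mod_Suc)
  qed
  then show ?thesis by (simp add: shift_space_def per_seq_def)
qed

lemma pre_per_seq [simp]: "pre (length w) (per_seq w) = w"
  by (simp add: pre_eq_iff per_seq_def)

lemma per_seq_in_cyl:
  "adm_word A w \<Longrightarrow> A (last w) (hd w) \<Longrightarrow> per_seq w \<in> cyl A w"
  by (simp add: mem_cyl_iff per_seq_in_shift_space)

text \<open>Prefixes of a point are determined by their length, so a weighted count of the cylinders
  containing the point is a sum over lengths.\<close>

lemma sum_words_at_point:
  assumes "finite F" "x \<in> shift_space A"
  shows "(\<Sum>w\<in>F. g w * indicator (cyl A w) x) = (\<Sum>n\<in>{n. pre n x \<in> F}. g (pre n x) :: real)"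
proof -
  have inj: "inj_on (\<lambda>n. pre n x) S" for S
    by (metis inj_onI length_pre)
  have "(\<Sum>w\<in>F. g w * indicator (cyl A w) x) = (\<Sum>w\<in>{w\<in>F. x \<in> cyl A w}. g w)"
    using assms(1) by (intro sum.mono_neutral_cong_right) (auto simp: indicator_def)
  also have "{w\<in>F. x \<in> cyl A w} = (\<lambda>n. pre n x) ` {n. pre n x \<in> F}"
    using assms(2) by (auto simp: mem_cyl_iff) (metis image_eqI mem_Collect_eq)
  also have "(\<Sum>w\<in>\<dots>. g w) = (\<Sum>n\<in>{n. pre n x \<in> F}. g (pre n x))"
    by (subst sum.reindex[OF inj]) simp
  finally show ?thesis .
qed

lemma finite_pre_in: "finite F \<Longrightarrow> finite {n. pre n x \<in> F}"
  by (rule finite_imageD[of "\<lambda>n. pre n x"]) (auto intro: finite_subset inj_onI simp: pre_eq_iff)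

section \<open>Finitely irreducible subshifts and distortion\<close>

locale irreducible_shift =
  fixes A :: "'e::countable \<Rightarrow> 'e \<Rightarrow> bool"
  assumes irr: "finitely_irreducible A"
begin

abbreviation "X \<equiv> shift_space A"

text \<open>One finite set is fixed by choice, so that maxima and minima over connectors are
  constants that do not depend on the letters to be joined.\<close>

definition connectors :: "'e list set" where
  "connectors = (SOME \<Omega>. finite \<Omega> \<and> \<Omega> \<subseteq> all_words A \<and>
        (\<forall>e e'. \<exists>\<omega>\<in>\<Omega>. adm_word A ([e] @ \<omega> @ [e'])))"

lemma connectors:
  "finite connectors" "connectors \<subseteq> all_words A"
  "\<exists>\<omega>\<in>connectors. adm_word A ([e] @ \<omega> @ [e'])"
proof -
  have "finite connectors \<and> connectors \<subseteq> all_words A \<and>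
        (\<forall>e e'. \<exists>\<omega>\<in>connectors. adm_word A ([e] @ \<omega> @ [e']))"
    unfolding connectors_def using irr unfolding finitely_irreducible_def by (rule someI_ex)
  then show "finite connectors" "connectors \<subseteq> all_words A"
    "\<exists>\<omega>\<in>connectors. adm_word A ([e] @ \<omega> @ [e'])" by auto
qed

lemma connector:
  obtains \<theta> where "\<theta> \<in> connectors" "\<theta> \<noteq> []" "successively A \<theta>" "A e (hd \<theta>)" "A (last \<theta>) e'"
proof -
  obtain \<theta> where t: "\<theta> \<in> connectors" "adm_word A ([e] @ \<theta> @ [e'])" using connectors(3) by blast
  moreover have "\<theta> \<noteq> []" using t(1) connectors(2) by (auto simp: all_words_def adm_word_def)
  ultimately show ?thesis using that[of \<theta>]
    by (auto simp: adm_word_iff successively_append_iff successively_Cons)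
qed

lemma has_successor: "\<exists>e'. A e e'"
  using connector[of e e] by metis

lemma exists_from: "\<exists>x\<in>X. x 0 = e"
proof -
  define x where "x = rec_nat e (\<lambda>_ y. SOME y'. A y y')"
  have "A (x i) (x (Suc i))" for i
    unfolding x_def using someI_ex[OF has_successor] by simp
  moreover have "x 0 = e" by (simp add: x_def)
  ultimately show ?thesis by (auto simp: shift_space_def)
qed

text \<open>Every letter has a successor, so an admissible word continues to a point of the space.
  This keeps the suprema over cylinders meaningful.\<close>

lemma cyl_nonempty: "successively A w \<Longrightarrow> cyl A w \<noteq> {}"
proof -
  assume w: "successively A w"
  obtain e where e: "w = [] \<or> A (last w) e" using has_successor by blast
  obtain x where x: "x \<in> X" "x 0 = e" using exists_from by blast
  have "concat_seq w x \<in> X" using w e x by (simp add: concat_in_shift_space)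
  then have "concat_seq w x \<in> cyl A w" by (simp add: mem_cyl_iff)
  then show ?thesis by blast
qed

end

section \<open>Bounded distortion of Birkhoff sums\<close>

locale holder_shift = irreducible_shift A for A :: "'e::countable \<Rightarrow> 'e \<Rightarrow> bool" +
  fixes \<alpha> :: real and f :: "(nat \<Rightarrow> 'e) \<Rightarrow> real"
  assumes alpha: "\<alpha> > 0" and hold: "holder_type A \<alpha> f"
begin

text \<open>A Holder constant of \<open>f\<close>, kept nonnegative. The index is shifted: agreement
  in the first letter alone already gives the bound \<open>V\<close>, and each further common letter
  gains a factor \<open>exp (- \<alpha>)\<close>.\<close>

definition V :: real where
  "V = (SOME C. C \<ge> 0 \<and> (\<forall>n. \<forall>x\<in>X. \<forall>y\<in>X. (\<forall>i<Suc n. x i = y i) \<longrightarrow> \<bar>f x - f y\<bar> \<le> C * exp (- \<alpha> * n)))"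

lemma V:
  "V \<ge> 0"
  "x \<in> X \<Longrightarrow> y \<in> X \<Longrightarrow> (\<And>i. i < Suc n \<Longrightarrow> x i = y i) \<Longrightarrow> \<bar>f x - f y\<bar> \<le> V * exp (- \<alpha> * n)"
proof -
  obtain C where C: "\<And>n x y. n \<ge> 1 \<Longrightarrow> x \<in> X \<Longrightarrow> y \<in> X \<Longrightarrow> (\<forall>i<n. x i = y i) \<Longrightarrow>
      norm (f x - f y) * exp (\<alpha> * (real n - 1)) \<le> C"
    using hold unfolding holder_type_def by blast
  have "\<exists>C. C \<ge> 0 \<and> (\<forall>n. \<forall>x\<in>X. \<forall>y\<in>X. (\<forall>i<Suc n. x i = y i) \<longrightarrow> \<bar>f x - f y\<bar> \<le> C * exp (- \<alpha> * n))"
  proof (intro exI[of _ "max C 0"] conjI allI ballI impI)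
    fix n x y assume "x \<in> X" "y \<in> X" "\<forall>i<Suc n. x i = y i"
    then have "\<bar>f x - f y\<bar> * exp (\<alpha> * real n) \<le> max C 0" using C[of "Suc n" x y] by simp
    then show "\<bar>f x - f y\<bar> \<le> max C 0 * exp (- \<alpha> * real n)"
      by (simp add: exp_minus divide_simps mult.commute)
  qed simp
  then have *: "V \<ge> 0 \<and> (\<forall>n. \<forall>x\<in>X. \<forall>y\<in>X. (\<forall>i<Suc n. x i = y i) \<longrightarrow> \<bar>f x - f y\<bar> \<le> V * exp (- \<alpha> * n))"
    unfolding V_def by (rule someI_ex)
  then show "V \<ge> 0" by blast
  show "x \<in> X \<Longrightarrow> y \<in> X \<Longrightarrow> (\<And>i. i < Suc n \<Longrightarrow> x i = y i) \<Longrightarrow> \<bar>f x - f y\<bar> \<le> V * exp (- \<alpha> * n)"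
    using * by blast
qed

text \<open>Value of the geometric series of Holder errors; it bounds the oscillation of Birkhoff
  sums over a cylinder, whatever the length of the word.\<close>

definition D :: real where
  "D = V / (1 - exp (- \<alpha>))"

lemma exp_alpha: "exp (- \<alpha>) < 1" "0 < exp (- \<alpha>)" using alpha by auto

lemma D_nonneg: "D \<ge> 0"
  using V(1) exp_alpha by (simp add: D_def)

lemma sum_exp_le_D: "(\<Sum>k<n. V * exp (- \<alpha> * real k)) \<le> D"
proof -
  have "(\<Sum>k<n. V * exp (- \<alpha> * real k)) = V * (\<Sum>k<n. exp (-\<alpha>) ^ k)"
    by (simp add: sum_distrib_left exp_of_nat_mult[symmetric] mult.commute)
  also have "(\<Sum>k<n. exp (-\<alpha>) ^ k) = (1 - exp (-\<alpha>) ^ n) / (1 - exp (-\<alpha>))"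
    using exp_alpha by (subst geometric_sum) (auto simp: divide_simps algebra_simps)
  also have "V * \<dots> \<le> V * (1 / (1 - exp (-\<alpha>)))"
    using exp_alpha V(1) by (intro mult_left_mono divide_right_mono) auto
  finally show ?thesis by (simp add: D_def)
qed

text \<open>Removing the first letter leaves two points of the shorter cylinder. The removed
  summands are taken at points that agree on the whole word, hence contribute the smallest error of
  the sum.\<close>

lemma birkhoff_distortion_aux:
  assumes "x \<in> cyl A w" "y \<in> cyl A w"
  shows "\<bar>birkhoff (length w) f x - birkhoff (length w) f y\<bar> \<le> (\<Sum>k<length w. V * exp (- \<alpha> * real k))"
  using assms
proof (induction w arbitrary: x y)
  case (Cons e w)
  have "\<bar>birkhoff (length w) f (shift x) - birkhoff (length w) f (shift y)\<bar>
      \<le> (\<Sum>k<length w. V * exp (- \<alpha> * real k))"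
    by (intro Cons.IH shift_in_cyl[OF Cons.prems(1)] shift_in_cyl[OF Cons.prems(2)])
  moreover have "\<bar>f x - f y\<bar> \<le> V * exp (- \<alpha> * real (length w))"
    using Cons.prems by (intro V(2)) (auto simp: cyl_def)
  ultimately show ?case by (simp add: birkhoff_Suc)
qed simp

lemma birkhoff_distortion:
  assumes "x \<in> cyl A w" "y \<in> cyl A w"
  shows "birkhoff (length w) f x \<le> birkhoff (length w) f y + D"
  using birkhoff_distortion_aux[OF assms] sum_exp_le_D[of "length w"] by linarith

text \<open>For an inadmissible word the supremum ranges over the empty set and carries no
  information; estimates of its value therefore assume an admissible word or a point of the
  cylinder.\<close>

definition S :: "'e list \<Rightarrow> real" where
  "S w = Sup (birkhoff (length w) f ` cyl A w)"

lemma bdd_above_birkhoff: "bdd_above (birkhoff (length w) f ` cyl A w)"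
proof (cases "cyl A w = {}")
  case False
  then obtain y where "y \<in> cyl A w" by blast
  then have "\<And>x. x \<in> cyl A w \<Longrightarrow> birkhoff (length w) f x \<le> birkhoff (length w) f y + D"
    by (rule birkhoff_distortion[rotated])
  then show ?thesis by (rule bdd_aboveI2)
qed simp

lemma birkhoff_le_S: "x \<in> cyl A w \<Longrightarrow> birkhoff (length w) f x \<le> S w"
  unfolding S_def by (intro cSUP_upper bdd_above_birkhoff)

lemma S_le_birkhoff: "x \<in> cyl A w \<Longrightarrow> S w \<le> birkhoff (length w) f x + D"
  unfolding S_def by (rule cSUP_least) (auto intro: birkhoff_distortion)

lemma S_append_le:
  assumes "successively A (u @ v)"
  shows "S (u @ v) \<le> S u + S v"
proof -
  have "birkhoff (length (u @ v)) f x \<le> S u + S v" if "x \<in> cyl A (u @ v)" for x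
    using birkhoff_le_S[of x u] birkhoff_le_S[OF shift_pow_in_cyl[OF that]] that cyl_append_subset
    by (fastforce simp: birkhoff_add)
  then show ?thesis unfolding S_def[of "u @ v"] using cyl_nonempty[OF assms]
    by (intro cSUP_least) auto
qed

text \<open>Both suprema are compared with the Birkhoff sums along one common point of the cylinder
  of \<open>u @ v\<close>, and each comparison costs \<open>D\<close>.\<close>

lemma S_append_ge:
  assumes "successively A (u @ v)"
  shows "S u + S v - 2 * D \<le> S (u @ v)"
proof -
  obtain x where x: "x \<in> cyl A (u @ v)" using cyl_nonempty[OF assms] by blast
  have "S u \<le> birkhoff (length u) f x + D" using x cyl_append_subset S_le_birkhoff by blast
  moreover have "S v \<le> birkhoff (length v) f ((shift ^^ length u) x) + D"
    using shift_pow_in_cyl[OF x] S_le_birkhoff by blast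
  ultimately show ?thesis using birkhoff_le_S[OF x] by (simp add: birkhoff_add)
qed

end

section \<open>The topology generated by cylinders\<close>

lemma topspace_shift_top [simp]: "topspace (shift_top A) = shift_space A"
  by (simp add: shift_top_def)

lemma openin_cyl: "openin (shift_top A) (cyl A w)"
proof -
  let ?P = "product_topology (\<lambda>_::nat. discrete_topology (UNIV::'a set)) UNIV"
  have 1: "openin ?P {x. x i = c}" for i c
  proof -
    have "openin ?P {x \<in> topspace ?P. x i \<in> {c}}"
      by (rule openin_continuous_map_preimage[OF continuous_map_product_projection]) auto
    then show ?thesis by simp
  qed
  have "openin ?P {x. \<forall>i<n. x i = w ! i}" for n
  proof (induction n)
    case 0
    then show ?case using openin_topspace[of ?P] by simp
  next
    case (Suc n)
    have "{x. \<forall>i<Suc n. x i = w ! i} = {x. \<forall>i<n. x i = w ! i} \<inter> {x. x n = w ! n}"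
      by (auto simp: less_Suc_eq)
    then show ?case using openin_Int[OF Suc 1] by simp
  qed
  moreover have "cyl A w = {x. \<forall>i<length w. x i = w ! i} \<inter> shift_space A" by (auto simp: cyl_def)
  ultimately show ?thesis unfolding shift_top_def openin_subtopology by blast
qed

text \<open>A basic open set of the product constrains finitely many coordinates, so a cylinder that
  fixes all of them lies inside it. Later proofs of openness use this criterion in place of the
  product topology.\<close>

lemma openin_shift_top_iff:
  "openin (shift_top A) U \<longleftrightarrow> U \<subseteq> shift_space A \<and> (\<forall>x\<in>U. \<exists>n. cyl A (pre n x) \<subseteq> U)"
proof (intro iffI conjI ballI)
  assume U: "openin (shift_top A) U"
  show "U \<subseteq> shift_space A" using openin_subset[OF U] by simp
  fix x assume x: "x \<in> U"
  let ?P = "product_topology (\<lambda>_::nat. discrete_topology (UNIV::'a set)) UNIV"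
  obtain W where W: "openin ?P W" "U = W \<inter> shift_space A"
    using U unfolding shift_top_def openin_subtopology by blast
  then obtain C where C: "finite {i. C i \<noteq> (UNIV :: 'a set)}" "x \<in> Pi\<^sub>E UNIV C" "Pi\<^sub>E UNIV C \<subseteq> W"
    using x unfolding openin_product_topology_alt by force
  obtain n where n: "\<forall>i\<in>{i. C i \<noteq> UNIV}. i < n"
    using finite_nat_set_iff_bounded[of "{i. C i \<noteq> UNIV}"] C(1) by blast
  have "y \<in> Pi\<^sub>E UNIV C" if "y \<in> cyl A (pre n x)" for y
  proof -
    have "y i \<in> C i" for i
    proof (cases "i < n")
      case True
      then have "y i = x i" using that by (simp add: cyl_def)
      then show ?thesis using C(2) by auto
    qed (use n in auto)
    then show ?thesis by auto
  qed
  then have "cyl A (pre n x) \<subseteq> U" using C(3) W(2) cyl_subset by blast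
  then show "\<exists>n. cyl A (pre n x) \<subseteq> U" ..
next
  assume *: "U \<subseteq> shift_space A \<and> (\<forall>x\<in>U. \<exists>n. cyl A (pre n x) \<subseteq> U)"
  then have "U = \<Union>{cyl A w |w. cyl A w \<subseteq> U}" using mem_cyl_pre by fastforce
  moreover have "openin (shift_top A) (\<Union>{cyl A w |w. cyl A w \<subseteq> U})"
    by (rule openin_Union) (auto simp: openin_cyl)
  ultimately show "openin (shift_top A) U" by simp
qed

text \<open>A countable alphabet has countably many words, hence every open set is a countable union
  of cylinders.\<close>

lemma borel_sets_eq_cylinders:
  "borel_sets_of (shift_top (A :: 'e::countable \<Rightarrow> 'e \<Rightarrow> bool)) = sigma_sets (shift_space A) (range (cyl A))"
proof -
  have "sigma_sets (shift_space A) {U. openin (shift_top A) U} = sigma_sets (shift_space A) (range (cyl A))"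
  proof (rule sigma_sets_eqI)
    fix U assume "U \<in> {U. openin (shift_top A) U}"
    then have "U = \<Union>(cyl A ` {w. cyl A w \<subseteq> U})"
      using mem_cyl_pre unfolding openin_shift_top_iff by fastforce
    moreover have "\<Union>(cyl A ` {w. cyl A w \<subseteq> U}) \<in> sigma_sets (shift_space A) (range (cyl A))"
    proof -
      interpret sigma_algebra "shift_space A" "sigma_sets (shift_space A) (range (cyl A))"
        by (rule sigma_algebra_sigma_sets) (use cyl_subset in auto)
      show ?thesis by (rule countable_UN) auto
    qed
    ultimately show "U \<in> sigma_sets (shift_space A) (range (cyl A))" by simp
  next
    fix C assume "C \<in> range (cyl A)"
    then show "C \<in> sigma_sets (shift_space A) {U. openin (shift_top A) U}"
      using openin_cyl by auto
  qed
  then show ?thesis by (simp add: borel_sets_of_def)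
qed

text \<open>Two cylinders are nested or disjoint. This pi-system serves the uniqueness argument
  behind the invariance of the equilibrium state.\<close>

lemma Int_stable_cylinders: "Int_stable (insert {} (range (cyl A)))"
proof (rule Int_stableI)
  have sub: "cyl A u \<inter> cyl A v \<in> insert {} (range (cyl A))" if "length u \<le> length v" for u v
  proof (cases "take (length u) v = u")
    case True
    then have "v = u @ drop (length u) v" by (metis append_take_drop_id)
    then have "cyl A v \<subseteq> cyl A u" using cyl_append_subset by metis
    then show ?thesis by (simp add: Int_absorb1)
  next
    case False
    have "cyl A u \<inter> cyl A v = {}"
    proof (rule equals0I)
      fix x assume "x \<in> cyl A u \<inter> cyl A v"
      then have "pre (length u) x = u" "pre (length v) x = v" by (auto simp: mem_cyl_iff)
      then show False using False that take_pre by metis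
    qed
    then show ?thesis by simp
  qed
  fix a b assume "a \<in> insert {} (range (cyl A))" "b \<in> insert {} (range (cyl A))"
  then consider "a \<inter> b = {}" | u v where "a = cyl A u" "b = cyl A v" by auto
  then show "a \<inter> b \<in> insert {} (range (cyl A))"
  proof cases
    case 2
    then show ?thesis using sub[of u v] sub[of v u] by (metis Int_commute nle_le)
  qed simp
qed

text \<open>Supplies test functions for the conformality hypothesis, which speaks of complex
  functions. If at least \<open>N\<close> coordinates agree, both points lie on the same side of the
  cut-off; if fewer agree, the weight is at most \<open>exp (\<alpha> * N)\<close> and the crude
  bound \<open>2 * \<bar>M\<bar>\<close> for the difference suffices.\<close>

lemma holder_space_restrict:
  fixes h :: "(nat \<Rightarrow> 'e) \<Rightarrow> real"
  assumes a: "\<alpha> > 0" and h: "holder_space A \<alpha> h"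
    and Q: "\<And>x y. x \<in> shift_space A \<Longrightarrow> y \<in> shift_space A \<Longrightarrow> (\<And>i. i < N \<Longrightarrow> x i = y i) \<Longrightarrow> x \<in> Q \<Longrightarrow> y \<in> Q"
  shows "holder_space A \<alpha> (\<lambda>x. complex_of_real (if x \<in> Q then h x else 0))"
proof -
  obtain M where M: "\<And>x. x \<in> shift_space A \<Longrightarrow> \<bar>h x\<bar> \<le> M"
    using h unfolding holder_space_def by auto
  obtain C where C: "\<And>n x y. n \<ge> 1 \<Longrightarrow> x \<in> shift_space A \<Longrightarrow> y \<in> shift_space A \<Longrightarrow> (\<forall>i<n. x i = y i) \<Longrightarrow>
      norm (h x - h y) * exp (\<alpha> * (real n - 1)) \<le> C"
    using h unfolding holder_space_def holder_type_def by blast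
  let ?g = "\<lambda>x. if x \<in> Q then h x else 0"
  have M': "\<bar>?g x\<bar> \<le> \<bar>M\<bar>" if "x \<in> shift_space A" for x using M[OF that] by auto
  have "norm (complex_of_real (?g x) - complex_of_real (?g y)) * exp (\<alpha> * (real n - 1))
      \<le> \<bar>C\<bar> + 2 * \<bar>M\<bar> * exp (\<alpha> * N)"
    if n: "n \<ge> 1" and x: "x \<in> shift_space A" and y: "y \<in> shift_space A" and xy: "\<forall>i<n. x i = y i" for n x y
  proof -
    have eq: "norm (complex_of_real (?g x) - complex_of_real (?g y)) = \<bar>?g x - ?g y\<bar>"
      by (metis norm_of_real of_real_diff)
    show ?thesis
    proof (cases "n \<ge> N")
      case True
      then have "x \<in> Q \<longleftrightarrow> y \<in> Q" using Q[of x y] Q[of y x] x y xy by auto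
      then have "\<bar>?g x - ?g y\<bar> \<le> \<bar>h x - h y\<bar>" by auto
      then have "\<bar>?g x - ?g y\<bar> * exp (\<alpha> * (real n - 1)) \<le> \<bar>h x - h y\<bar> * exp (\<alpha> * (real n - 1))"
        by (intro mult_right_mono) auto
      also have "\<dots> \<le> C" using C[OF n x y xy] by simp
      also have "\<dots> \<le> \<bar>C\<bar> + 2 * \<bar>M\<bar> * exp (\<alpha> * N)" by (simp add: add_increasing2)
      finally show ?thesis unfolding eq .
    next
      case False
      then have "\<alpha> * (real n - 1) \<le> \<alpha> * N" using a by (intro mult_left_mono) auto
      moreover have "\<bar>?g x - ?g y\<bar> \<le> 2 * \<bar>M\<bar>"
        using M'[OF x] M'[OF y] by linarith
      ultimately have "\<bar>?g x - ?g y\<bar> * exp (\<alpha> * (real n - 1)) \<le> 2 * \<bar>M\<bar> * exp (\<alpha> * N)"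
        by (intro mult_mono) auto
      then show ?thesis unfolding eq by linarith
    qed
  qed
  then have "holder_type A \<alpha> (\<lambda>x. complex_of_real (?g x))" unfolding holder_type_def by blast
  moreover have "norm (complex_of_real (?g x)) \<le> \<bar>M\<bar>" if "x \<in> shift_space A" for x
    using M'[OF that] by (simp only: norm_of_real)
  ultimately show ?thesis unfolding holder_space_def by blast
qed

section \<open>The Gibbs property of the conformal measure\<close>

locale conformal_shift = holder_shift A \<alpha> f
  for A :: "'e::countable \<Rightarrow> 'e \<Rightarrow> bool" and \<alpha> :: real and f :: "(nat \<Rightarrow> 'e) \<Rightarrow> real" +
  fixes \<delta> :: real and m :: "(nat \<Rightarrow> 'e) measure"
  assumes delta: "\<delta> > 0"
    and m_prob: "prob_space m"
    and space_m: "space m = shift_space A"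
    and sets_m: "sets m = borel_sets_of (shift_top A)"
    and m_conf: "\<And>g :: (nat \<Rightarrow> 'e) \<Rightarrow> complex. holder_space A \<alpha> g \<Longrightarrow>
                   (\<integral>\<rho>. transfer_op A \<delta> f g \<rho> \<partial>m) = (\<integral>\<rho>. g \<rho> \<partial>m)"
begin

sublocale prob_space m by (rule m_prob)

lemma open_measurable: "openin (shift_top A) U \<Longrightarrow> U \<in> sets m"
  by (auto simp: sets_m borel_sets_of_def)

lemma cyl_measurable [measurable]: "cyl A w \<in> sets m"
  by (rule open_measurable[OF openin_cyl])

lemma continuous_measurable:
  fixes g :: "(nat \<Rightarrow> 'e) \<Rightarrow> real"
  assumes "\<And>x \<epsilon>. x \<in> X \<Longrightarrow> \<epsilon> > 0 \<Longrightarrow> \<exists>n. \<forall>y\<in>cyl A (pre n x). \<bar>g y - g x\<bar> < \<epsilon>"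
  shows "g \<in> borel_measurable m"
proof (rule borel_measurableI)
  fix W :: "real set" assume W: "open W"
  have "openin (shift_top A) (g -` W \<inter> X)"
    unfolding openin_shift_top_iff
  proof (intro conjI ballI)
    fix x assume x: "x \<in> g -` W \<inter> X"
    then obtain \<epsilon> where e: "\<epsilon> > 0" "\<And>t. dist t (g x) < \<epsilon> \<Longrightarrow> t \<in> W"
      using W unfolding open_dist by blast
    obtain n where "\<forall>y\<in>cyl A (pre n x). \<bar>g y - g x\<bar> < \<epsilon>" using assms x e(1) by blast
    then have "cyl A (pre n x) \<subseteq> g -` W \<inter> X" using e(2) by (auto simp: dist_real_def mem_cyl_iff)
    then show "\<exists>n. cyl A (pre n x) \<subseteq> g -` W \<inter> X" ..
  qed simp
  then show "g -` W \<inter> space m \<in> sets m" using open_measurable by (simp add: space_m)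
qed

lemma exp_alpha_small: "\<epsilon> > 0 \<Longrightarrow> \<exists>n. C * exp (- \<alpha> * real n) < \<epsilon>"
proof -
  assume e: "\<epsilon> > 0"
  have "(\<lambda>n. C * exp (- \<alpha>) ^ n) \<longlonglongrightarrow> C * 0"
    using exp_alpha by (intro tendsto_intros LIMSEQ_realpow_zero) auto
  then have "eventually (\<lambda>n. C * exp (- \<alpha>) ^ n < \<epsilon>) sequentially"
    using e by (intro order_tendstoD(2)) auto
  then obtain n where "C * exp (- \<alpha>) ^ n < \<epsilon>" by (auto simp: eventually_sequentially)
  then show ?thesis by (auto simp: exp_of_nat_mult[symmetric] mult.commute)
qed

lemma holder_measurable:
  fixes g :: "(nat \<Rightarrow> 'e) \<Rightarrow> real"
  assumes "holder_type A \<alpha> g"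
  shows "g \<in> borel_measurable m"
proof (rule continuous_measurable)
  interpret g: holder_shift A \<alpha> g by unfold_locales (use alpha assms in auto)
  fix x \<epsilon> assume x: "x \<in> X" and e: "(\<epsilon>::real) > 0"
  obtain n where n: "g.V * exp (- \<alpha> * real n) < \<epsilon>" using exp_alpha_small[OF e] by blast
  have "\<bar>g y - g x\<bar> < \<epsilon>" if "y \<in> cyl A (pre (Suc n) x)" for y
  proof -
    have "\<bar>g y - g x\<bar> \<le> g.V * exp (- \<alpha> * real n)"
      using that x by (intro g.V(2)) (auto simp: cyl_def)
    then show ?thesis using n by linarith
  qed
  then show "\<exists>n. \<forall>y\<in>cyl A (pre n x). \<bar>g y - g x\<bar> < \<epsilon>" by blast
qed

text \<open>On the shift space this is the image of the indicator of the cylinder of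
  \<open>e # w\<close> under the transfer operator: only the branch \<open>e\<close>
  contributes.\<close>

definition branch_weight :: "'e \<Rightarrow> 'e list \<Rightarrow> (nat \<Rightarrow> 'e) \<Rightarrow> real" where
  "branch_weight e w \<rho> = (if A e (\<rho> 0) \<and> \<rho> \<in> cyl A w then exp (\<delta> * f (concat_seq [e] \<rho>)) else 0)"

text \<open>Both conditions are settled by finitely many coordinates, and where they hold the weight
  inherits continuity from \<open>f\<close>.\<close>

lemma branch_weight_measurable [measurable]: "branch_weight e w \<in> borel_measurable m"
proof (rule continuous_measurable)
  fix x \<epsilon> assume x: "x \<in> X" and e: "(\<epsilon>::real) > 0"
  have same: "A e (y 0) \<and> y \<in> cyl A w \<longleftrightarrow> A e (x 0) \<and> x \<in> cyl A w"
    if "y \<in> cyl A (pre n x)" "n \<ge> Suc (length w)" for y n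
    using that x by (auto simp: cyl_def)
  show "\<exists>n. \<forall>y\<in>cyl A (pre n x). \<bar>branch_weight e w y - branch_weight e w x\<bar> < \<epsilon>"
  proof (cases "A e (x 0) \<and> x \<in> cyl A w")
    case False
    then have "\<forall>y\<in>cyl A (pre (Suc (length w)) x). \<bar>branch_weight e w y - branch_weight e w x\<bar> < \<epsilon>"
      using same e by (auto simp: branch_weight_def)
    then show ?thesis ..
  next
    case True
    have "isCont (\<lambda>t. exp (\<delta> * t)) (f (concat_seq [e] x))" by (intro continuous_intros)
    then obtain d where d: "d > 0" "\<And>t. \<bar>t - f (concat_seq [e] x)\<bar> < d \<Longrightarrow>
        \<bar>exp (\<delta> * t) - exp (\<delta> * f (concat_seq [e] x))\<bar> < \<epsilon>"
      using e unfolding continuous_at_eps_delta dist_real_def by blast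
    obtain n where n: "V * exp (- \<alpha> * real n) < d" using exp_alpha_small[OF d(1)] by blast
    have "\<bar>branch_weight e w y - branch_weight e w x\<bar> < \<epsilon>"
      if y: "y \<in> cyl A (pre (max n (Suc (length w))) x)" for y
    proof -
      have Y: "A e (y 0) \<and> y \<in> cyl A w" using same[OF y] True by simp
      have "concat_seq [e] y \<in> X" "concat_seq [e] x \<in> X"
        using y x Y True by (auto simp: concat_in_shift_space mem_cyl_iff)
      then have "\<bar>f (concat_seq [e] y) - f (concat_seq [e] x)\<bar> \<le> V * exp (- \<alpha> * real n)"
        using y by (intro V(2)) (auto simp: cyl_def concat_seq_def)
      then have "\<bar>exp (\<delta> * f (concat_seq [e] y)) - exp (\<delta> * f (concat_seq [e] x))\<bar> < \<epsilon>"
        using d n by auto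
      then show ?thesis using Y True by (simp add: branch_weight_def)
    qed
    then show ?thesis by blast
  qed
qed

lemma holder_space_indicator:
  "holder_space A \<alpha> (\<lambda>x. complex_of_real (indicator (cyl A w) x))"
proof -
  have "holder_space A \<alpha> (\<lambda>x. complex_of_real (if x \<in> cyl A w then 1 else 0))"
    by (rule holder_space_restrict[OF alpha, where N = "length w"])
      (auto simp: holder_space_def holder_type_def cyl_def intro: exI[of _ 1] exI[of _ 0])
  then show ?thesis by (simp add: indicator_def of_bool_def)
qed

lemma infsum_single:
  assumes "\<And>j. j \<in> Q \<Longrightarrow> j \<noteq> i \<Longrightarrow> g j = 0"
  shows "infsum g Q = (if i \<in> Q then g i else 0)"
proof -
  have "infsum g Q = infsum g (Q \<inter> {i})"
    by (rule infsum_cong_neutral) (use assms in auto)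
  then show ?thesis by auto
qed

text \<open>Conformality tested on the indicator of a cylinder. The identity strips one letter off a
  word, and the Gibbs estimates are obtained by iterating it.\<close>

lemma measure_cyl_Cons: "measure m (cyl A (e # w)) = (\<integral>\<rho>. branch_weight e w \<rho> \<partial>m)"
proof -
  have eq: "transfer_op A \<delta> f (\<lambda>x. complex_of_real (indicator (cyl A (e # w)) x)) \<rho>
      = complex_of_real (branch_weight e w \<rho>)" if "\<rho> \<in> X" for \<rho>
    unfolding transfer_op_def
    by (subst infsum_single[where i = e])
      (use that in \<open>auto simp: concat_in_cyl_iff indicator_def branch_weight_def\<close>)
  have "complex_of_real (measure m (cyl A (e # w)))
      = (\<integral>x. complex_of_real (indicator (cyl A (e # w)) x) \<partial>m)"
    by (subst integral_complex_of_real) (simp add: Int_absorb2 cyl_subset space_m)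
  also have "\<dots> = (\<integral>\<rho>. transfer_op A \<delta> f (\<lambda>x. complex_of_real (indicator (cyl A (e # w)) x)) \<rho> \<partial>m)"
    by (rule m_conf[OF holder_space_indicator, symmetric])
  also have "\<dots> = (\<integral>\<rho>. complex_of_real (branch_weight e w \<rho>) \<partial>m)"
    by (rule Bochner_Integration.integral_cong) (simp_all add: eq space_m)
  also have "\<dots> = complex_of_real (\<integral>\<rho>. branch_weight e w \<rho> \<partial>m)"
    by (rule integral_complex_of_real)
  finally show ?thesis by (simp only: of_real_eq_iff)
qed

lemma measure_X [simp]: "measure m X = 1"
  using prob_space by (simp add: space_m)

lemma branch_weight_bounds:
  assumes "x \<in> cyl A (e # w)" "\<rho> \<in> cyl A w" "A e (\<rho> 0)"
  shows "f (concat_seq [e] \<rho>) \<le> f x + V * exp (- \<alpha> * real (length w))"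
    "f x - V * exp (- \<alpha> * real (length w)) \<le> f (concat_seq [e] \<rho>)"
proof -
  have "concat_seq [e] \<rho> \<in> cyl A (e # w)"
    using assms cyl_subset by (subst concat_in_cyl_iff) auto
  then have "\<bar>f (concat_seq [e] \<rho>) - f x\<bar> \<le> V * exp (- \<alpha> * real (length w))"
    using assms(1) by (intro V(2)) (auto simp: cyl_def)
  then show "f (concat_seq [e] \<rho>) \<le> f x + V * exp (- \<alpha> * real (length w))"
    "f x - V * exp (- \<alpha> * real (length w)) \<le> f (concat_seq [e] \<rho>)" by linarith+
qed

lemma branch_weight_le:
  assumes "x \<in> cyl A (e # w)"
  shows "branch_weight e w \<rho> \<le> exp (\<delta> * (f x + V * exp (- \<alpha> * real (length w)))) * indicator (cyl A w) \<rho>"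
  using branch_weight_bounds(1)[OF assms, of \<rho>] delta
  by (auto simp: branch_weight_def indicator_def)

lemma branch_weight_integrable: "x \<in> cyl A (e # w) \<Longrightarrow> integrable m (branch_weight e w)"
proof (rule integrable_const_bound[where B = "exp (\<delta> * (f x + V * exp (- \<alpha> * real (length w))))"])
  assume x: "x \<in> cyl A (e # w)"
  have "\<bar>branch_weight e w \<rho>\<bar> \<le> exp (\<delta> * (f x + V * exp (- \<alpha> * real (length w))))" for \<rho>
  proof -
    have "0 \<le> branch_weight e w \<rho>" by (simp add: branch_weight_def)
    moreover have "exp (\<delta> * (f x + V * exp (- \<alpha> * real (length w)))) * indicator (cyl A w) \<rho>
        \<le> exp (\<delta> * (f x + V * exp (- \<alpha> * real (length w))))" by (simp add: indicator_def)
    ultimately show ?thesis using branch_weight_le[OF x, of \<rho>] by linarith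
  qed
  then show "AE \<rho> in m. norm (branch_weight e w \<rho>) \<le> exp (\<delta> * (f x + V * exp (- \<alpha> * real (length w))))"
    by simp
qed simp

lemma measure_cyl_Cons_le:
  assumes "x \<in> cyl A (e # w)"
  shows "measure m (cyl A (e # w)) \<le> exp (\<delta> * (f x + V * exp (- \<alpha> * real (length w)))) * measure m (cyl A w)"
proof -
  have "measure m (cyl A (e # w)) \<le>
      (\<integral>\<rho>. exp (\<delta> * (f x + V * exp (- \<alpha> * real (length w)))) * indicator (cyl A w) \<rho> \<partial>m)"
    unfolding measure_cyl_Cons
    by (rule integral_mono[OF branch_weight_integrable[OF assms]])
      (use branch_weight_le[OF assms] in \<open>auto simp: emeasure_eq_measure\<close>)
  then show ?thesis by (simp add: Int_absorb2 cyl_subset space_m)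
qed

text \<open>\<open>Q\<close> is left free for two uses: the cylinder of a nonempty \<open>w\<close>,
  where \<open>e\<close> is automatically admissible if \<open>e # w\<close> is, and for empty
  \<open>w\<close> the set of points that may follow \<open>e\<close>, which can be smaller than the
  whole space.\<close>

lemma measure_cyl_Cons_ge:
  assumes "x \<in> cyl A (e # w)" "Q \<subseteq> cyl A w" "\<And>\<rho>. \<rho> \<in> Q \<Longrightarrow> A e (\<rho> 0)" "Q \<in> sets m"
  shows "exp (\<delta> * (f x - V * exp (- \<alpha> * real (length w)))) * measure m Q \<le> measure m (cyl A (e # w))"
proof -
  have "exp (\<delta> * (f x - V * exp (- \<alpha> * real (length w)))) * indicator Q \<rho> \<le> branch_weight e w \<rho>" for \<rho>
    using branch_weight_bounds(2)[OF assms(1), of \<rho>] assms(2,3) delta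
    by (auto simp: branch_weight_def indicator_def)
  then have "(\<integral>\<rho>. exp (\<delta> * (f x - V * exp (- \<alpha> * real (length w)))) * indicator Q \<rho> \<partial>m)
      \<le> measure m (cyl A (e # w))"
    unfolding measure_cyl_Cons
    by (intro integral_mono branch_weight_integrable[OF assms(1)]) (auto simp: emeasure_eq_measure assms(4))
  moreover have "Q \<inter> space m = Q" using assms(4) sets.sets_into_space by blast
  ultimately show ?thesis by simp
qed

lemma measure_cyl_pos_Cons:
  assumes "successively A (e # w)" "w \<noteq> []" "measure m (cyl A w) > 0"
  shows "measure m (cyl A (e # w)) > 0"
proof -
  obtain x where x: "x \<in> cyl A (e # w)" using cyl_nonempty[OF assms(1)] by blast
  have "A e (\<rho> 0)" if "\<rho> \<in> cyl A w" for \<rho>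
    using that assms(1,2) by (cases w) (auto simp: cyl_def)
  then have "exp (\<delta> * (f x - V * exp (- \<alpha> * real (length w)))) * measure m (cyl A w) \<le> measure m (cyl A (e # w))"
    by (intro measure_cyl_Cons_ge[OF x]) auto
  moreover have "exp (\<delta> * (f x - V * exp (- \<alpha> * real (length w)))) * measure m (cyl A w) > 0"
    using assms(3) by simp
  ultimately show ?thesis by linarith
qed

lemma measure_cyl_pos_append:
  "successively A (u @ v) \<Longrightarrow> v \<noteq> [] \<Longrightarrow> measure m (cyl A v) > 0 \<Longrightarrow> measure m (cyl A (u @ v)) > 0"
  by (induction u) (auto intro!: measure_cyl_pos_Cons simp: successively_Cons)

text \<open>Countably many null cylinders cannot cover a space of mass 1.\<close>

lemma exists_charged_letter: "\<exists>e. measure m (cyl A [e]) > 0"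
proof (rule ccontr)
  assume "\<nexists>e. measure m (cyl A [e]) > 0"
  then have "emeasure m (cyl A [e]) = 0" for e by (simp add: emeasure_eq_measure zero_less_measure_iff)
  then have "cyl A [e] \<in> null_sets m" for e by (intro null_setsI) auto
  then have "(\<Union>e. cyl A [e]) \<in> null_sets m" by (intro null_sets_UN) auto
  then have "emeasure m (\<Union>e. cyl A [e]) = 0" by auto
  moreover have "(\<Union>e. cyl A [e]) = space m" by (auto simp: space_m cyl_def)
  ultimately show False using emeasure_space_1 by simp
qed

text \<open>The mass of the set of admissible successors of a letter is bounded below over the
  (possibly infinite) alphabet because it contains one of finitely many cylinders.\<close>

lemma successor_mass: "\<exists>\<kappa>>0. \<forall>e. \<kappa> \<le> measure m {\<rho>\<in>X. A e (\<rho> 0)}"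
proof -
  obtain e0 where e0: "measure m (cyl A [e0]) > 0" using exists_charged_letter by blast
  let ?T = "{\<theta>\<in>connectors. successively A (\<theta> @ [e0])}"
  let ?K = "(\<lambda>\<theta>. measure m (cyl A (\<theta> @ [e0]))) ` ?T"
  have fin: "finite ?K" using connectors(1) by simp
  have ne: "?K \<noteq> {}"
    by (rule connector[of e0 e0]) (auto simp: successively_append_iff)
  have "\<forall>k\<in>?K. k > 0" using e0 measure_cyl_pos_append by auto
  then have "Min ?K > 0" using fin ne by simp
  moreover have "Min ?K \<le> measure m {\<rho>\<in>X. A e (\<rho> 0)}" for e
  proof -
    obtain \<theta> where t: "\<theta> \<in> connectors" "\<theta> \<noteq> []" "successively A \<theta>" "A e (hd \<theta>)" "A (last \<theta>) e0"
      by (rule connector)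
    have "Min ?K \<le> measure m (cyl A (\<theta> @ [e0]))"
      using t by (intro Min_le fin) (auto simp: successively_append_iff)
    also have "\<dots> \<le> measure m {\<rho>\<in>X. A e (\<rho> 0)}"
    proof (rule finite_measure_mono)
      show "cyl A (\<theta> @ [e0]) \<subseteq> {\<rho>\<in>X. A e (\<rho> 0)}"
        using t(2,4) by (cases \<theta>) (auto simp: cyl_def)
      have "openin (shift_top A) {\<rho>\<in>X. A e (\<rho> 0)}"
        unfolding openin_shift_top_iff by (auto simp: cyl_def intro: exI[of _ 1])
      then show "{\<rho>\<in>X. A e (\<rho> 0)} \<in> sets m" by (rule open_measurable)
    qed
    finally show ?thesis .
  qed
  ultimately show ?thesis by blast
qed

text \<open>Stripping a letter in front of a remaining word of length k costs the Holder error of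
  index k, so the errors form a geometric series instead of growing with the length.\<close>

lemma measure_cyl_le_aux:
  "x \<in> cyl A w \<Longrightarrow>
     measure m (cyl A w) \<le> exp (\<delta> * (birkhoff (length w) f x + (\<Sum>k<length w. V * exp (- \<alpha> * real k))))"
proof (induction w arbitrary: x)
  case (Cons e w)
  let ?s = "birkhoff (length w) f (shift x) + (\<Sum>k<length w. V * exp (- \<alpha> * real k))"
  have "measure m (cyl A (e # w)) \<le> exp (\<delta> * (f x + V * exp (- \<alpha> * real (length w)))) * measure m (cyl A w)"
    by (rule measure_cyl_Cons_le[OF Cons.prems])
  also have "\<dots> \<le> exp (\<delta> * (f x + V * exp (- \<alpha> * real (length w)))) * exp (\<delta> * ?s)"
    by (intro mult_left_mono Cons.IH[OF shift_in_cyl[OF Cons.prems]]) auto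
  also have "\<dots> = exp (\<delta> * (f x + V * exp (- \<alpha> * real (length w)) + ?s))"
    by (simp add: exp_add[symmetric] distrib_left)
  finally show ?case by (simp add: birkhoff_Suc algebra_simps)
qed simp

text \<open>The same iteration from below. The successor mass \<open>\<kappa>\<close> enters once,
  at the last letter; each earlier letter is followed by a prescribed admissible one, so its branch
  is defined on the whole remaining cylinder.\<close>

lemma measure_cyl_ge_aux:
  assumes "\<And>e. \<kappa> \<le> measure m {\<rho>\<in>X. A e (\<rho> 0)}" "w \<noteq> []"
  shows "x \<in> cyl A w \<Longrightarrow>
     \<kappa> * exp (\<delta> * (birkhoff (length w) f x - (\<Sum>k<length w. V * exp (- \<alpha> * real k)))) \<le> measure m (cyl A w)"
  using assms(2)
proof (induction w arbitrary: x rule: list_nonempty_induct)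
  case (single e)
  have "openin (shift_top A) {\<rho>\<in>X. A e (\<rho> 0)}"
    unfolding openin_shift_top_iff by (auto simp: cyl_def intro: exI[of _ 1])
  then have "{\<rho>\<in>X. A e (\<rho> 0)} \<in> sets m" by (rule open_measurable)
  then have "exp (\<delta> * (f x - V * exp (- \<alpha> * real (length ([] :: 'e list))))) * measure m {\<rho>\<in>X. A e (\<rho> 0)}
      \<le> measure m (cyl A [e])"
    by (intro measure_cyl_Cons_ge[OF single(1)]) auto
  then have "exp (\<delta> * (f x - V)) * measure m {\<rho>\<in>X. A e (\<rho> 0)} \<le> measure m (cyl A [e])" by simp
  moreover have "exp (\<delta> * (f x - V)) * \<kappa> \<le> exp (\<delta> * (f x - V)) * measure m {\<rho>\<in>X. A e (\<rho> 0)}"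
    by (intro mult_left_mono assms(1)) auto
  ultimately have "exp (\<delta> * (f x - V)) * \<kappa> \<le> measure m (cyl A [e])" by linarith
  then show ?case by (simp add: birkhoff_Suc mult.commute)
next
  case (cons e w)
  let ?s = "birkhoff (length w) f (shift x) - (\<Sum>k<length w. V * exp (- \<alpha> * real k))"
  have "successively A (e # w)" using cons.prems cyl_empty by blast
  then have "A e (\<rho> 0)" if "\<rho> \<in> cyl A w" for \<rho>
    using that cons.hyps by (cases w) (auto simp: cyl_def)
  then have *: "exp (\<delta> * (f x - V * exp (- \<alpha> * real (length w)))) * measure m (cyl A w) \<le> measure m (cyl A (e # w))"
    by (intro measure_cyl_Cons_ge[OF cons.prems]) auto
  have "\<kappa> * exp (\<delta> * (f x - V * exp (- \<alpha> * real (length w)) + ?s))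
      = exp (\<delta> * (f x - V * exp (- \<alpha> * real (length w)))) * (\<kappa> * exp (\<delta> * ?s))"
    by (simp add: exp_add distrib_left)
  also have "\<dots> \<le> exp (\<delta> * (f x - V * exp (- \<alpha> * real (length w)))) * measure m (cyl A w)"
    by (intro mult_left_mono cons.IH shift_in_cyl[OF cons.prems]) auto
  also note *
  finally show ?case by (simp add: birkhoff_Suc algebra_simps)
qed

lemma S_Nil [simp]: "S [] = 0"
  using cyl_nonempty[of "[]"] by (simp add: S_def)

text \<open>Upper constant of the Gibbs property; its lower counterpart is
  \<open>gk\<close>.\<close>

definition gK :: real where "gK = exp (\<delta> * D)"

lemma gK_pos: "gK > 0" by (simp add: gK_def)

lemma measure_cyl_le: "measure m (cyl A w) \<le> gK * exp (\<delta> * S w)"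
proof (cases "cyl A w = {}")
  case False
  then obtain x where x: "x \<in> cyl A w" by blast
  have "\<delta> * (birkhoff (length w) f x + (\<Sum>k<length w. V * exp (- \<alpha> * real k))) \<le> \<delta> * (S w + D)"
    using birkhoff_le_S[OF x] sum_exp_le_D[of "length w"] delta by (intro mult_left_mono) auto
  then have "exp (\<delta> * (birkhoff (length w) f x + (\<Sum>k<length w. V * exp (- \<alpha> * real k)))) \<le> exp (\<delta> * (S w + D))"
    by simp
  then have "measure m (cyl A w) \<le> exp (\<delta> * (S w + D))" by (rule order_trans[OF measure_cyl_le_aux[OF x]])
  then show ?thesis by (simp add: gK_def exp_add[symmetric] algebra_simps)
qed (use gK_pos in simp)

lemma measure_cyl_ge_ex: "\<exists>k>0. \<forall>w. successively A w \<longrightarrow> k * exp (\<delta> * S w) \<le> measure m (cyl A w)"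
proof -
  obtain \<kappa> where k: "\<kappa> > 0" "\<And>e. \<kappa> \<le> measure m {\<rho>\<in>X. A e (\<rho> 0)}" using successor_mass by blast
  \<comment> \<open>Used for the empty word, whose cylinder is the whole space of mass 1 and for
    which \<open>S [] = 0\<close>.\<close>
  have k1: "\<kappa> \<le> 1" using k(2) prob_le_1 order_trans by blast
  have "\<kappa> * exp (- \<delta> * (2 * D)) * exp (\<delta> * S w) \<le> measure m (cyl A w)" if w: "successively A w" for w
  proof (cases "w = []")
    case True
    have "\<kappa> * exp (- \<delta> * (2 * D)) \<le> 1 * 1"
      using k k1 D_nonneg delta by (intro mult_mono) auto
    then show ?thesis using True by simp
  next
    case False
    obtain x where x: "x \<in> cyl A w" using cyl_nonempty[OF w] by blast
    \<comment> \<open>One \<open>D\<close> pays for passing from the supremum to the point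
      \<open>x\<close>, the other for the accumulated Holder errors.\<close>
    have "- \<delta> * (2 * D) + \<delta> * S w \<le> \<delta> * (birkhoff (length w) f x - (\<Sum>k<length w. V * exp (- \<alpha> * real k)))"
    proof -
      have "- (2 * D) + S w \<le> birkhoff (length w) f x - (\<Sum>k<length w. V * exp (- \<alpha> * real k))"
        using S_le_birkhoff[OF x] sum_exp_le_D[of "length w"] by linarith
      then have "\<delta> * (- (2 * D) + S w) \<le> \<delta> * (birkhoff (length w) f x - (\<Sum>k<length w. V * exp (- \<alpha> * real k)))"
        using delta by (intro mult_left_mono) auto
      then show ?thesis by (simp add: algebra_simps)
    qed
    then have "\<kappa> * exp (- \<delta> * (2 * D) + \<delta> * S w)
        \<le> \<kappa> * exp (\<delta> * (birkhoff (length w) f x - (\<Sum>k<length w. V * exp (- \<alpha> * real k))))"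
      using k(1) by (intro mult_left_mono) auto
    also have "\<dots> \<le> measure m (cyl A w)" by (rule measure_cyl_ge_aux[OF k(2) False x])
    finally show ?thesis by (simp add: exp_add[symmetric] mult.assoc)
  qed
  then show ?thesis using k(1) by (intro exI[of _ "\<kappa> * exp (- \<delta> * (2 * D))"]) auto
qed

definition gk :: real where
  "gk = (SOME k. k > 0 \<and> (\<forall>w. successively A w \<longrightarrow> k * exp (\<delta> * S w) \<le> measure m (cyl A w)))"

lemma gk_pos: "gk > 0" and measure_cyl_ge: "successively A w \<Longrightarrow> gk * exp (\<delta> * S w) \<le> measure m (cyl A w)"
  using someI_ex[OF measure_cyl_ge_ex, folded gk_def] by blast+

lemma measure_cyl_pos: "successively A w \<Longrightarrow> measure m (cyl A w) > 0"
  using measure_cyl_ge[of w] gk_pos by (meson exp_gt_zero less_le_trans mult_pos_pos)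

end

section \<open>Exponential decay of cylinders\<close>

context conformal_shift
begin

lemma sum_measure_cyl_le:
  assumes "finite F" "\<And>v. v \<in> F \<Longrightarrow> length v = n"
  shows "(\<Sum>v\<in>F. measure m (cyl A v)) \<le> 1"
proof -
  have "(\<Sum>v\<in>F. measure m (cyl A v)) = measure m (\<Union>v\<in>F. cyl A v)"
  proof (rule finite_measure_finite_Union[symmetric])
    show "disjoint_family_on (cyl A) F"
      unfolding disjoint_family_on_def by (metis assms(2) cyl_disjoint)
  qed (use assms in auto)
  then show ?thesis by simp
qed

text \<open>The Gibbs bounds turn masses into exponentials of \<open>S\<close>, whose defect of
  additivity is at most \<open>2 * D\<close>. Hence a prescribed admissible continuation takes a
  proportion of a cylinder that does not depend on the cylinder.\<close>

lemma quasi_bernoulli_ge: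
  "\<exists>q>0. \<forall>u v. successively A (u @ v) \<longrightarrow> q * measure m (cyl A u) * measure m (cyl A v) \<le> measure m (cyl A (u @ v))"
proof -
  have "gk * exp (- \<delta> * (2 * D)) / gK\<^sup>2 * measure m (cyl A u) * measure m (cyl A v) \<le> measure m (cyl A (u @ v))"
    if uv: "successively A (u @ v)" for u v
  proof -
    have "measure m (cyl A u) * measure m (cyl A v) \<le> (gK * exp (\<delta> * S u)) * (gK * exp (\<delta> * S v))"
      using gK_pos by (intro mult_mono measure_cyl_le) auto
    also have "\<dots> = gK\<^sup>2 * exp (\<delta> * (S u + S v))"
      by (simp add: power2_eq_square distrib_left exp_add)
    finally have "gk * exp (- \<delta> * (2 * D)) * (measure m (cyl A u) * measure m (cyl A v))
        \<le> gk * exp (- \<delta> * (2 * D)) * (gK\<^sup>2 * exp (\<delta> * (S u + S v)))"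
      using gk_pos by (intro mult_left_mono) auto
    also have "\<dots> = gK\<^sup>2 * (gk * exp (\<delta> * (S u + S v - 2 * D)))"
      by (simp add: right_diff_distrib exp_add[symmetric])
    also have "\<dots> \<le> gK\<^sup>2 * (gk * exp (\<delta> * S (u @ v)))"
      using gk_pos delta S_append_ge[OF uv] by (intro mult_left_mono) auto
    also have "\<dots> \<le> gK\<^sup>2 * measure m (cyl A (u @ v))"
      using measure_cyl_ge[OF uv] by (intro mult_left_mono) auto
    finally show ?thesis using gK_pos by (simp add: field_simps)
  qed
  then show ?thesis using gk_pos gK_pos by (intro exI[of _ "gk * exp (- \<delta> * (2 * D)) / gK\<^sup>2"]) auto
qed

text \<open>Comes from subadditivity of \<open>S\<close>. It decouples the last letter of a word
  from the rest, which the overshoot estimate relies on.\<close>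

lemma quasi_bernoulli_le:
  "measure m (cyl A (u @ v)) \<le> gK / gk\<^sup>2 * measure m (cyl A u) * measure m (cyl A v)"
proof (cases "successively A (u @ v)")
  case True
  then have u: "successively A u" and v: "successively A v" by (auto simp: successively_append_iff)
  have "gk\<^sup>2 * measure m (cyl A (u @ v)) \<le> gk\<^sup>2 * (gK * exp (\<delta> * S (u @ v)))"
    by (intro mult_left_mono measure_cyl_le) auto
  also have "\<dots> \<le> gk\<^sup>2 * (gK * exp (\<delta> * (S u + S v)))"
    using gK_pos S_append_le[OF True] delta by (intro mult_left_mono) auto
  also have "\<dots> = gK * ((gk * exp (\<delta> * S u)) * (gk * exp (\<delta> * S v)))"
    by (simp add: power2_eq_square distrib_left exp_add)
  also have "\<dots> \<le> gK * (measure m (cyl A u) * measure m (cyl A v))"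
    using gK_pos gk_pos by (intro mult_left_mono mult_mono measure_cyl_ge u v) auto
  finally show ?thesis using gk_pos by (simp add: field_simps)
next
  case False
  have "0 \<le> gK / gk\<^sup>2 * measure m (cyl A u) * measure m (cyl A v)"
    using gK_pos by (intro mult_nonneg_nonneg) auto
  then show ?thesis using False by (simp add: cyl_empty)
qed

text \<open>From the end of \<open>w\<close> a connector leads to \<open>b\<close>, where two
  continuations are possible. A word \<open>v\<close> long enough to decide between them misses at
  least one; the missed cylinder is disjoint from that of \<open>w @ v\<close> and takes a fixed
  proportion of the mass of \<open>w\<close>.\<close>

lemma branching_contraction:
  assumes b: "A b b1" "A b b2" "b1 \<noteq> b2"
  shows "\<exists>\<theta> q. 0 < \<theta> \<and> \<theta> < 1 \<and> q > 0 \<and>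
    (\<forall>w v. w \<noteq> [] \<longrightarrow> length v = q \<longrightarrow> measure m (cyl A (w @ v)) \<le> \<theta> * measure m (cyl A w))"
proof -
  obtain k where k: "k > 0" "\<And>u v. successively A (u @ v) \<Longrightarrow>
      k * measure m (cyl A u) * measure m (cyl A v) \<le> measure m (cyl A (u @ v))"
    using quasi_bernoulli_ge by blast
  let ?P = "{v \<in> (\<lambda>t. t @ [b, b1]) ` connectors \<union> (\<lambda>t. t @ [b, b2]) ` connectors. successively A v}"
  \<comment> \<open>The inserted \<open>1 / (2 * k)\<close> forces \<open>\<epsilon>\<close> to be
    at most 1/2, so that the contraction factor \<open>1 - \<epsilon>\<close> stays
    positive.\<close>
  let ?K = "insert (1 / (2 * k)) ((\<lambda>v. measure m (cyl A v)) ` ?P)"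
  define \<epsilon> where "\<epsilon> = k * Min ?K"
  \<comment> \<open>Longest connector plus the branching letter and its successor.\<close>
  define q where "q = 2 + Max (insert 0 (length ` connectors))"
  have fin: "finite ?K" using connectors(1) by simp
  have "Min ?K > 0" using fin k(1) by (auto simp: measure_cyl_pos)
  then have eps: "\<epsilon> > 0" using k(1) by (simp add: \<epsilon>_def)
  have "Min ?K \<le> 1 / (2 * k)" by (intro Min_le fin) auto
  then have eps1: "\<epsilon> \<le> 1/2" using k(1) by (simp add: \<epsilon>_def field_simps)
  have main: "measure m (cyl A (w @ v)) \<le> (1 - \<epsilon>) * measure m (cyl A w)"
    if w: "w \<noteq> []" and v: "length v = q" for w v
  proof (cases "successively A w")
    case False
    then have "cyl A w = {}" "cyl A (w @ v) = {}"
      by (auto simp: cyl_empty successively_append_iff)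
    then show ?thesis by simp
  next
    case True
    obtain t where t: "t \<in> connectors" "t \<noteq> []" "successively A t" "A (last w) (hd t)" "A (last t) b"
      by (rule connector)
    have lt: "length t + 2 \<le> q"
      using t(1) connectors(1) by (auto simp: q_def intro!: Max_ge)
    have *: "measure m (cyl A (w @ v)) \<le> (1 - \<epsilon>) * measure m (cyl A w)"
      if c: "A b c" and cP: "t @ [b, c] \<in> ?P" and ne: "take (length t + 2) v \<noteq> t @ [b, c]" for c
    proof -
      let ?u = "t @ [b, c]"
      have s: "successively A (w @ ?u)" using True t c
        by (auto simp: successively_append_iff)
      have dis: "cyl A (w @ v) \<inter> cyl A (w @ ?u) = {}"
      proof -
        have "cyl A (w @ v) \<subseteq> cyl A (w @ take (length t + 2) v)"
          using cyl_append_subset[of A "w @ take (length t + 2) v" "drop (length t + 2) v"] by simp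
        moreover have "cyl A (w @ take (length t + 2) v) \<inter> cyl A (w @ ?u) = {}"
          using ne v lt by (intro cyl_disjoint) auto
        ultimately show ?thesis by blast
      qed
      have "\<epsilon> \<le> k * measure m (cyl A ?u)"
        unfolding \<epsilon>_def using k(1) cP by (intro mult_left_mono Min_le fin) auto
      then have "\<epsilon> * measure m (cyl A w) \<le> k * measure m (cyl A ?u) * measure m (cyl A w)"
        by (intro mult_right_mono) auto
      also have "\<dots> \<le> measure m (cyl A (w @ ?u))" using k(2)[OF s] by (simp add: ac_simps)
      finally have "\<epsilon> * measure m (cyl A w) \<le> measure m (cyl A (w @ ?u))" .
      moreover have "measure m (cyl A (w @ v)) + measure m (cyl A (w @ ?u)) \<le> measure m (cyl A w)"
      proof -
        have "measure m (cyl A (w @ v)) + measure m (cyl A (w @ ?u)) = measure m (cyl A (w @ v) \<union> cyl A (w @ ?u))"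
          by (rule finite_measure_Union[symmetric]) (use dis in auto)
        also have "\<dots> \<le> measure m (cyl A w)"
          by (intro finite_measure_mono Un_least cyl_append_subset) auto
        finally show ?thesis .
      qed
      ultimately show ?thesis by (simp add: algebra_simps)
    qed
    have P: "t @ [b, b1] \<in> ?P" "t @ [b, b2] \<in> ?P" using t b by (auto simp: successively_append_iff)
    have "take (length t + 2) v \<noteq> t @ [b, b1] \<or> take (length t + 2) v \<noteq> t @ [b, b2]" using b(3) by auto
    then show ?thesis using *[OF b(1) P(1)] *[OF b(2) P(2)] by blast
  qed
  show ?thesis
    by (rule exI[of _ "1 - \<epsilon>"], rule exI[of _ q]) (use eps eps1 main in \<open>auto simp: q_def\<close>)
qed

text \<open>The contraction is iterated on blocks of \<open>q\<close> letters, the first letter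
  being spared because the contraction applies to nonempty words only. The lower Gibbs bound
  converts decay of mass into linear decay of \<open>S\<close>.\<close>

lemma branching_decay:
  assumes b: "A b b1" "A b b2" "b1 \<noteq> b2"
  shows "\<exists>c>0. \<exists>C. \<forall>w. successively A w \<longrightarrow> S w \<le> C - c * real (length w)"
proof -
  obtain \<theta> q where t: "0 < \<theta>" "\<theta> < 1" "q > 0"
    and contr: "\<And>w v. w \<noteq> [] \<Longrightarrow> length v = q \<Longrightarrow> measure m (cyl A (w @ v)) \<le> \<theta> * measure m (cyl A w)"
    using branching_contraction[OF b] by blast
  have bound: "w \<noteq> [] \<Longrightarrow> measure m (cyl A w) \<le> \<theta> ^ ((length w - 1) div q)" for w
  proof (induction "length w" arbitrary: w rule: less_induct)
    case less
    show ?case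
    proof (cases "length w \<le> q")
      case True
      then have "(length w - 1) div q = 0" using t(3) less.prems by (cases w) auto
      then show ?thesis by simp
    next
      case False
      let ?u = "take (length w - q) w" and ?v = "drop (length w - q) w"
      have u: "?u \<noteq> []" "length ?u = length w - q" "length ?v = q" using False by auto
      have "measure m (cyl A (?u @ ?v)) \<le> \<theta> * measure m (cyl A ?u)" by (rule contr) (use u in auto)
      also have "\<dots> \<le> \<theta> * \<theta> ^ ((length ?u - 1) div q)"
        using t False u by (intro mult_left_mono less.hyps) auto
      also have "\<dots> = \<theta> ^ Suc ((length ?u - 1) div q)" by simp
      also have "Suc ((length ?u - 1) div q) = (length w - 1) div q"
      proof -
        have "length w - 1 = (length ?u - 1) + q" using False u by simp
        then have "(length w - 1) div q = (length ?u - 1 + q) div q" by (simp only:)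
        also have "\<dots> = (length ?u - 1) div q + 1" by (rule div_add_self2) (use t(3) in simp)
        finally show ?thesis by simp
      qed
      finally show ?thesis by simp
    qed
  qed
  define c where "c = - ln \<theta> / (q * \<delta>)"
  \<comment> \<open>The absolute value keeps \<open>C\<close> nonnegative, as the empty word
    demands; the two factors \<open>\<theta>\<close> cover the spared letter and the rounding to
    whole blocks.\<close>
  define C where "C = \<bar>(- ln gk - 2 * ln \<theta>) / \<delta>\<bar>"
  have lt: "ln \<theta> < 0" using t by simp
  have "c > 0" unfolding c_def using t delta lt by (intro divide_pos_pos) auto
  moreover have "S w \<le> C - c * length w" if w: "successively A w" for w
  proof (cases "w = []")
    case True
    then show ?thesis by (simp add: C_def)
  next
    case False
    let ?k = "(length w - 1) div q"
    have "gk * exp (\<delta> * S w) \<le> \<theta> ^ ?k"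
      using measure_cyl_ge[OF w] bound[OF False] by linarith
    then have "ln (gk * exp (\<delta> * S w)) \<le> ln (\<theta> ^ ?k)"
      using gk_pos t by (subst ln_le_cancel_iff) auto
    then have 1: "ln gk + \<delta> * S w \<le> real ?k * ln \<theta>"
      using gk_pos t by (simp add: ln_mult ln_realpow)
    have "length w - 1 < (?k + 1) * q" using t(3)
      by (metis Suc_eq_plus1 dividend_less_div_times mult.commute mult_Suc_right add.commute)
    then have "length w \<le> (?k + 1) * q" by linarith
    then have "real (length w) \<le> (real ?k + 1) * real q"
      by (metis of_nat_1 of_nat_add of_nat_le_iff of_nat_mult)
    then have "real (length w) / q - 1 \<le> real ?k" using t(3) by (simp add: field_simps)
    then have "real ?k * ln \<theta> \<le> (real (length w) / q - 2) * ln \<theta>"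
      using lt by (intro mult_right_mono_neg) auto
    with 1 have "\<delta> * S w \<le> (- ln gk - 2 * ln \<theta>) + real (length w) / q * ln \<theta>"
      by (simp add: algebra_simps)
    then have "S w \<le> ((- ln gk - 2 * ln \<theta>) + real (length w) / q * ln \<theta>) / \<delta>"
      using delta by (simp add: field_simps)
    also have "\<dots> = (- ln gk - 2 * ln \<theta>) / \<delta> - c * length w"
      using delta t(3) by (simp add: c_def field_simps)
    also have "\<dots> \<le> C - c * length w" unfolding C_def by (intro diff_right_mono abs_ge_self)
    finally show ?thesis .
  qed
  ultimately show ?thesis by blast
qed

text \<open>The lower Gibbs bound against total mass 1. This holds with or without branching, so it
  is available in the deterministic case as well.\<close>

lemma S_bounded_above: "\<exists>C\<ge>0. \<forall>w. successively A w \<longrightarrow> S w \<le> C"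
proof -
  have "S w \<le> \<bar>- ln gk / \<delta>\<bar>" if "successively A w" for w
  proof -
    have "gk * exp (\<delta> * S w) \<le> 1" using measure_cyl_ge[OF that] prob_le_1 order_trans by blast
    then have "ln (gk * exp (\<delta> * S w)) \<le> ln 1"
      using gk_pos by (subst ln_le_cancel_iff) auto
    then have "\<delta> * S w \<le> - ln gk" using gk_pos by (simp add: ln_mult)
    then have "S w \<le> - ln gk / \<delta>" using delta by (simp add: field_simps)
    then show ?thesis by linarith
  qed
  then show ?thesis by (intro exI[of _ "\<bar>- ln gk / \<delta>\<bar>"]) auto
qed

end

section \<open>Pressure\<close>

text \<open>Subadditivity is asked for at positive indices only, since there are no admissible words
  of length 0 and the logarithm of that partition function is meaningless.\<close>

lemma fekete:
  fixes a :: "nat \<Rightarrow> real"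
  assumes sub: "\<And>m n. m > 0 \<Longrightarrow> n > 0 \<Longrightarrow> a (m + n) \<le> a m + a n"
  shows "(\<lambda>n. ereal (a (Suc n) / real (Suc n))) \<longlonglongrightarrow> (INF n. ereal (a (Suc n) / real (Suc n)))"
proof (rule order_tendstoI)
  fix r assume "r < (INF n. ereal (a (Suc n) / real (Suc n)))"
  then show "eventually (\<lambda>n. r < ereal (a (Suc n) / real (Suc n))) sequentially"
    by (intro always_eventually allI) (rule less_le_trans, assumption, rule INF_lower, simp)
next
  fix r assume "(INF n. ereal (a (Suc n) / real (Suc n))) < r"
  then obtain k' where "ereal (a (Suc k') / real (Suc k')) < r" by (auto simp: INF_less_iff)
  then obtain k where k: "k > 0" "ereal (a k / real k) < r" by blast
  obtain s where s: "a k / real k < s" "ereal s < r"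
    using ereal_dense2[OF k(2)] by (metis ereal_less(2) less_ereal.simps(1))
  \<comment> \<open>Value 0 at index 0 extends subadditivity to all indices, so that division by
    \<open>k\<close> may leave remainder 0.\<close>
  define b where "b n = (if n = 0 then 0 else a n)" for n
  have bsub: "b (m + n) \<le> b m + b n" for m n
    using sub[of m n] by (auto simp: b_def)
  have bmul: "b (q * k) \<le> q * b k" for q
  proof (induction q)
    case (Suc q)
    then show ?case using bsub[of k "q * k"] by (simp add: algebra_simps)
  qed (simp add: b_def)
  define M where "M = Max ((\<lambda>j. \<bar>b j\<bar>) ` {..<k})"
  have M: "\<bar>b j\<bar> \<le> M" if "j < k" for j unfolding M_def using that by (intro Max_ge) auto
  \<comment> \<open>Division with remainder: \<open>M\<close> bounds the remainder term, and
    \<open>\<bar>b k\<bar>\<close> the change from the integer quotient to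
    \<open>n / k\<close>.\<close>
  have bound: "b n \<le> n * (b k / k) + (M + \<bar>b k\<bar>)" for n
  proof -
    have "b n = b (n div k * k + n mod k)" by simp
    also have "\<dots> \<le> real (n div k) * b k + b (n mod k)"
      using bsub[of "n div k * k" "n mod k"] bmul[of "n div k"] by linarith
    also have "b (n mod k) \<le> M" using M[of "n mod k"] k(1) by auto
    also have "real (n div k) * b k \<le> n * (b k / k) + \<bar>b k\<bar>"
    proof -
      have "real n = real (n div k) * k + real (n mod k)"
        by (metis div_mult_mod_eq of_nat_add of_nat_mult)
      then have "n * (b k / k) = real (n div k) * b k + real (n mod k) * (b k / k)"
        using k(1) by (simp add: field_simps)
      moreover have "\<bar>real (n mod k) * (b k / k)\<bar> \<le> \<bar>b k\<bar>"
      proof -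
        have "real (n mod k) \<le> k" using k(1) by simp
        then have "real (n mod k) * (\<bar>b k\<bar> / k) \<le> k * (\<bar>b k\<bar> / k)" by (intro mult_right_mono) auto
        then show ?thesis using k(1) by (simp add: abs_mult)
      qed
      ultimately show ?thesis by linarith
    qed
    finally show ?thesis by linarith
  qed
  have "(\<lambda>n. b k / k + (M + \<bar>b k\<bar>) / real (Suc n)) \<longlonglongrightarrow> b k / k + 0"
    by (intro tendsto_intros LIMSEQ_Suc lim_const_over_n)
  then have "eventually (\<lambda>n. b k / k + (M + \<bar>b k\<bar>) / real (Suc n) < s) sequentially"
    using s k by (intro order_tendstoD(2)) (auto simp: b_def)
  then show "eventually (\<lambda>n. ereal (a (Suc n) / real (Suc n)) < r) sequentially"
  proof eventually_elim
    case (elim n)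
    have "a (Suc n) / real (Suc n) \<le> (real (Suc n) * (b k / k) + (M + \<bar>b k\<bar>)) / real (Suc n)"
      using bound[of "Suc n"] by (intro divide_right_mono) (auto simp: b_def)
    also have "\<dots> = b k / k + (M + \<bar>b k\<bar>) / real (Suc n)"
      by (subst add_divide_distrib) simp
    finally have "a (Suc n) / real (Suc n) \<le> b k / k + (M + \<bar>b k\<bar>) / real (Suc n)" .
    then have "ereal (a (Suc n) / real (Suc n)) < ereal s" using elim by simp
    then show ?case using s(2) by (rule less_trans)
  qed
qed

lemma infsum_ennreal_le:
  fixes g :: "'a \<Rightarrow> ennreal"
  assumes "\<And>F. finite F \<Longrightarrow> F \<subseteq> Q \<Longrightarrow> sum g F \<le> B"
  shows "infsum g Q \<le> B"
  unfolding nonneg_infsum_complete[OF zero_le] by (auto intro!: SUP_least assms)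

lemma sum_le_infsum_ennreal:
  fixes g :: "'a \<Rightarrow> ennreal"
  assumes "finite F" "F \<subseteq> Q"
  shows "sum g F \<le> infsum g Q"
  unfolding nonneg_infsum_complete[OF zero_le] using assms by (auto intro!: SUP_upper)

section \<open>Partition functions and convergence to the pressure\<close>

context holder_shift
begin

lemma Sup_birkhoff_scale:
  assumes "x > 0" "successively A w"
  shows "Sup (birkhoff (length w) (\<lambda>\<rho>. x * f \<rho>) ` cyl A w) = x * S w"
proof (rule cSup_eq_non_empty)
  show "birkhoff (length w) (\<lambda>\<rho>. x * f \<rho>) ` cyl A w \<noteq> {}" using cyl_nonempty[OF assms(2)] by simp
  show "z \<le> x * S w" if "z \<in> birkhoff (length w) (\<lambda>\<rho>. x * f \<rho>) ` cyl A w" for z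
    using that birkhoff_le_S assms(1) by (auto simp: birkhoff_scale)
  fix y assume y: "\<And>z. z \<in> birkhoff (length w) (\<lambda>\<rho>. x * f \<rho>) ` cyl A w \<Longrightarrow> z \<le> y"
  have "S w \<le> y / x" unfolding S_def
    using y assms(1) cyl_nonempty[OF assms(2)]
    by (intro cSUP_least) (auto simp: birkhoff_scale field_simps)
  then show "x * S w \<le> y" using assms(1) by (simp add: field_simps)
qed

lemma partition_fun_eq:
  assumes "x > 0"
  shows "partition_fun A (\<lambda>\<rho>. x * f \<rho>) n = (\<Sum>\<^sub>\<infinity>w\<in>words A n. ennreal (exp (x * S w)))"
  unfolding partition_fun_def
  by (rule infsum_cong) (use assms Sup_birkhoff_scale in \<open>auto simp: words_def adm_word_iff\<close>)

lemma words_nonempty: "n > 0 \<Longrightarrow> \<exists>w. w \<in> words A n"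
proof -
  assume n: "n > 0"
  obtain x where "x \<in> X" using exists_from by blast
  then have "pre n x \<in> words A n"
    using n by (auto simp: words_def adm_word_iff successively_pre simp flip: length_greater_0_conv)
  then show ?thesis ..
qed

lemma partition_fun_pos:
  assumes "x > 0" "n > 0"
  shows "0 < partition_fun A (\<lambda>\<rho>. x * f \<rho>) n"
proof -
  obtain w where w: "w \<in> words A n" using words_nonempty[OF assms(2)] by blast
  have "(\<Sum>w\<in>{w}. ennreal (exp (x * S w))) \<le> (\<Sum>\<^sub>\<infinity>w\<in>words A n. ennreal (exp (x * S w)))"
    using w by (intro sum_le_infsum_ennreal) auto
  moreover have "0 < (\<Sum>w\<in>{w}. ennreal (exp (x * S w)))" by simp
  ultimately show ?thesis unfolding partition_fun_eq[OF assms(1)] by (rule less_le_trans[rotated])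
qed

text \<open>Cutting a word after \<open>p\<close> letters is injective into pairs of words, and
  \<open>S\<close> is subadditive under the cut. Finite sums suffice, as sums in
  \<open>ennreal\<close> are suprema of finite ones.\<close>

lemma partition_fun_submult:
  assumes x: "x > 0" and "p > 0" "n > 0"
  shows "partition_fun A (\<lambda>\<rho>. x * f \<rho>) (p + n)
    \<le> partition_fun A (\<lambda>\<rho>. x * f \<rho>) p * partition_fun A (\<lambda>\<rho>. x * f \<rho>) n"
  unfolding partition_fun_eq[OF x]
proof (rule infsum_ennreal_le)
  fix F assume F: "finite F" "F \<subseteq> words A (p + n)"
  let ?g = "\<lambda>w. ennreal (exp (x * S w))"
  let ?U = "take p ` F" and ?W = "drop p ` F"
  have "sum ?g F \<le> (\<Sum>w\<in>F. ?g (take p w) * ?g (drop p w))"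
  proof (rule sum_mono)
    fix w assume "w \<in> F"
    then have "successively A (take p w @ drop p w)" using F by (auto simp: words_def adm_word_iff)
    then have "S w \<le> S (take p w) + S (drop p w)" using S_append_le by fastforce
    then have "exp (x * S w) \<le> exp (x * S (take p w)) * exp (x * S (drop p w))"
      using x by (simp add: exp_add[symmetric] distrib_left[symmetric])
    then show "?g w \<le> ?g (take p w) * ?g (drop p w)"
      by (simp add: ennreal_mult[symmetric] ennreal_leI)
  qed
  also have "\<dots> = (\<Sum>(u, v)\<in>(\<lambda>w. (take p w, drop p w)) ` F. ?g u * ?g v)"
  proof -
    have "inj_on (\<lambda>w. (take p w, drop p w)) F"
      by (rule inj_onI) (metis append_take_drop_id prod.inject)
    then show ?thesis by (simp add: sum.reindex o_def)
  qed
  also have "\<dots> \<le> (\<Sum>(u, v)\<in>?U \<times> ?W. ?g u * ?g v)"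
    using F(1) by (intro sum_mono2) auto
  also have "\<dots> = sum ?g ?U * sum ?g ?W"
    by (simp only: sum_product sum.cartesian_product)
  also have "\<dots> \<le> infsum ?g (words A p) * infsum ?g (words A n)"
  proof (intro mult_mono sum_le_infsum_ennreal)
    show "?U \<subseteq> words A p" "?W \<subseteq> words A n"
    proof -
      have "take p w \<in> words A p \<and> drop p w \<in> words A n" if "w \<in> words A (p + n)" for w
      proof -
        have "successively A (take p w @ drop p w)" "length w = p + n"
          using that by (auto simp: words_def adm_word_iff)
        then show ?thesis using assms(2,3) unfolding successively_append_iff
          by (auto simp: words_def adm_word_iff)
      qed
      then show "?U \<subseteq> words A p" "?W \<subseteq> words A n" using F(2) by auto
    qed
  qed (use F in auto)
  finally show "sum ?g F \<le> infsum ?g (words A p) * infsum ?g (words A n)" .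
qed

text \<open>Each single letter is prolonged by a tail that takes only finitely many values, so
  \<open>S\<close> changes by a bounded amount and the sum over letters is dominated by a multiple
  of the sum over words of length \<open>Suc n\<close>.\<close>

lemma partition_fun_infinite:
  assumes x: "x > 0" and Z1: "partition_fun A (\<lambda>\<rho>. x * f \<rho>) 1 = \<infinity>"
  shows "partition_fun A (\<lambda>\<rho>. x * f \<rho>) (Suc n) = \<infinity>"
proof -
  let ?g = "\<lambda>w. ennreal (exp (x * S w))"
  obtain y where y: "y \<in> X" using exists_from by blast
  \<comment> \<open>A connector leading to a fixed point \<open>y\<close>, followed by
    \<open>y\<close> and cut to \<open>n\<close> letters. It depends on the letter only through the
    connector, whence the uniform bound \<open>l\<close>.\<close>
  define tail where "tail t = pre n (concat_seq t y)" for t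
  define l where "l = Min (insert 0 ((\<lambda>t. S (tail t)) ` connectors))"
  have l: "l \<le> S (tail t)" if "t \<in> connectors" for t
    unfolding l_def using that connectors(1) by (intro Min_le) auto
  define t where "t e = (SOME t. t \<in> connectors \<and> successively A t \<and> t \<noteq> [] \<and> A e (hd t) \<and> A (last t) (y 0))" for e
  have t: "t e \<in> connectors \<and> successively A (t e) \<and> t e \<noteq> [] \<and> A e (hd (t e)) \<and> A (last (t e)) (y 0)" for e
    unfolding t_def by (rule someI_ex) (metis connector)
  define ext where "ext w = w @ tail (t (hd w))" for w
  have w1: "ext w \<in> words A (Suc n) \<and> S w + l - 2 * D \<le> S (ext w)" if w: "w \<in> words A 1" for w
  proof -
    obtain e where e: "w = [e]" using w by (auto simp: words_def length_Suc_conv)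
    have "concat_seq (e # t e) y \<in> X"
      using t[of e] y by (auto simp: concat_in_shift_space successively_Cons)
    moreover have "pre (Suc n) (concat_seq (e # t e) y) = ext w"
      unfolding pre_eq_iff
      by (auto simp: e ext_def tail_def less_Suc_eq_0_disj)
    ultimately have s: "successively A (ext w)" using successively_pre by metis
    have "S w + S (tail (t (hd w))) - 2 * D \<le> S (ext w)"
      using S_append_ge s by (simp add: ext_def)
    then show ?thesis using l[of "t (hd w)"] t s e
      by (force simp: words_def adm_word_iff ext_def tail_def)
  qed
  have "partition_fun A (\<lambda>\<rho>. x * f \<rho>) 1 \<le>
      ennreal (exp (x * (2 * D - l))) * partition_fun A (\<lambda>\<rho>. x * f \<rho>) (Suc n)"
    unfolding partition_fun_eq[OF x]
  proof (rule infsum_ennreal_le)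
    fix F assume F: "finite F" "F \<subseteq> words A 1"
    have inj: "inj_on ext F"
    proof (rule inj_onI)
      fix u v assume uv: "u \<in> F" "v \<in> F" "ext u = ext v"
      then have "length u = 1" "length v = 1" using F(2) by (auto simp: words_def)
      with uv(3) show "u = v" by (simp add: ext_def append_eq_append_conv)
    qed
    have "sum ?g F \<le> (\<Sum>w\<in>F. ennreal (exp (x * (2 * D - l))) * ?g (ext w))"
    proof (rule sum_mono)
      fix w assume "w \<in> F"
      then have "S w \<le> (2 * D - l) + S (ext w)" using w1 F(2) by force
      then have "x * S w \<le> x * (2 * D - l) + x * S (ext w)"
        using x by (metis distrib_left mult_le_cancel_left_pos)
      then have "exp (x * S w) \<le> exp (x * (2 * D - l)) * exp (x * S (ext w))"
        by (simp add: exp_add[symmetric])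
      then show "?g w \<le> ennreal (exp (x * (2 * D - l))) * ?g (ext w)"
        by (simp add: ennreal_mult[symmetric] ennreal_leI)
    qed
    also have "\<dots> = ennreal (exp (x * (2 * D - l))) * (\<Sum>w\<in>ext ` F. ?g w)"
      by (simp only: sum_distrib_left sum.reindex[OF inj] o_def)
    also have "\<dots> \<le> ennreal (exp (x * (2 * D - l))) * infsum ?g (words A (Suc n))"
      using F w1 by (intro mult_left_mono sum_le_infsum_ennreal) auto
    finally show "sum ?g F \<le> ennreal (exp (x * (2 * D - l))) * infsum ?g (words A (Suc n))" .
  qed
  then have "ennreal (exp (x * (2 * D - l))) * partition_fun A (\<lambda>\<rho>. x * f \<rho>) (Suc n) = top"
    unfolding Z1 by (simp add: top_unique)
  then show ?thesis by (simp add: ennreal_mult_eq_top_iff)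
qed

text \<open>Used in contraposition: finite pressure at a parameter gives summability over letters at
  that parameter.\<close>

lemma pressure_infinite:
  assumes "x > 0" "partition_fun A (\<lambda>\<rho>. x * f \<rho>) 1 = \<infinity>"
  shows "pressure A (\<lambda>\<rho>. x * f \<rho>) = \<infinity>"
proof -
  have "pressure_term A (\<lambda>\<rho>. x * f \<rho>) (Suc n) = \<infinity>" for n
    using partition_fun_infinite[OF assms] by (simp add: pressure_term_def)
  then show ?thesis unfolding pressure_def by (simp add: limI)
qed

lemma pressure_term_finite:
  assumes "x > 0" "partition_fun A (\<lambda>\<rho>. x * f \<rho>) (Suc n) \<noteq> \<infinity>"
  shows "pressure_term A (\<lambda>\<rho>. x * f \<rho>) (Suc n) = ereal (ln (enn2real (partition_fun A (\<lambda>\<rho>. x * f \<rho>) (Suc n))) / real (Suc n))"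
  using assms partition_fun_pos[of x "Suc n"] by (auto simp: pressure_term_def Let_def)

text \<open>The pressure is defined by \<open>lim\<close>, so a bound on its terms says something
  only after convergence is known; Fekete supplies it, and the logarithm of a bounded partition
  function divided by the length tends to at most 0.\<close>

lemma pressure_le_0:
  assumes x: "x > 0" and Z: "\<And>n. partition_fun A (\<lambda>\<rho>. x * f \<rho>) (Suc n) \<le> ennreal K"
  shows "pressure A (\<lambda>\<rho>. x * f \<rho>) \<le> 0"
proof -
  let ?Z = "partition_fun A (\<lambda>\<rho>. x * f \<rho>)"
  have fin: "?Z (Suc n) \<noteq> \<infinity>" for n using Z[of n] by (auto simp: top_unique)
  define a where "a n = ln (enn2real (?Z n))" for n
  have pos: "enn2real (?Z n) > 0" if "n > 0" for n
    using that partition_fun_pos[OF x that] fin[of "n - 1"] by (simp add: enn2real_positive_iff top.not_eq_extremum)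
  have sub: "a (p + n) \<le> a p + a n" if "p > 0" "n > 0" for p n
  proof -
    have "enn2real (?Z (p + n)) \<le> enn2real (?Z p * ?Z n)"
      using that fin[of "p - 1"] fin[of "n - 1"]
      by (intro enn2real_mono partition_fun_submult x) (auto simp: ennreal_mult_less_top top.not_eq_extremum)
    then have "a (p + n) \<le> ln (enn2real (?Z p) * enn2real (?Z n))" 
      unfolding a_def enn2real_mult using pos that by (subst ln_le_cancel_iff) auto
    also have "\<dots> = a p + a n"
      unfolding a_def using pos[OF that(1)] pos[OF that(2)] by (subst ln_mult) auto
    finally show ?thesis .
  qed
  have eq: "pressure_term A (\<lambda>\<rho>. x * f \<rho>) (Suc n) = ereal (a (Suc n) / real (Suc n))" for n
    using pressure_term_finite[OF x fin] by (simp add: a_def)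
  have lim: "(\<lambda>n. pressure_term A (\<lambda>\<rho>. x * f \<rho>) (Suc n)) \<longlonglongrightarrow> (INF n. ereal (a (Suc n) / real (Suc n)))"
    unfolding eq by (rule fekete) (rule sub)
  have "pressure_term A (\<lambda>\<rho>. x * f \<rho>) (Suc n) \<le> ereal (ln K / real (Suc n))" for n
  proof -
    have "enn2real (?Z (Suc n)) \<le> K"
    proof -
      have "K > 0" using Z[of n] partition_fun_pos[OF x, of "Suc n"]
        by (metis ennreal_neg le_zero_eq linorder_not_le not_gr_zero zero_less_Suc)
      then show ?thesis using Z[of n] by (simp add: enn2real_leI)
    qed
    then have "a (Suc n) \<le> ln K" unfolding a_def using pos[of "Suc n"] by simp
    then show ?thesis unfolding eq by (simp add: divide_right_mono)
  qed
  moreover have "(\<lambda>n. ereal (ln K / real (Suc n))) \<longlonglongrightarrow> ereal 0"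
    by (intro tendsto_ereal LIMSEQ_Suc lim_const_over_n)
  ultimately have "(INF n. ereal (a (Suc n) / real (Suc n))) \<le> ereal 0"
    by (intro LIMSEQ_le[OF lim]) blast+
  then show ?thesis unfolding pressure_def limI[OF lim] zero_ereal_def .
qed

end


section \<open>Parameters at which the pressure is not positive\<close>

context conformal_shift
begin

text \<open>Without branching the first letter determines the whole point. Every letter is reached
  from a fixed one through a connector, so it occurs on one orbit within a bounded number of
  steps.\<close>

lemma deterministic_finite_letters:
  assumes det: "\<And>b b1 b2. A b b1 \<Longrightarrow> A b b2 \<Longrightarrow> b1 = b2"
  shows "finite (UNIV :: 'e set)"
    and "x \<in> X \<Longrightarrow> y \<in> X \<Longrightarrow> x 0 = y 0 \<Longrightarrow> x = y"
proof -
  have uniq: "x = y" if "x \<in> X" "y \<in> X" "x 0 = y 0" for x y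
  proof
    fix i show "x i = y i"
    proof (induction i)
      case (Suc i)
      then show ?case using that(1,2) det by (metis (mono_tags, lifting) mem_Collect_eq shift_space_def)
    qed (rule that(3))
  qed
  then show "x \<in> X \<Longrightarrow> y \<in> X \<Longrightarrow> x 0 = y 0 \<Longrightarrow> x = y" .
  obtain x where x: "x \<in> X" using exists_from by blast
  define L where "L = Suc (Max (insert 0 (length ` connectors)))"
  have "e' \<in> x ` {..L}" for e'
  proof -
    obtain t where t: "t \<in> connectors" "t \<noteq> []" "successively A t" "A (x 0) (hd t)" "A (last t) e'"
      by (rule connector)
    obtain y where y: "y \<in> X" "y 0 = e'" using exists_from by blast
    have "concat_seq (x 0 # t) y \<in> X"
      using t y by (auto simp: concat_in_shift_space successively_Cons)
    then have "x = concat_seq (x 0 # t) y" using x by (intro uniq) auto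
    then have "x (Suc (length t)) = concat_seq (x 0 # t) y (Suc (length t))" by simp
    then have "x (Suc (length t)) = e'" using y(2) by (simp add: concat_seq_def)
    moreover have "Suc (length t) \<le> L"
      using t(1) connectors(1) by (simp add: L_def)
    ultimately show ?thesis by blast
  qed
  then have "UNIV \<subseteq> x ` {..L}" by blast
  then show "finite (UNIV :: 'e set)" using finite_subset by blast
qed

text \<open>Words of a given length are determined by their first letter, so their number is bounded
  by the size of the finite alphabet, and \<open>S\<close> is bounded above.\<close>

lemma deterministic_pressure_le_0:
  assumes det: "\<And>b b1 b2. A b b1 \<Longrightarrow> A b b2 \<Longrightarrow> b1 = b2" and x: "x > 0"
  shows "pressure A (\<lambda>\<rho>. x * f \<rho>) \<le> 0"
proof -
  obtain C where C: "\<And>w. successively A w \<Longrightarrow> S w \<le> C" using S_bounded_above by blast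
  have "partition_fun A (\<lambda>\<rho>. x * f \<rho>) (Suc n) \<le> ennreal (card (UNIV :: 'e set) * exp (x * C))" for n
    unfolding partition_fun_eq[OF x]
  proof (rule infsum_ennreal_le)
    fix F assume F: "finite F" "F \<subseteq> words A (Suc n)"
    have "inj_on hd F"
    proof (rule inj_onI)
      fix u v assume uv: "u \<in> F" "v \<in> F" "hd u = hd v"
      then have s: "successively A u" "successively A v" "length u = Suc n" "length v = Suc n"
        using F(2) by (auto simp: words_def adm_word_iff)
      obtain y z where yz: "y \<in> cyl A u" "z \<in> cyl A v" using cyl_nonempty s by blast
      have "y 0 = hd u" "z 0 = hd v" using yz s
        by (auto simp: cyl_def hd_conv_nth simp flip: length_greater_0_conv)
      then have "y = z"
        using yz uv(3) by (intro deterministic_finite_letters(2)[OF det]) (auto simp: mem_cyl_iff)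
      then show "u = v" using yz s by (simp add: mem_cyl_iff)
    qed
    then have "card F \<le> card (UNIV :: 'e set)"
      using deterministic_finite_letters(1)[OF det] by (intro card_inj_on_le) auto
    have "(\<Sum>w\<in>F. exp (x * S w)) \<le> (\<Sum>w\<in>F. exp (x * C))"
      using F(2) C x by (intro sum_mono) (auto simp: words_def adm_word_iff)
    also have "\<dots> \<le> card (UNIV :: 'e set) * exp (x * C)"
      using \<open>card F \<le> card (UNIV :: 'e set)\<close> by (simp add: mult_right_mono)
    finally show "(\<Sum>w\<in>F. ennreal (exp (x * S w))) \<le> ennreal (card (UNIV :: 'e set) * exp (x * C))"
      by (simp add: ennreal_leI)
  qed
  then show ?thesis by (rule pressure_le_0[OF x])
qed

text \<open>At \<open>\<delta>\<close> the summands are comparable to masses of disjoint cylinders,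
  so the partition functions are bounded; raising the parameter costs a bounded factor because
  \<open>S\<close> is bounded above. This places every parameter of positive pressure below
  \<open>\<delta>\<close>.\<close>

lemma pressure_le_0_above_delta:
  assumes x: "x \<ge> \<delta>"
  shows "pressure A (\<lambda>\<rho>. x * f \<rho>) \<le> 0"
proof -
  have x0: "x > 0" using x delta by simp
  obtain C where C: "\<And>w. successively A w \<Longrightarrow> S w \<le> C" using S_bounded_above by blast
  have "partition_fun A (\<lambda>\<rho>. x * f \<rho>) (Suc n) \<le> ennreal (exp ((x - \<delta>) * C) / gk)" for n
    unfolding partition_fun_eq[OF x0]
  proof (rule infsum_ennreal_le)
    fix F assume F: "finite F" "F \<subseteq> words A (Suc n)"
    have "(\<Sum>w\<in>F. exp (x * S w)) \<le> (\<Sum>w\<in>F. exp ((x - \<delta>) * C) / gk * measure m (cyl A w))"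
    proof (rule sum_mono)
      fix w assume "w \<in> F"
      then have w: "successively A w" using F(2) by (auto simp: words_def adm_word_iff)
      have "exp (x * S w) = exp ((x - \<delta>) * S w) * exp (\<delta> * S w)"
        by (simp add: exp_add[symmetric] algebra_simps)
      also have "\<dots> \<le> exp ((x - \<delta>) * C) * (measure m (cyl A w) / gk)"
      proof (rule mult_mono)
        show "exp ((x - \<delta>) * S w) \<le> exp ((x - \<delta>) * C)"
          using C[OF w] x by (simp add: mult_left_mono)
        show "exp (\<delta> * S w) \<le> measure m (cyl A w) / gk"
          using measure_cyl_ge[OF w] gk_pos by (simp add: field_simps)
      qed auto
      finally show "exp (x * S w) \<le> exp ((x - \<delta>) * C) / gk * measure m (cyl A w)" by simp
    qed
    also have "\<dots> = exp ((x - \<delta>) * C) / gk * (\<Sum>w\<in>F. measure m (cyl A w))"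
      by (simp only: sum_distrib_left)
    also have "\<dots> \<le> exp ((x - \<delta>) * C) / gk * 1"
      using F gk_pos by (intro mult_left_mono sum_measure_cyl_le[where n = "Suc n"]) (auto simp: words_def)
    finally show "(\<Sum>w\<in>F. ennreal (exp (x * S w))) \<le> ennreal (exp ((x - \<delta>) * C) / gk)"
      by (simp add: ennreal_leI)
  qed
  then show ?thesis by (rule pressure_le_0[OF x0])
qed

end

section \<open>Decay and letter moment from strong regularity\<close>

locale regular_shift = conformal_shift A \<alpha> f \<delta> m
  for A :: "'e::countable \<Rightarrow> 'e \<Rightarrow> bool" and \<alpha> :: real and f :: "(nat \<Rightarrow> 'e) \<Rightarrow> real"
    and \<delta> :: real and m :: "(nat \<Rightarrow> 'e) measure" +
  assumes sreg: "strongly_regular A f"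
begin

lemma positive_pressure:
  obtains x where "x > 0" "0 < pressure A (\<lambda>\<rho>. x * f \<rho>)" "pressure A (\<lambda>\<rho>. x * f \<rho>) < \<infinity>"
  using sreg unfolding strongly_regular_def by blast

lemma S_decay: "\<exists>c>0. \<exists>C. \<forall>w. successively A w \<longrightarrow> S w \<le> C - c * real (length w)"
proof (cases "\<exists>b b1 b2. A b b1 \<and> A b b2 \<and> b1 \<noteq> b2")
  case True
  then show ?thesis using branching_decay by blast
next
  case False
  obtain x where x: "x > 0" "0 < pressure A (\<lambda>\<rho>. x * f \<rho>)" by (rule positive_pressure)
  have "pressure A (\<lambda>\<rho>. x * f \<rho>) \<le> 0"
    by (rule deterministic_pressure_le_0) (use False x in auto)
  then show ?thesis using x(2) by simp
qed

text \<open>With x strictly below \<open>\<delta>\<close>, part of the exponential weight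
  \<open>exp (\<delta> * S [e])\<close> is spent on \<bar>S [e]\<bar>; the rest is the summand of
  the partition function of length 1, which is finite because the pressure at x is.\<close>

lemma letter_moment_summable: "(\<lambda>e. measure m (cyl A [e]) * \<bar>S [e]\<bar>) summable_on UNIV"
proof -
  obtain x where x: "x > 0" "0 < pressure A (\<lambda>\<rho>. x * f \<rho>)" "pressure A (\<lambda>\<rho>. x * f \<rho>) < \<infinity>"
    by (rule positive_pressure)
  have Z1: "partition_fun A (\<lambda>\<rho>. x * f \<rho>) 1 \<noteq> \<infinity>" using pressure_infinite[OF x(1)] x(3) by auto
  have "x < \<delta>" using pressure_le_0_above_delta[of x] x(2) by force
  define d where "d = \<delta> - x"
  have d: "d > 0" using \<open>x < \<delta>\<close> by (simp add: d_def)
  obtain C where C: "C \<ge> 0" "\<And>w. successively A w \<Longrightarrow> S w \<le> C" using S_bounded_above by blast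
  \<comment> \<open>The term \<open>1 / d\<close> serves negative values of \<open>S [e]\<close>,
    the other term values between 0 and \<open>C\<close>.\<close>
  define K where "K = 1 / d + C * exp (d * C)"
  have K: "K \<ge> 0" using C d by (simp add: K_def)
  have pt: "measure m (cyl A [e]) * \<bar>S [e]\<bar> \<le> gK * K * exp (x * S [e])" for e
  proof -
    have "\<bar>S [e]\<bar> \<le> K * exp (- d * S [e])"
    proof (cases "S [e] < 0")
      case True
      have "1 + (- d * S [e]) \<le> exp (- d * S [e])" by (rule exp_ge_add_one_self)
      then have "\<bar>S [e]\<bar> \<le> 1 / d * exp (- d * S [e])" using True d by (simp add: field_simps)
      also have "\<dots> \<le> K * exp (- d * S [e])"
        using C by (intro mult_right_mono) (auto simp: K_def)
      finally show ?thesis .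
    next
      case False
      have "S [e] \<le> C" by (rule C(2)) simp
      then have "exp (d * C) * exp (- d * S [e]) \<ge> 1"
        using d by (simp add: exp_add[symmetric] mult_left_mono)
      then have "C * 1 \<le> C * (exp (d * C) * exp (- d * S [e]))" using C(1) by (rule mult_left_mono)
      also have "\<dots> \<le> K * exp (- d * S [e])"
        using d by (simp add: K_def distrib_right)
      finally show ?thesis using False \<open>S [e] \<le> C\<close> by simp
    qed
    then have "measure m (cyl A [e]) * \<bar>S [e]\<bar> \<le> (gK * exp (\<delta> * S [e])) * (K * exp (- d * S [e]))"
      using gK_pos by (intro mult_mono measure_cyl_le) auto
    also have "\<dots> = gK * K * exp (x * S [e])"
      by (simp add: d_def exp_add[symmetric] algebra_simps flip: exp_add)
    finally show ?thesis .
  qed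
  show ?thesis
  proof (rule nonneg_bdd_above_summable_on)
    show "bdd_above (sum (\<lambda>e. measure m (cyl A [e]) * \<bar>S [e]\<bar>) ` {F. F \<subseteq> UNIV \<and> finite F})"
    proof (rule bdd_aboveI2)
      fix F :: "'e set" assume "F \<in> {F. F \<subseteq> UNIV \<and> finite F}"
      then have F: "finite F" by simp
      have inj: "inj_on (\<lambda>e. [e]) F" by (auto intro: inj_onI)
      have "(\<Sum>w\<in>(\<lambda>e. [e]) ` F. ennreal (exp (x * S w))) \<le> partition_fun A (\<lambda>\<rho>. x * f \<rho>) 1"
        unfolding partition_fun_eq[OF x(1)]
        by (rule sum_le_infsum_ennreal) (use F in \<open>auto simp: words_def adm_word_def\<close>)
      then have "ennreal (\<Sum>e\<in>F. exp (x * S [e])) \<le> partition_fun A (\<lambda>\<rho>. x * f \<rho>) 1"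
        by (simp add: sum.reindex[OF inj])
      then have *: "(\<Sum>e\<in>F. exp (x * S [e])) \<le> enn2real (partition_fun A (\<lambda>\<rho>. x * f \<rho>) 1)"
        using Z1 by (metis enn2real_ennreal enn2real_mono exp_ge_zero infinity_ennreal_def sum_nonneg top.not_eq_extremum)
      have "(\<Sum>e\<in>F. measure m (cyl A [e]) * \<bar>S [e]\<bar>) \<le> (\<Sum>e\<in>F. gK * K * exp (x * S [e]))"
        by (intro sum_mono pt)
      also have "\<dots> = gK * K * (\<Sum>e\<in>F. exp (x * S [e]))" by (simp add: sum_distrib_left)
      also have "\<dots> \<le> gK * K * enn2real (partition_fun A (\<lambda>\<rho>. x * f \<rho>) 1)"
        using gK_pos K * by (intro mult_left_mono) auto
      finally show "(\<Sum>e\<in>F. measure m (cyl A [e]) * \<bar>S [e]\<bar>) \<le> gK * K * enn2real (partition_fun A (\<lambda>\<rho>. x * f \<rho>) 1)" .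
    qed
  qed simp
qed

end

section \<open>Counting words by their Birkhoff sums\<close>

context prob_space
begin

text \<open>Finite subfamilies cut out by the enumeration increase to the union, so continuity from
  below carries a bound on finite sums over to it.\<close>

lemma measure_UN_le_finite_sums:
  fixes G :: "'i::countable \<Rightarrow> 'a set"
  assumes meas: "\<And>i. i \<in> P \<Longrightarrow> G i \<in> sets M"
    and B: "\<And>F. finite F \<Longrightarrow> F \<subseteq> P \<Longrightarrow> (\<Sum>i\<in>F. measure M (G i)) \<le> B"
  shows "measure M (\<Union>i\<in>P. G i) \<le> B"
proof -
  define H where "H n = (\<Union>i\<in>{i\<in>P. to_nat i < n}. G i)" for n
  have fin: "finite {i\<in>P. to_nat i < n}" for n
    by (rule finite_subset[of _ "from_nat ` {..<n}"])
      (auto simp: image_iff intro: from_nat_to_nat[symmetric])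
  have "(\<lambda>n. measure M (H n)) \<longlonglongrightarrow> measure M (\<Union>n. H n)"
  proof (rule finite_Lim_measure_incseq)
    show "range H \<subseteq> sets M" using fin meas by (auto simp: H_def)
    show "incseq H" by (rule incseq_SucI) (auto simp: H_def less_Suc_eq)
  qed
  moreover have "(\<Union>n. H n) = (\<Union>i\<in>P. G i)" by (auto simp: H_def)
  moreover have "measure M (H n) \<le> B" for n
  proof -
    have "measure M (H n) \<le> (\<Sum>i\<in>{i\<in>P. to_nat i < n}. measure M (G i))"
      unfolding H_def by (rule finite_measure_subadditive_finite) (use fin meas in auto)
    also have "\<dots> \<le> B" by (rule B) (use fin in auto)
    finally show ?thesis .
  qed
  ultimately show ?thesis by (auto intro: LIMSEQ_le_const2)
qed

end

lemma summable_on_tail: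
  fixes g :: "'i \<Rightarrow> real"
  assumes g: "g summable_on UNIV" "\<And>i. g i \<ge> 0" and e: "\<epsilon> > 0"
  obtains E where "finite E" "\<And>F. finite F \<Longrightarrow> F \<inter> E = {} \<Longrightarrow> sum g F \<le> \<epsilon>"
proof -
  have le: "sum g F \<le> infsum g UNIV" if "finite F" for F
    by (rule finite_sum_le_infsum) (use g that in auto)
  have "\<exists>E. finite E \<and> infsum g UNIV - \<epsilon> < sum g E"
  proof (rule ccontr)
    assume "\<nexists>E. finite E \<and> infsum g UNIV - \<epsilon> < sum g E"
    then have "infsum g UNIV \<le> infsum g UNIV - \<epsilon>"
      by (intro infsum_le_finite_sums g(1)) (auto simp: not_less)
    then show False using e by simp
  qed
  then obtain E where E: "finite E" "infsum g UNIV - \<epsilon> < sum g E" by blast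
  have "sum g F \<le> \<epsilon>" if "finite F" "F \<inter> E = {}" for F
  proof -
    have "sum g F + sum g E = sum g (F \<union> E)" using that E(1) by (simp add: sum.union_disjoint)
    then show ?thesis using le[of "F \<union> E"] that E by simp
  qed
  then show ?thesis using that E(1) by blast
qed

context regular_shift
begin

text \<open>The second estimate is the first one at a shifted point. Birkhoff sums need not be
  monotone along an orbit, but a later one exceeds an earlier one by at most
  \<open>C\<close>.\<close>

lemma birkhoff_decay:
  "\<exists>c C. c > 0 \<and> C \<ge> 0 \<and> (\<forall>x n. x \<in> X \<longrightarrow> birkhoff n f x \<le> C - c * real n) \<and>
    (\<forall>x n k. x \<in> X \<longrightarrow> birkhoff (n + k) f x \<le> birkhoff n f x + C - c * real k)"
proof -
  obtain c C where c: "c > 0" and C: "\<And>w. successively A w \<Longrightarrow> S w \<le> C - c * real (length w)"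
    using S_decay by blast
  have 1: "birkhoff n f x \<le> C - c * real n" if "x \<in> X" for x n
    using birkhoff_le_S[OF mem_cyl_pre[OF that, of n]] C[OF successively_pre[OF that, of n]] by simp
  have "0 \<le> C" using C[of "[]"] by simp
  moreover have 2: "birkhoff (n + k) f x \<le> birkhoff n f x + C - c * real k" if "x \<in> X" for x n k
    using 1[OF shift_pow_in_shift_space[OF that, of n], of k] by (simp add: birkhoff_add)
  ultimately show ?thesis using c 1 by blast
qed

text \<open>Turns a weighted sum of masses into an integral, whose integrand is estimated along a
  single orbit with \<open>sum_words_at_point\<close>.\<close>

lemma sum_measure_cyl_integral:
  assumes "finite F"
  shows "(\<Sum>w\<in>F. g w * measure m (cyl A w)) = (\<integral>x. (\<Sum>w\<in>F. g w * indicator (cyl A w) x) \<partial>m)"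
    and "integrable m (\<lambda>x. \<Sum>w\<in>F. g w * indicator (cyl A w) x)"
proof -
  have i: "integrable m (\<lambda>x. g w * indicator (cyl A w) x)" for w
    by (auto simp: emeasure_eq_measure)
  then show "integrable m (\<lambda>x. \<Sum>w\<in>F. g w * indicator (cyl A w) x)" by simp
  show "(\<Sum>w\<in>F. g w * measure m (cyl A w)) = (\<integral>x. (\<Sum>w\<in>F. g w * indicator (cyl A w) x) \<partial>m)"
    by (subst Bochner_Integration.integral_sum[OF i]) (simp add: Int_absorb2 cyl_subset space_m)
qed

text \<open>Along an orbit the Birkhoff sums drop at a linear rate, so they visit a window of length
  \<open>v - u\<close> at most \<open>O(v - u + 1)\<close> times; integrating this over a cylinder yields the
  following bound.\<close>

lemma window_measure:
  "\<exists>a b. a > 0 \<and> b \<ge> 0 \<and>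
    (\<forall>F \<tau> u v. finite F \<longrightarrow> (\<forall>w\<in>F. cyl A w \<subseteq> cyl A \<tau> \<and> u \<le> S w \<and> S w \<le> v) \<longrightarrow>
       u \<le> v \<longrightarrow> (\<Sum>w\<in>F. measure m (cyl A w)) \<le> (a * (v - u) + b) * measure m (cyl A \<tau>))"
proof -
  obtain c C where c: "c > 0" "C \<ge> 0"
    "\<And>x n. x \<in> X \<Longrightarrow> birkhoff n f x \<le> C - c * real n"
    and dec: "\<And>x n k. x \<in> X \<Longrightarrow> birkhoff (n + k) f x \<le> birkhoff n f x + C - c * real k"
    using birkhoff_decay by blast
  define b where "b = (D + C) / c + 1"
  have b: "b \<ge> 0" using c D_nonneg by (simp add: b_def)
  have card: "real (card J) \<le> 1 / c * (v - u) + b"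
    if J: "finite J" "\<And>n. n \<in> J \<Longrightarrow> u - D \<le> birkhoff n f x \<and> birkhoff n f x \<le> v" and x: "x \<in> X" and uv: "u \<le> v"
    for J x u v
  proof (cases "J = {}")
    case True
    then show ?thesis using b c uv by simp
  next
    case False
    \<comment> \<open>Between the first and the last visit the sums lose at least the linear rate up
      to \<open>C\<close>, while the window, widened by \<open>D\<close>, leaves room for
      \<open>v - u + D\<close> only.\<close>
    let ?a = "Min J" and ?b = "Max J"
    have ab: "?a \<in> J" "?b \<in> J" "?a \<le> ?b" using J(1) False by auto
    have "birkhoff (?a + (?b - ?a)) f x \<le> birkhoff ?a f x + C - c * real (?b - ?a)" by (rule dec[OF x])
    then have "c * real (?b - ?a) \<le> v - u + D + C" using J(2)[OF ab(1)] J(2)[OF ab(2)] ab(3) by simp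
    then have "real (?b - ?a) \<le> (v - u + D + C) / c" using c by (simp add: field_simps)
    moreover have "card J \<le> card {?a..?b}" using J(1) by (intro card_mono) auto
    ultimately have "real (card J) \<le> (v - u + D + C) / c + 1" using ab(3) by simp
    also have "\<dots> = 1 / c * (v - u) + b" using c by (simp add: b_def field_simps)
    finally show ?thesis .
  qed
  have "(\<Sum>w\<in>F. measure m (cyl A w)) \<le> (1 / c * (v - u) + b) * measure m (cyl A \<tau>)"
    if F: "finite F" and W: "\<And>w. w \<in> F \<Longrightarrow> cyl A w \<subseteq> cyl A \<tau> \<and> u \<le> S w \<and> S w \<le> v" and uv: "u \<le> v"
    for F \<tau> u v
  proof -
    have pt: "(\<Sum>w\<in>F. 1 * indicator (cyl A w) x) \<le> (1 / c * (v - u) + b) * indicator (cyl A \<tau>) x"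
      if x: "x \<in> X" for x
    proof (cases "x \<in> cyl A \<tau>")
      case False
      then have "(\<Sum>w\<in>F. 1 * indicator (cyl A w) x) = (0::real)"
        using W by (intro sum.neutral) (auto simp: indicator_def)
      then show ?thesis using False by simp
    next
      case True
      have "(\<Sum>w\<in>F. 1 * indicator (cyl A w) x) = (\<Sum>n\<in>{n. pre n x \<in> F}. (1::real))"
        by (rule sum_words_at_point[OF F x])
      also have "\<dots> = real (card {n. pre n x \<in> F})" by simp
      also have "\<dots> \<le> 1 / c * (v - u) + b"
      proof (rule card[OF finite_pre_in[OF F] _ x uv])
        fix n assume "n \<in> {n. pre n x \<in> F}"
        then have "u \<le> S (pre n x)" "S (pre n x) \<le> v" using W by auto
        then show "u - D \<le> birkhoff n f x \<and> birkhoff n f x \<le> v"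
          using birkhoff_le_S[OF mem_cyl_pre[OF x, of n]] S_le_birkhoff[OF mem_cyl_pre[OF x, of n]] by simp
      qed
      finally show ?thesis using True by simp
    qed
    have "(\<Sum>w\<in>F. 1 * measure m (cyl A w)) = (\<integral>x. (\<Sum>w\<in>F. 1 * indicator (cyl A w) x) \<partial>m)"
      by (rule sum_measure_cyl_integral(1)[OF F])
    also have "\<dots> \<le> (\<integral>x. (1 / c * (v - u) + b) * indicator (cyl A \<tau>) x \<partial>m)"
      by (rule integral_mono[OF sum_measure_cyl_integral(2)[OF F]])
        (use pt in \<open>auto simp: emeasure_eq_measure space_m\<close>)
    finally show ?thesis by (simp add: Int_absorb2 cyl_subset space_m)
  qed
  then show ?thesis using c b by (intro exI[of _ "1 / c"] exI[of _ b]) auto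
qed

text \<open>The weight \<open>exp (- \<delta> * S w)\<close> makes every word worth at least
  \<open>gk\<close> in measure, so counting becomes integrating. At a point the weights of its
  prefixes grow at least geometrically up to an exponential of T. Finiteness follows because the
  bound holds for all finite subfamilies.\<close>

lemma upper_count:
  "\<exists>K>0. \<forall>T. finite {w. successively A w \<and> S w \<ge> - T} \<and>
    real (card {w. successively A w \<and> S w \<ge> - T}) \<le> K * exp (\<delta> * T)"
proof -
  obtain c C where c: "c > 0" "C \<ge> 0"
    "\<And>x n. x \<in> X \<Longrightarrow> birkhoff n f x \<le> C - c * real n"
    and dec: "\<And>x n k. x \<in> X \<Longrightarrow> birkhoff (n + k) f x \<le> birkhoff n f x + C - c * real k"
    using birkhoff_decay by blast
  define r where "r = exp (- (\<delta> * c))"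
  have r: "0 < r" "r < 1" using c delta by (auto simp: r_def)
  define K where "K = exp (\<delta> * (D + C)) / (1 - r) / gk"
  have K: "K > 0" using r gk_pos by (simp add: K_def)
  have main: "real (card F) \<le> K * exp (\<delta> * T)"
    if F: "finite F" and W: "\<And>w. w \<in> F \<Longrightarrow> successively A w \<and> S w \<ge> - T" for F T
  proof -
    have pt: "(\<Sum>w\<in>F. exp (- \<delta> * S w) * indicator (cyl A w) x) \<le> exp (\<delta> * (T + D + C)) / (1 - r)"
      if x: "x \<in> X" for x
    proof -
      let ?J = "{n. pre n x \<in> F}"
      have J: "finite ?J" by (rule finite_pre_in[OF F])
      \<comment> \<open>Length of the longest counted prefix of \<open>x\<close>. Its sum is still
        at least -T up to \<open>D\<close>, and looking backwards from it linear decay forces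
        earlier prefixes to have larger \<open>S\<close>.\<close>
      define N where "N = Max ?J"
      have "(\<Sum>w\<in>F. exp (- \<delta> * S w) * indicator (cyl A w) x) = (\<Sum>n\<in>?J. exp (- \<delta> * S (pre n x)))"
        by (rule sum_words_at_point[OF F x])
      also have "\<dots> \<le> (\<Sum>n\<in>?J. exp (\<delta> * (T + D + C)) * r ^ (Suc N - Suc n))"
      proof (rule sum_mono)
        fix n assume n: "n \<in> ?J"
        then have nN: "n \<le> N" using J by (simp add: N_def)
        have "N \<in> ?J" unfolding N_def using n J by (intro Max_in) auto
        then have "- T \<le> S (pre N x)" using W by auto
        also have "\<dots> \<le> birkhoff N f x + D" using S_le_birkhoff[OF mem_cyl_pre[OF x, of N]] by simp
        also have "birkhoff N f x \<le> birkhoff n f x + C - c * real (N - n)" using dec[OF x, of n "N - n"] nN by simp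
        also have "birkhoff n f x \<le> S (pre n x)" using birkhoff_le_S[OF mem_cyl_pre[OF x, of n]] by simp
        finally have "- S (pre n x) \<le> (T + D + C) + - c * real (N - n)" by simp
        then have "\<delta> * - S (pre n x) \<le> \<delta> * ((T + D + C) + - c * real (N - n))"
          using delta by (intro mult_left_mono) auto
        then have "- \<delta> * S (pre n x) \<le> \<delta> * (T + D + C) + real (N - n) * (- (\<delta> * c))"
          by (simp add: algebra_simps)
        then have "exp (- \<delta> * S (pre n x)) \<le> exp (\<delta> * (T + D + C) + real (N - n) * (- (\<delta> * c)))"
          by simp
        also have "\<dots> = exp (\<delta> * (T + D + C)) * r ^ (Suc N - Suc n)"
          by (simp only: exp_add exp_of_nat_mult r_def diff_Suc_Suc)
        finally show "exp (- \<delta> * S (pre n x)) \<le> exp (\<delta> * (T + D + C)) * r ^ (Suc N - Suc n)" .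
      qed
      also have "\<dots> \<le> (\<Sum>n<Suc N. exp (\<delta> * (T + D + C)) * r ^ (Suc N - Suc n))"
        using J r by (intro sum_mono2) (auto simp: N_def less_Suc_eq_le)
      also have "\<dots> = exp (\<delta> * (T + D + C)) * (\<Sum>n<Suc N. r ^ n)"
        unfolding sum_distrib_left[symmetric] by (subst sum.nat_diff_reindex) simp
      also have "(\<Sum>n<Suc N. r ^ n) \<le> 1 / (1 - r)"
      proof -
        have "(\<Sum>n<Suc N. r ^ n) = (1 - r ^ Suc N) / (1 - r)"
          using r by (subst sum_gp_strict) auto
        then show ?thesis using r by (simp add: divide_right_mono)
      qed
      finally show ?thesis by simp
    qed
    have "real (card F) = (\<Sum>w\<in>F. 1)" by simp
    also have "\<dots> \<le> (\<Sum>w\<in>F. exp (- \<delta> * S w) * measure m (cyl A w) / gk)"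
    proof (rule sum_mono)
      fix w assume "w \<in> F"
      then have "gk * exp (\<delta> * S w) \<le> measure m (cyl A w)" using W measure_cyl_ge by blast
      then have "exp (- \<delta> * S w) * (gk * exp (\<delta> * S w)) \<le> exp (- \<delta> * S w) * measure m (cyl A w)"
        by (intro mult_left_mono) auto
      moreover have "exp (- \<delta> * S w) * (gk * exp (\<delta> * S w)) = gk"
        by (simp add: exp_minus)
      ultimately have "gk \<le> exp (- \<delta> * S w) * measure m (cyl A w)" by linarith
      then show "1 \<le> exp (- \<delta> * S w) * measure m (cyl A w) / gk" using gk_pos by (simp add: le_divide_eq)
    qed
    also have "\<dots> = (\<Sum>w\<in>F. exp (- \<delta> * S w) * measure m (cyl A w)) / gk"
      by (simp only: sum_divide_distrib)
    also have "(\<Sum>w\<in>F. exp (- \<delta> * S w) * measure m (cyl A w)) =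
        (\<integral>x. (\<Sum>w\<in>F. exp (- \<delta> * S w) * indicator (cyl A w) x) \<partial>m)"
      by (rule sum_measure_cyl_integral(1)[OF F])
    also have "\<dots> \<le> (\<integral>x. exp (\<delta> * (T + D + C)) / (1 - r) \<partial>m)"
      by (rule integral_mono[OF sum_measure_cyl_integral(2)[OF F]]) (use pt in \<open>auto simp: space_m\<close>)
    also have "\<dots> = exp (\<delta> * (T + D + C)) / (1 - r)" using prob_space by simp
    finally have "real (card F) \<le> exp (\<delta> * (T + D + C)) / (1 - r) / gk"
      using gk_pos by (simp add: divide_right_mono)
    also have "\<dots> = K * exp (\<delta> * T)" by (simp add: K_def exp_add[symmetric] algebra_simps flip: exp_add)
    finally show ?thesis .
  qed
  have fin: "finite {w. successively A w \<and> S w \<ge> - T}" for T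
  proof (rule ccontr)
    assume inf: "infinite {w. successively A w \<and> S w \<ge> - T}"
    obtain F where F: "finite F" "F \<subseteq> {w. successively A w \<and> S w \<ge> - T}"
        "card F = Suc (nat \<lceil>K * exp (\<delta> * T)\<rceil>)"
      using infinite_arbitrarily_large[OF inf] by blast
    have "real (card F) \<le> K * exp (\<delta> * T)" by (rule main) (use F in auto)
    then show False unfolding F(3) by linarith
  qed
  have "real (card {w. successively A w \<and> S w \<ge> - T}) \<le> K * exp (\<delta> * T)" for T
    by (rule main[OF fin]) simp
  then show ?thesis using K fin by blast
qed

text \<open>A point of \<open>[\<tau>]\<close> whose Birkhoff sums jump over the window \<open>[-T, -T + M]\<close> lies in a
  cylinder \<open>[we]\<close> with \<open>S w \<ge> -T + M\<close> and \<open>S [e]\<close> very negative.  Since \<open>\<bar>S [e]\<bar>\<close> has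
  finite first moment, such points make up at most half of \<open>[\<tau>]\<close> once \<open>M\<close> is large.\<close>

lemma overshoot_measure:
  "\<exists>M\<ge>0. \<forall>\<tau> T. measure m (\<Union>(w, e)\<in>{(w, e). successively A (w @ [e]) \<and> cyl A w \<subseteq> cyl A \<tau> \<and>
        - T + M \<le> S w \<and> S (w @ [e]) \<le> - T + D}. cyl A (w @ [e])) \<le> measure m (cyl A \<tau>) / 2"
proof -
  obtain a b where ab: "a > 0" "b \<ge> 0"
    and win: "\<And>F \<tau> u v. finite F \<Longrightarrow> \<forall>w\<in>F. cyl A w \<subseteq> cyl A \<tau> \<and> u \<le> S w \<and> S w \<le> v \<Longrightarrow>
       u \<le> v \<Longrightarrow> (\<Sum>w\<in>F. measure m (cyl A w)) \<le> (a * (v - u) + b) * measure m (cyl A \<tau>)"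
    using window_measure by blast
  define q where "q = gK / gk\<^sup>2"
  have q: "q > 0" using gK_pos gk_pos by (simp add: q_def)
  \<comment> \<open>Slope of a linear bound for the window estimate in \<bar>S [e]\<bar>, valid once
    that quantity is at least 1.\<close>
  define L where "L = a * (1 + 3 * D) + b"
  have L: "L > 0" using ab D_nonneg by (simp add: L_def add_pos_nonneg)
  \<comment> \<open>The tail is made small enough that the factors \<open>q\<close> and
    \<open>L\<close> of the final estimate leave exactly one half.\<close>
  obtain E where E: "finite E"
    "\<And>F. finite F \<Longrightarrow> F \<inter> E = {} \<Longrightarrow> (\<Sum>e\<in>F. measure m (cyl A [e]) * \<bar>S [e]\<bar>) \<le> 1 / (2 * q * L)"
    by (rule summable_on_tail[OF letter_moment_summable, of "1 / (2 * q * L)"]) (use q L in auto)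
  \<comment> \<open>A jump from above \<open>- T + M\<close> to below \<open>- T + D\<close> by one
    letter forces \<bar>S [e]\<bar> to be at least \<open>M - 3 * D\<close>. This rules out the
    letters of \<open>E\<close> and makes the value at least 1.\<close>
  define M where "M = 3 * D + 1 + Max (insert 0 ((\<lambda>e. \<bar>S [e]\<bar>) ` E))"
  have ME: "\<bar>S [e]\<bar> < M - 3 * D" if "e \<in> E" for e
  proof -
    have "\<bar>S [e]\<bar> \<le> Max (insert 0 ((\<lambda>e. \<bar>S [e]\<bar>) ` E))" using that E(1) by (intro Max_ge) auto
    then show ?thesis by (simp add: M_def)
  qed
  have "0 \<le> Max (insert 0 ((\<lambda>e. \<bar>S [e]\<bar>) ` E))" using E(1) by (intro Max_ge) auto
  then have M: "M \<ge> 3 * D + 1" by (simp add: M_def)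
  have "measure m (\<Union>(w, e)\<in>{(w, e). successively A (w @ [e]) \<and> cyl A w \<subseteq> cyl A \<tau> \<and>
        - T + M \<le> S w \<and> S (w @ [e]) \<le> - T + D}. cyl A (w @ [e])) \<le> measure m (cyl A \<tau>) / 2" for \<tau> T
  proof -
    let ?P = "{(w, e). successively A (w @ [e]) \<and> cyl A w \<subseteq> cyl A \<tau> \<and> - T + M \<le> S w \<and> S (w @ [e]) \<le> - T + D}"
    let ?G = "\<lambda>(w, e). cyl A (w @ [e])"
    have "measure m (\<Union>p\<in>?P. ?G p) \<le> measure m (cyl A \<tau>) / 2"
    proof (rule measure_UN_le_finite_sums)
      show "?G p \<in> sets m" for p by (cases p) simp
      fix F assume F: "finite F" "F \<subseteq> ?P"
      have up: "- T + M \<le> S w \<and> S w \<le> - T + 3 * D + \<bar>S [e]\<bar> \<and> cyl A w \<subseteq> cyl A \<tau>" if "(w, e) \<in> F" for w e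
      proof -
        have *: "successively A (w @ [e])" "cyl A w \<subseteq> cyl A \<tau>" "- T + M \<le> S w" "S (w @ [e]) \<le> - T + D"
          using that F(2) by auto
        show ?thesis using S_append_ge[OF *(1)] *(2-4) by linarith
      qed
      \<comment> \<open>Grouping by the last letter: for fixed \<open>e\<close> the values
        \<open>S w\<close> lie in a window of length \<open>3 * D + \<bar>S [e]\<bar> - M\<close>,
        and the mass of the letter splits off as a factor.\<close>
      have "(\<Sum>p\<in>F. measure m (?G p)) = (\<Sum>e\<in>snd ` F. \<Sum>p\<in>{p\<in>F. snd p = e}. measure m (?G p))"
        by (rule sum.group[symmetric]) (use F in auto)
      also have "\<dots> \<le> (\<Sum>e\<in>snd ` F. q * measure m (cyl A \<tau>) * L * (measure m (cyl A [e]) * \<bar>S [e]\<bar>))"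
      proof (rule sum_mono)
        fix e assume "e \<in> snd ` F"
        then obtain w0 where w0: "(w0, e) \<in> F" by auto
        have big: "M - 3 * D \<le> \<bar>S [e]\<bar>" using up[OF w0] by linarith
        let ?F = "{p\<in>F. snd p = e}"
        have inj: "inj_on fst ?F" by (auto intro!: inj_onI)
        have "(\<Sum>p\<in>?F. measure m (?G p)) \<le> (\<Sum>p\<in>?F. q * measure m (cyl A [e]) * measure m (cyl A (fst p)))"
          using quasi_bernoulli_le[of _ "[e]"]
          by (intro sum_mono) (auto simp: q_def mult.assoc mult.commute[of "measure m (cyl A [e])"])
        also have "\<dots> = q * measure m (cyl A [e]) * (\<Sum>w\<in>fst ` ?F. measure m (cyl A w))"
          by (simp add: sum_distrib_left sum.reindex[OF inj])
        also have "(\<Sum>w\<in>fst ` ?F. measure m (cyl A w)) \<le>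
            (a * ((- T + 3 * D + \<bar>S [e]\<bar>) - (- T + M)) + b) * measure m (cyl A \<tau>)"
        proof (rule win)
          show "finite (fst ` ?F)" using F by simp
          show "- T + M \<le> - T + 3 * D + \<bar>S [e]\<bar>" using big by simp
          show "\<forall>w\<in>fst ` ?F. cyl A w \<subseteq> cyl A \<tau> \<and> - T + M \<le> S w \<and> S w \<le> - T + 3 * D + \<bar>S [e]\<bar>"
            using up by auto
        qed
        also have "a * ((- T + 3 * D + \<bar>S [e]\<bar>) - (- T + M)) + b \<le> L * \<bar>S [e]\<bar>"
        proof -
          have one: "1 \<le> \<bar>S [e]\<bar>" using big M by linarith
          have "a * ((- T + 3 * D + \<bar>S [e]\<bar>) - (- T + M)) \<le> a * \<bar>S [e]\<bar>"
            using ab M by (intro mult_left_mono) auto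
          moreover have "b \<le> b * \<bar>S [e]\<bar>" using mult_left_mono[OF one ab(2)] by simp
          moreover have "0 \<le> a * (3 * D) * \<bar>S [e]\<bar>" using ab D_nonneg by simp
          ultimately show ?thesis by (simp add: L_def algebra_simps)
        qed
        finally show "(\<Sum>p\<in>?F. measure m (?G p)) \<le> q * measure m (cyl A \<tau>) * L * (measure m (cyl A [e]) * \<bar>S [e]\<bar>)"
          using q by (simp add: mult_left_mono mult_right_mono ac_simps)
      qed
      also have "\<dots> = q * measure m (cyl A \<tau>) * L * (\<Sum>e\<in>snd ` F. measure m (cyl A [e]) * \<bar>S [e]\<bar>)"
        by (simp add: sum_distrib_left)
      also have "\<dots> \<le> q * measure m (cyl A \<tau>) * L * (1 / (2 * q * L))"
      proof (intro mult_left_mono E(2))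
        show "snd ` F \<inter> E = {}"
        proof (rule equals0I)
          fix e assume "e \<in> snd ` F \<inter> E"
          then obtain w where w: "(w, e) \<in> F" "e \<in> E" by auto
          show False using up[OF w(1)] ME[OF w(2)] by linarith
        qed
      qed (use F q L in auto)
      also have "\<dots> = measure m (cyl A \<tau>) / 2" using q L by simp
      finally show "(\<Sum>p\<in>F. measure m (?G p)) \<le> measure m (cyl A \<tau>) / 2" .
    qed
    then show ?thesis by (simp add: case_prod_unfold)
  qed
  moreover have "M \<ge> 0" using M D_nonneg by linarith
  ultimately show ?thesis by blast
qed

text \<open>At least half of the cylinder is covered by words whose \<open>S\<close> lies in a
  window just above -T. Each of them has mass at most of order exp (- \<delta> T), so there must be
  many. The constant is uniform; only the threshold depends on \<open>\<tau>\<close>.\<close>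

lemma lower_count:
  "\<exists>k>0. \<forall>\<tau>. successively A \<tau> \<longrightarrow> (\<exists>T0. \<forall>T\<ge>T0. k * measure m (cyl A \<tau>) * exp (\<delta> * T)
        \<le> real (card {w. adm_word A w \<and> cyl A w \<subseteq> cyl A \<tau> \<and> S w \<ge> - T}))"
proof -
  obtain M where M: "M \<ge> 0"
    "\<And>\<tau> T. measure m (\<Union>(w, e)\<in>{(w, e). successively A (w @ [e]) \<and> cyl A w \<subseteq> cyl A \<tau> \<and>
        - T + M \<le> S w \<and> S (w @ [e]) \<le> - T + D}. cyl A (w @ [e])) \<le> measure m (cyl A \<tau>) / 2"
    using overshoot_measure by blast
  obtain c C where c: "c > 0" "C \<ge> 0"
    and dec: "\<And>x n. x \<in> X \<Longrightarrow> birkhoff n f x \<le> C - c * real n"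
    "\<And>x n k. x \<in> X \<Longrightarrow> birkhoff (n + k) f x \<le> birkhoff n f x + C - c * real k"
    using birkhoff_decay by blast
  obtain K where "K > 0" and fin: "\<And>T. finite {w. successively A w \<and> S w \<ge> - T}"
    "\<And>T. real (card {w. successively A w \<and> S w \<ge> - T}) \<le> K * exp (\<delta> * T)"
    using upper_count by blast
  \<comment> \<open>Window words satisfy \<open>S w \<le> - T + M + D\<close>, so up to
    \<open>exp (\<delta> * T)\<close> this is the reciprocal of twice their largest possible
    mass.\<close>
  define k where "k = 1 / (2 * gK * exp (\<delta> * (M + D)))"
  have k: "k > 0" using gK_pos by (simp add: k_def)
  have "\<exists>T0. \<forall>T\<ge>T0. k * measure m (cyl A \<tau>) * exp (\<delta> * T)
        \<le> real (card {w. adm_word A w \<and> cyl A w \<subseteq> cyl A \<tau> \<and> S w \<ge> - T})"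
    if tau: "successively A \<tau>" for \<tau>
  proof -
    \<comment> \<open>Two demands: no prefix of \<open>\<tau>\<close> may already have fallen below
      -T, so that the first passage occurs after \<open>\<tau>\<close> has been read; and
      \<open>T > M\<close>, which keeps the empty word out of the window.\<close>
    define T0 where "T0 = M + 1 + Max (insert 0 ((\<lambda>j. D - S (take j \<tau>)) ` {..length \<tau>}))"
    have "k * measure m (cyl A \<tau>) * exp (\<delta> * T)
        \<le> real (card {w. adm_word A w \<and> cyl A w \<subseteq> cyl A \<tau> \<and> S w \<ge> - T})" if T: "T \<ge> T0" for T
    proof -
      let ?X = "\<Union>(w, e)\<in>{(w, e). successively A (w @ [e]) \<and> cyl A w \<subseteq> cyl A \<tau> \<and>
        - T + M \<le> S w \<and> S (w @ [e]) \<le> - T + D}. cyl A (w @ [e])"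
      let ?W = "{w. adm_word A w \<and> cyl A w \<subseteq> cyl A \<tau> \<and> - T \<le> S w \<and> S w \<le> - T + M + D}"
      have finW: "finite ?W" by (rule finite_subset[OF _ fin(1)[of T]]) (auto simp: adm_word_iff)
      have "0 \<le> Max (insert 0 ((\<lambda>j. D - S (take j \<tau>)) ` {..length \<tau>}))" by (intro Max_ge) auto
      then have TM: "T > M" using T by (simp add: T0_def)
      have cover: "cyl A \<tau> \<subseteq> (\<Union>w\<in>?W. cyl A w) \<union> ?X"
      proof
        fix x assume x: "x \<in> cyl A \<tau>"
        then have xX: "x \<in> X" by (simp add: mem_cyl_iff)
        obtain N0 where "(C + T) / c < real N0" using reals_Archimedean2 by blast
        then have "C - c * real N0 < - T" using c by (simp add: field_simps)
        then have ex: "birkhoff N0 f x < - T" using dec[OF xX, of N0] by linarith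
        \<comment> \<open>First time below -T. The prefix one step earlier is still at least -T:
          either it lies in the window, or the next letter is an overshoot.\<close>
        define N where "N = (LEAST N. birkhoff N f x < - T)"
        have N: "birkhoff N f x < - T" unfolding N_def using ex by (rule LeastI)
        have small: "- T \<le> birkhoff j f x" if "j \<le> length \<tau>" for j
        proof -
          have "take j \<tau> = pre j x" using x that by (metis mem_cyl_iff take_pre)
          then have "S (take j \<tau>) \<le> birkhoff j f x + D"
            using S_le_birkhoff[OF mem_cyl_pre[OF xX, of j]] by simp
          moreover have "D - S (take j \<tau>) \<le> Max (insert 0 ((\<lambda>j. D - S (take j \<tau>)) ` {..length \<tau>}))"
            using that by (intro Max_ge) auto
          ultimately show ?thesis using T M(1) by (simp add: T0_def)
        qed
        have "length \<tau> < N" using small[of N] N by force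
        then obtain n where n: "N = Suc n" "length \<tau> \<le> n" by (cases N) auto
        have "\<not> birkhoff n f x < - T" using not_less_Least[of n "\<lambda>N. birkhoff N f x < - T"] n by (simp add: N_def)
        then have bn: "- T \<le> birkhoff n f x" by simp
        let ?w = "pre n x"
        have w: "x \<in> cyl A ?w" "birkhoff n f x \<le> S ?w" "S ?w \<le> birkhoff n f x + D"
          using mem_cyl_pre[OF xX, of n] birkhoff_le_S[OF mem_cyl_pre[OF xX, of n]]
            S_le_birkhoff[OF mem_cyl_pre[OF xX, of n]] by auto
        have sub: "cyl A ?w \<subseteq> cyl A \<tau>"
        proof -
          have "take (length \<tau>) ?w = \<tau>" using x n(2) by (simp add: take_pre mem_cyl_iff)
          then have "?w = \<tau> @ drop (length \<tau>) ?w" by (metis append_take_drop_id)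
          then show ?thesis using cyl_append_subset by metis
        qed
        show "x \<in> (\<Union>w\<in>?W. cyl A w) \<union> ?X"
        proof (cases "birkhoff n f x \<le> - T + M")
          case True
          then have "n \<noteq> 0" using TM by (intro notI) simp
          then have "adm_word A ?w"
            using successively_pre[OF xX] by (auto simp: adm_word_iff simp flip: length_greater_0_conv)
          then have "?w \<in> ?W" using sub w bn True by auto
          then show ?thesis using w(1) by blast
        next
          case False
          have p: "pre N x = ?w @ [x n]" by (simp add: n(1) pre_def)
          have "S (?w @ [x n]) \<le> - T + D"
            using S_le_birkhoff[OF mem_cyl_pre[OF xX, of N]] N by (simp add: p[symmetric])
          moreover have "successively A (?w @ [x n])" "x \<in> cyl A (?w @ [x n])"
            using successively_pre[OF xX, of N] mem_cyl_pre[OF xX, of N] by (simp_all add: p)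
          ultimately have "(?w, x n) \<in> {(w, e). successively A (w @ [e]) \<and> cyl A w \<subseteq> cyl A \<tau> \<and>
              - T + M \<le> S w \<and> S (w @ [e]) \<le> - T + D}"
            using sub w False by auto
          then show ?thesis using \<open>x \<in> cyl A (?w @ [x n])\<close> by (intro UnI2 UN_I) auto
        qed
      qed
      have Xm: "?X \<in> sets m" by (intro sets.countable_UN') (auto simp: case_prod_unfold)
      have "measure m (cyl A \<tau>) \<le> measure m ((\<Union>w\<in>?W. cyl A w) \<union> ?X)"
        using cover finW Xm by (intro finite_measure_mono) auto
      also have "\<dots> \<le> measure m (\<Union>w\<in>?W. cyl A w) + measure m ?X"
        using finW Xm by (intro measure_Un_le) auto
      also have "measure m (\<Union>w\<in>?W. cyl A w) \<le> (\<Sum>w\<in>?W. measure m (cyl A w))"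
        using finW by (intro finite_measure_subadditive_finite) auto
      also have "\<dots> \<le> (\<Sum>w\<in>?W. gK * exp (\<delta> * (- T + M + D)))"
      proof (rule sum_mono)
        fix w assume "w \<in> ?W"
        then have "gK * exp (\<delta> * S w) \<le> gK * exp (\<delta> * (- T + M + D))"
          using gK_pos delta by (intro mult_left_mono) auto
        then show "measure m (cyl A w) \<le> gK * exp (\<delta> * (- T + M + D))"
          using measure_cyl_le[of w] by linarith
      qed
      also have "\<dots> = real (card ?W) * (gK * exp (\<delta> * (- T + M + D)))" by simp
      finally have "measure m (cyl A \<tau>) / 2 \<le> real (card ?W) * (gK * exp (\<delta> * (- T + M + D)))"
        using M(2)[of \<tau> T] by linarith
      then have "measure m (cyl A \<tau>) / 2 * exp (\<delta> * T) \<le> real (card ?W) * (gK * exp (\<delta> * (- T + M + D))) * exp (\<delta> * T)"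
        by (intro mult_right_mono) auto
      also have "\<dots> = real (card ?W) * (gK * exp (\<delta> * (M + D)))"
        by (simp add: mult.assoc exp_add[symmetric]) (simp add: algebra_simps)
      finally have "k * measure m (cyl A \<tau>) * exp (\<delta> * T) \<le> real (card ?W)"
        using gK_pos by (simp add: k_def field_simps)
      also have "\<dots> \<le> real (card {w. adm_word A w \<and> cyl A w \<subseteq> cyl A \<tau> \<and> S w \<ge> - T})"
      proof -
        have "finite {w. adm_word A w \<and> cyl A w \<subseteq> cyl A \<tau> \<and> S w \<ge> - T}"
          by (rule finite_subset[OF _ fin(1)[of T]]) (auto simp: adm_word_iff)
        then show ?thesis by (intro of_nat_mono card_mono) auto
      qed
      finally show ?thesis .
    qed
    then show ?thesis by blast
  qed
  then show ?thesis using k by blast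
qed

end

section \<open>Orbit and periodic counts\<close>

context regular_shift
begin

text \<open>Words are closed up by a connector.  The word is recovered from its closure once the
  connector is known, so closing is at most \<open>card connectors\<close>-to-one.\<close>

lemma connect_words:
  "\<exists>(\<theta> :: 'e \<Rightarrow> 'e \<Rightarrow> 'e list) (R :: real).
    (\<forall>a b. \<theta> a b \<in> connectors \<and> successively A (\<theta> a b) \<and> \<theta> a b \<noteq> [] \<and> A a (hd (\<theta> a b)) \<and> A (last (\<theta> a b)) b) \<and>
    (\<forall>w b x. adm_word A w \<longrightarrow> x \<in> cyl A (w @ \<theta> (last w) b) \<longrightarrow>
        S w - R \<le> birkhoff (length (w @ \<theta> (last w) b)) f x) \<and>
    (\<forall>W E. finite W \<longrightarrow> card W \<le> card ((\<lambda>w. w @ \<theta> (last w) (E w)) ` W) * card connectors)"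
proof -
  define \<theta> where "\<theta> a b = (SOME t. t \<in> connectors \<and> successively A t \<and> t \<noteq> [] \<and> A a (hd t) \<and> A (last t) b)" for a b
  have t: "\<theta> a b \<in> connectors \<and> successively A (\<theta> a b) \<and> \<theta> a b \<noteq> [] \<and> A a (hd (\<theta> a b)) \<and> A (last (\<theta> a b)) b" for a b
    unfolding \<theta>_def by (rule someI_ex) (metis connector)
  define l where "l = Min (insert 0 (S ` connectors))"
  have l: "l \<le> S (\<theta> a b)" for a b
    unfolding l_def using t[of a b] connectors(1) by (intro Min_le) auto
  \<comment> \<open>The loss consists of \<open>2 * D\<close> for the concatenation,
    \<open>D\<close> for passing from the supremum to a point, and the least value \<open>l\<close>
    of \<open>S\<close> on connectors.\<close>
  have b: "S w - (3 * D - l) \<le> birkhoff (length (w @ \<theta> (last w) b)) f x"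
    if w: "adm_word A w" "x \<in> cyl A (w @ \<theta> (last w) b)" for w b x
  proof -
    have "successively A (w @ \<theta> (last w) b)" using w cyl_empty by blast
    then have "S w + S (\<theta> (last w) b) - 2 * D \<le> S (w @ \<theta> (last w) b)" by (rule S_append_ge)
    also have "\<dots> \<le> birkhoff (length (w @ \<theta> (last w) b)) f x + D" by (rule S_le_birkhoff[OF w(2)])
    finally show ?thesis using l[of "last w" b] by linarith
  qed
  have card: "card W \<le> card ((\<lambda>w. w @ \<theta> (last w) (E w)) ` W) * card connectors" if W: "finite W" for W E
  proof -
    let ?g = "\<lambda>w. w @ \<theta> (last w) (E w)"
    let ?h = "\<lambda>w. (?g w, \<theta> (last w) (E w))"
    have "inj_on ?h W" by (auto intro!: inj_onI)
    then have "card W \<le> card (?g ` W \<times> connectors)"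
      using W t connectors(1) by (intro card_inj_on_le[of ?h]) auto
    then show ?thesis by (simp add: card_cartesian_product)
  qed
  show ?thesis by (intro exI[of _ \<theta>] exI[of _ "3 * D - l"] conjI allI impI) (use t b card in auto)
qed

lemma adm_word_append:
  "adm_word A w \<Longrightarrow> successively A t \<Longrightarrow> A (last w) (hd t) \<Longrightarrow> adm_word A (w @ t)"
  by (auto simp: adm_word_iff successively_append_iff)

definition orbit_words :: "(nat \<Rightarrow> 'e) \<Rightarrow> 'e list set" where
  "orbit_words \<rho> = {w \<in> all_words A. concat_seq w \<rho> \<in> X}"

definition per_words :: "'e list set" where
  "per_words = {w \<in> all_words A. A (last w) (hd w)}"

lemma orbit_in_cyl: "w \<in> orbit_words \<rho> \<Longrightarrow> concat_seq w \<rho> \<in> cyl A w"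
  by (simp add: orbit_words_def mem_cyl_iff)

lemma per_in_cyl: "w \<in> per_words \<Longrightarrow> per_seq w \<in> cyl A w"
  by (simp add: per_words_def all_words_def per_seq_in_cyl)

text \<open>A family \<open>G\<close> of words with a point \<open>p w\<close> of \<open>[w]\<close> for each of them covers both counting
  functions: \<open>p w\<close> is \<open>w\<rho>\<close> for \<open>N_orbit\<close> and the periodic point of \<open>w\<close> for \<open>N_per\<close>.\<close>

lemma count_upper:
  "\<exists>K>0. \<forall>G p T. (\<forall>w\<in>G. adm_word A w \<and> p w \<in> cyl A w) \<longrightarrow>
     finite {w\<in>G. birkhoff (length w) f (p w) \<ge> - T} \<and>
     real (card {w\<in>G. birkhoff (length w) f (p w) \<ge> - T}) \<le> K * exp (\<delta> * T)"
proof -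
  obtain K where K: "K > 0" "\<And>T. finite {w. successively A w \<and> S w \<ge> - T}"
    "\<And>T. real (card {w. successively A w \<and> S w \<ge> - T}) \<le> K * exp (\<delta> * T)"
    using upper_count by blast
  have "finite {w\<in>G. birkhoff (length w) f (p w) \<ge> - T} \<and>
     real (card {w\<in>G. birkhoff (length w) f (p w) \<ge> - T}) \<le> K * exp (\<delta> * T)"
    if G: "\<forall>w\<in>G. adm_word A w \<and> p w \<in> cyl A w" for G and p :: "'e list \<Rightarrow> nat \<Rightarrow> 'e" and T
  proof -
    have sub: "{w\<in>G. birkhoff (length w) f (p w) \<ge> - T} \<subseteq> {w. successively A w \<and> S w \<ge> - T}"
    proof
      fix w assume w: "w \<in> {w\<in>G. birkhoff (length w) f (p w) \<ge> - T}"
      then have "birkhoff (length w) f (p w) \<le> S w" using G by (intro birkhoff_le_S) auto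
      then show "w \<in> {w. successively A w \<and> S w \<ge> - T}" using w G by (auto simp: adm_word_iff)
    qed
    have "real (card {w\<in>G. birkhoff (length w) f (p w) \<ge> - T}) \<le> real (card {w. successively A w \<and> S w \<ge> - T})"
      by (intro of_nat_mono card_mono K(2) sub)
    then show ?thesis using finite_subset[OF sub K(2)] K(3)[of T] by linarith
  qed
  then show ?thesis using K(1) by blast
qed

text \<open>Closing a word lowers its sum by at most \<open>R\<close> and merges at most as many
  words as there are connectors, so the count at \<open>T - R\<close> carries over. The constant
  comes before \<open>\<tau>\<close>, which later allows adding over finitely many
  cylinders.\<close>

lemma count_lower:
  "\<exists>k>0. \<forall>\<tau>. successively A \<tau> \<longrightarrow> (\<exists>T0. \<forall>T\<ge>T0.
     (\<forall>\<rho>\<in>X. k * measure m (cyl A \<tau>) * exp (\<delta> * T) \<le>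
        real (card {w\<in>orbit_words \<rho>. birkhoff (length w) f (concat_seq w \<rho>) \<ge> - T \<and> concat_seq w \<rho> \<in> cyl A \<tau>})) \<and>
     k * measure m (cyl A \<tau>) * exp (\<delta> * T) \<le>
        real (card {w\<in>per_words. birkhoff (length w) f (per_seq w) \<ge> - T \<and> per_seq w \<in> cyl A \<tau>}))"
proof -
  obtain k where k: "k > 0" "\<And>\<tau>. successively A \<tau> \<Longrightarrow>
      \<exists>T0. \<forall>T\<ge>T0. k * measure m (cyl A \<tau>) * exp (\<delta> * T)
        \<le> real (card {w. adm_word A w \<and> cyl A w \<subseteq> cyl A \<tau> \<and> S w \<ge> - T})"
    using lower_count by blast
  obtain K where up: "\<And>T. finite {w. successively A w \<and> S w \<ge> - T}"
    using upper_count by blast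
  obtain K' where fin: "\<And>G p T. \<forall>w\<in>G. adm_word A w \<and> p w \<in> cyl A w \<Longrightarrow>
     finite {w\<in>G. birkhoff (length w) f (p w) \<ge> - T}"
    using count_upper by blast
  obtain \<theta> and R :: real where
    t: "\<And>a b. \<theta> a b \<in> connectors \<and> successively A (\<theta> a b) \<and> \<theta> a b \<noteq> [] \<and> A a (hd (\<theta> a b)) \<and> A (last (\<theta> a b)) b"
    and R: "\<And>w b x. adm_word A w \<Longrightarrow> x \<in> cyl A (w @ \<theta> (last w) b) \<Longrightarrow>
        S w - R \<le> birkhoff (length (w @ \<theta> (last w) b)) f x"
    and card: "\<And>W cl. finite W \<Longrightarrow>
        card W \<le> card ((\<lambda>w. w @ \<theta> (last w) (cl w)) ` W) * card connectors"
    using connect_words by (elim exE conjE) blast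
  define n where "n = card connectors"
  have "connectors \<noteq> {}" using t by blast
  then have n: "n > 0" using connectors(1) by (simp add: n_def card_gt_0_iff)
  \<comment> \<open>The exponential pays for the shift from \<open>T\<close> to
    \<open>T - R\<close>, the division for the multiplicity of closing.\<close>
  define k' where "k' = k * exp (- (\<delta> * R)) / n"
  have "k' > 0" using k n by (simp add: k'_def)
  moreover have "\<exists>T0. \<forall>T\<ge>T0.
     (\<forall>\<rho>\<in>X. k' * measure m (cyl A \<tau>) * exp (\<delta> * T) \<le>
        real (card {w\<in>orbit_words \<rho>. birkhoff (length w) f (concat_seq w \<rho>) \<ge> - T \<and> concat_seq w \<rho> \<in> cyl A \<tau>})) \<and>
     k' * measure m (cyl A \<tau>) * exp (\<delta> * T) \<le>
        real (card {w\<in>per_words. birkhoff (length w) f (per_seq w) \<ge> - T \<and> per_seq w \<in> cyl A \<tau>})"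
    if tau: "successively A \<tau>" for \<tau>
  proof -
    obtain T0 where T0: "\<And>T. T \<ge> T0 \<Longrightarrow> k * measure m (cyl A \<tau>) * exp (\<delta> * T)
        \<le> real (card {w. adm_word A w \<and> cyl A w \<subseteq> cyl A \<tau> \<and> S w \<ge> - T})"
      using k(2)[OF tau] by blast
    \<comment> \<open>\<open>cl w\<close> is the letter that the connector must reach: the first
      letter of \<open>\<rho>\<close> for orbits, the first letter of \<open>w\<close> itself for
      periodic points.\<close>
    have key: "k' * measure m (cyl A \<tau>) * exp (\<delta> * T) \<le>
        real (card {w\<in>G. birkhoff (length w) f (p w) \<ge> - T \<and> p w \<in> cyl A \<tau>})"
      if T: "T \<ge> T0 + R" and G: "\<forall>w\<in>G. adm_word A w \<and> p w \<in> cyl A w"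
        and ext: "\<And>w. adm_word A w \<Longrightarrow> w @ \<theta> (last w) (cl w) \<in> G"
      for T G and cl :: "'e list \<Rightarrow> 'e" and p :: "'e list \<Rightarrow> nat \<Rightarrow> 'e"
    proof -
      let ?W = "{w. adm_word A w \<and> cyl A w \<subseteq> cyl A \<tau> \<and> S w \<ge> - (T - R)}"
      let ?g = "\<lambda>w. w @ \<theta> (last w) (cl w)"
      let ?V = "{w\<in>G. birkhoff (length w) f (p w) \<ge> - T \<and> p w \<in> cyl A \<tau>}"
      have finW: "finite ?W" by (rule finite_subset[OF _ up[of "T - R"]]) (auto simp: adm_word_iff)
      have finV: "finite ?V" by (rule finite_subset[OF _ fin[OF G, of T]]) auto
      have "?g ` ?W \<subseteq> ?V"
      proof
        fix v assume "v \<in> ?g ` ?W"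
        then obtain w where w: "w \<in> ?W" "v = ?g w" by blast
        have vG: "v \<in> G" using w ext by auto
        have pv: "p v \<in> cyl A (w @ \<theta> (last w) (cl w))" using G vG w(2) by auto
        have "S w - R \<le> birkhoff (length v) f (p v)" unfolding w(2) using pv w by (intro R) auto
        moreover have "p v \<in> cyl A \<tau>" using pv w(1) cyl_append_subset by blast
        ultimately show "v \<in> ?V" using vG w(1) by auto
      qed
      then have "card (?g ` ?W) \<le> card ?V" by (rule card_mono[OF finV])
      then have "card (?g ` ?W) * n \<le> card ?V * n" by (rule mult_le_mono1)
      with card[OF finW, of cl] have "card ?W \<le> card ?V * n" unfolding n_def by (rule order_trans)
      then have "real (card ?W) \<le> real (card ?V) * real n"
        by (simp only: of_nat_mult[symmetric] of_nat_le_iff)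
      moreover have "k * measure m (cyl A \<tau>) * exp (\<delta> * (T - R)) \<le> real (card ?W)"
        by (rule T0) (use T in simp)
      ultimately have "k * measure m (cyl A \<tau>) * exp (\<delta> * (T - R)) \<le> real (card ?V) * real n" by linarith
      moreover have "k * measure m (cyl A \<tau>) * exp (\<delta> * (T - R)) = k' * measure m (cyl A \<tau>) * exp (\<delta> * T) * n"
      proof -
        have "exp (\<delta> * (T - R)) = exp (- (\<delta> * R)) * exp (\<delta> * T)"
          by (simp add: exp_add[symmetric]) (simp add: algebra_simps)
        then show ?thesis using n by (simp add: k'_def)
      qed
      ultimately show ?thesis using n by simp
    qed
    have "k' * measure m (cyl A \<tau>) * exp (\<delta> * T) \<le>
        real (card {w\<in>orbit_words \<rho>. birkhoff (length w) f (concat_seq w \<rho>) \<ge> - T \<and> concat_seq w \<rho> \<in> cyl A \<tau>})"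
      if "T \<ge> T0 + R" "\<rho> \<in> X" for T \<rho>
    proof (rule key)
      show "\<forall>w\<in>orbit_words \<rho>. adm_word A w \<and> concat_seq w \<rho> \<in> cyl A w"
        using orbit_in_cyl by (auto simp: orbit_words_def all_words_def)
      fix w assume w: "adm_word A w"
      show "w @ \<theta> (last w) (\<rho> 0) \<in> orbit_words \<rho>"
        using adm_word_append[OF w, of "\<theta> (last w) (\<rho> 0)"] t[of "last w" "\<rho> 0"] that(2)
        by (auto simp: orbit_words_def all_words_def concat_in_shift_space adm_word_iff)
    qed (use that in simp)
    moreover have "k' * measure m (cyl A \<tau>) * exp (\<delta> * T) \<le>
        real (card {w\<in>per_words. birkhoff (length w) f (per_seq w) \<ge> - T \<and> per_seq w \<in> cyl A \<tau>})"
      if "T \<ge> T0 + R" for T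
    proof (rule key)
      show "\<forall>w\<in>per_words. adm_word A w \<and> per_seq w \<in> cyl A w"
        using per_in_cyl by (auto simp: per_words_def all_words_def)
      fix w assume w: "adm_word A w"
      show "w @ \<theta> (last w) (hd w) \<in> per_words"
        using adm_word_append[OF w, of "\<theta> (last w) (hd w)"] t[of "last w" "hd w"] w
        by (auto simp: per_words_def all_words_def adm_word_def)
    qed (use that in simp)
    ultimately show ?thesis by blast
  qed
  ultimately show ?thesis by blast
qed

text \<open>The cylinders of length \<open>n\<close> inside \<open>U\<close> have unions increasing
  to \<open>U\<close>, and finitely many of them nearly exhaust the mass. Their common length makes
  them disjoint, so that counts over them can be added.\<close>

lemma open_approx:
  assumes U: "openin (shift_top A) U" and r: "r < measure m U"
  shows "\<exists>n F. finite F \<and> (\<forall>\<tau>\<in>F. successively A \<tau> \<and> length \<tau> = n \<and> cyl A \<tau> \<subseteq> U) \<and>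
    r < (\<Sum>\<tau>\<in>F. measure m (cyl A \<tau>))"
proof -
  define H where "H n = (\<Union>\<tau>\<in>{\<tau>. length \<tau> = n \<and> cyl A \<tau> \<subseteq> U}. cyl A \<tau>)" for n
  have meas: "H n \<in> sets m" for n unfolding H_def by (intro sets.countable_UN') auto
  have "(\<lambda>n. measure m (H n)) \<longlonglongrightarrow> measure m (\<Union>n. H n)"
  proof (rule finite_Lim_measure_incseq)
    show "range H \<subseteq> sets m" using meas by auto
    show "incseq H"
    proof (rule incseq_SucI, rule subsetI)
      fix n x assume "x \<in> H n"
      then obtain \<tau> where t: "length \<tau> = n" "cyl A \<tau> \<subseteq> U" "x \<in> cyl A \<tau>" by (auto simp: H_def)
      then have eq: "pre (Suc n) x = \<tau> @ [x n]" by (auto simp: mem_cyl_iff pre_def)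
      have "x \<in> cyl A (\<tau> @ [x n])" using mem_cyl_pre[of x A "Suc n"] t(3) unfolding eq by (simp add: mem_cyl_iff)
      moreover have "cyl A (\<tau> @ [x n]) \<subseteq> U" using cyl_append_subset t(2) by blast
      ultimately show "x \<in> H (Suc n)" unfolding H_def using t(1) by (intro UN_I[of "\<tau> @ [x n]"]) auto
    qed
  qed
  moreover have "(\<Union>n. H n) = U"
  proof
    show "(\<Union>n. H n) \<subseteq> U" by (auto simp: H_def)
    show "U \<subseteq> (\<Union>n. H n)"
    proof
      fix x assume x: "x \<in> U"
      then obtain n where n: "cyl A (pre n x) \<subseteq> U" and "x \<in> X" using U unfolding openin_shift_top_iff by blast
      then have "x \<in> H n" unfolding H_def using mem_cyl_pre by (intro UN_I[of "pre n x"]) auto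
      then show "x \<in> (\<Union>n. H n)" by blast
    qed
  qed
  ultimately have "eventually (\<lambda>n. r < measure m (H n)) sequentially"
    using r by (intro order_tendstoD(1)) auto
  then obtain n where n: "r < measure m (H n)" by (auto simp: eventually_sequentially)
  have "\<exists>F. finite F \<and> F \<subseteq> {\<tau>. length \<tau> = n \<and> cyl A \<tau> \<subseteq> U} \<and> r < (\<Sum>\<tau>\<in>F. measure m (cyl A \<tau>))"
  proof (rule ccontr)
    assume *: "\<nexists>F. finite F \<and> F \<subseteq> {\<tau>. length \<tau> = n \<and> cyl A \<tau> \<subseteq> U} \<and> r < (\<Sum>\<tau>\<in>F. measure m (cyl A \<tau>))"
    have "measure m (H n) \<le> r" unfolding H_def
      by (rule measure_UN_le_finite_sums) (use * in \<open>auto simp: not_less\<close>)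
    then show False using n by simp
  qed
  then obtain F where F: "finite F" "F \<subseteq> {\<tau>. length \<tau> = n \<and> cyl A \<tau> \<subseteq> U}" "r < (\<Sum>\<tau>\<in>F. measure m (cyl A \<tau>))"
    by blast
  have eq: "(\<Sum>\<tau>\<in>{\<tau>\<in>F. successively A \<tau>}. measure m (cyl A \<tau>)) = (\<Sum>\<tau>\<in>F. measure m (cyl A \<tau>))"
    using F(1) by (intro sum.mono_neutral_left) (auto simp: cyl_empty)
  show ?thesis
    by (intro exI[of _ n] exI[of _ "{\<tau>\<in>F. successively A \<tau>}"]) (use F eq in auto)
qed

text \<open>Finitely many cylinders have a common threshold in T, and distinct ones contain distinct
  points \<open>p w\<close>, so the lower bounds add up. Letting \<open>r\<close> approach the mass
  of \<open>U\<close> gives the claim.\<close>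

lemma liminf_count:
  fixes G :: "'e list set" and p :: "'e list \<Rightarrow> nat \<Rightarrow> 'e"
  assumes G: "\<forall>w\<in>G. adm_word A w \<and> p w \<in> cyl A w" and k: "k > 0"
    and low: "\<And>\<tau>. successively A \<tau> \<Longrightarrow> \<exists>T0. \<forall>T\<ge>T0. k * measure m (cyl A \<tau>) * exp (\<delta> * T) \<le>
        real (card {w\<in>G. birkhoff (length w) f (p w) \<ge> - T \<and> p w \<in> cyl A \<tau>})"
    and U: "openin (shift_top A) U" "U \<subseteq> B"
  shows "ereal (k * measure m U) \<le>
    Liminf at_top (\<lambda>T. ecard {w\<in>G. p w \<in> B \<and> birkhoff (length w) f (p w) \<ge> - T} / ereal (exp (\<delta> * T)))"
    (is "_ \<le> ?L")
proof -
  obtain K' where fin: "\<And>G p T. \<forall>w\<in>G. adm_word A w \<and> p w \<in> cyl A w \<Longrightarrow>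
     finite {w\<in>G. birkhoff (length w) f (p w) \<ge> - T}"
    using count_upper by blast
  have step: "ereal (k * r) \<le> ?L" if r: "r < measure m U" for r
  proof -
    obtain n F where F: "finite F" "\<And>\<tau>. \<tau> \<in> F \<Longrightarrow> successively A \<tau> \<and> length \<tau> = n \<and> cyl A \<tau> \<subseteq> U"
      "r < (\<Sum>\<tau>\<in>F. measure m (cyl A \<tau>))"
      using open_approx[OF U(1) r] by blast
    have "\<forall>\<tau>\<in>F. eventually (\<lambda>T. k * measure m (cyl A \<tau>) * exp (\<delta> * T) \<le>
        real (card {w\<in>G. birkhoff (length w) f (p w) \<ge> - T \<and> p w \<in> cyl A \<tau>})) at_top"
      using low F(2) by (simp add: eventually_at_top_linorder)
    then have "eventually (\<lambda>T. \<forall>\<tau>\<in>F. k * measure m (cyl A \<tau>) * exp (\<delta> * T) \<le>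
        real (card {w\<in>G. birkhoff (length w) f (p w) \<ge> - T \<and> p w \<in> cyl A \<tau>})) at_top"
      using F(1) by (simp add: eventually_ball_finite)
    then have "eventually (\<lambda>T. ereal (k * r) \<le>
        ecard {w\<in>G. p w \<in> B \<and> birkhoff (length w) f (p w) \<ge> - T} / ereal (exp (\<delta> * T))) at_top"
    proof eventually_elim
      case (elim T)
      let ?V = "\<lambda>\<tau>. {w\<in>G. birkhoff (length w) f (p w) \<ge> - T \<and> p w \<in> cyl A \<tau>}"
      let ?B = "{w\<in>G. p w \<in> B \<and> birkhoff (length w) f (p w) \<ge> - T}"
      have finV: "finite (?V \<tau>)" "finite ?B" for \<tau>
        by (rule finite_subset[OF _ fin[OF G, of T]]; auto)+
      have "k * r * exp (\<delta> * T) \<le> k * (\<Sum>\<tau>\<in>F. measure m (cyl A \<tau>)) * exp (\<delta> * T)"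
        using k F(3) by (intro mult_right_mono mult_left_mono) auto
      also have "\<dots> = (\<Sum>\<tau>\<in>F. k * measure m (cyl A \<tau>) * exp (\<delta> * T))"
        by (simp add: sum_distrib_left sum_distrib_right)
      also have "\<dots> \<le> (\<Sum>\<tau>\<in>F. real (card (?V \<tau>)))" by (rule sum_mono) (use elim in blast)
      also have "\<dots> = real (card (\<Union>\<tau>\<in>F. ?V \<tau>))"
      proof -
        have "card (\<Union>\<tau>\<in>F. ?V \<tau>) = (\<Sum>\<tau>\<in>F. card (?V \<tau>))"
        proof (rule card_UN_disjoint[OF F(1)])
          show "\<forall>i\<in>F. finite (?V i)" using finV by blast
          show "\<forall>i\<in>F. \<forall>j\<in>F. i \<noteq> j \<longrightarrow> ?V i \<inter> ?V j = {}"
            using F(2) cyl_disjoint by blast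
        qed
        then show ?thesis by simp
      qed
      also have "\<dots> \<le> real (card ?B)"
        by (intro of_nat_mono card_mono finV) (use F(2) U(2) in blast)
      finally have "k * r \<le> real (card ?B) / exp (\<delta> * T)" by (simp add: field_simps)
      then show ?case using finV(2) by (simp add: ecard_def)
    qed
    then show ?thesis by (rule Liminf_bounded)
  qed
  show ?thesis
  proof (rule ccontr)
    assume "\<not> ?thesis"
    then have "?L < ereal (k * measure m U)" by simp
    then obtain z where z: "?L < ereal z" "ereal z < ereal (k * measure m U)" using ereal_dense2 by blast
    have "z / k < measure m U" using z(2) k by (simp add: field_simps)
    from step[OF this] have "ereal z \<le> ?L" using k by simp
    then show False using z(1) by simp
  qed
qed

text \<open>The restriction to \<open>B\<close> is simply dropped; in the theorem the additive term
  with \<open>1 / y0\<close> absorbs the resulting constant.\<close>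

lemma limsup_count:
  fixes G :: "'e list set" and p :: "'e list \<Rightarrow> nat \<Rightarrow> 'e"
  assumes "\<And>T. finite {w\<in>G. birkhoff (length w) f (p w) \<ge> - T} \<and>
     real (card {w\<in>G. birkhoff (length w) f (p w) \<ge> - T}) \<le> K * exp (\<delta> * T)"
  shows "Limsup at_top (\<lambda>T. ecard {w\<in>G. p w \<in> B \<and> birkhoff (length w) f (p w) \<ge> - T} / ereal (exp (\<delta> * T)))
    \<le> ereal K"
proof (rule Limsup_bounded, rule always_eventually, rule allI)
  fix T
  let ?B = "{w\<in>G. p w \<in> B \<and> birkhoff (length w) f (p w) \<ge> - T}"
  have sub: "?B \<subseteq> {w\<in>G. birkhoff (length w) f (p w) \<ge> - T}" by auto
  have fin: "finite ?B" using finite_subset[OF sub] assms by blast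
  have "real (card ?B) \<le> real (card {w\<in>G. birkhoff (length w) f (p w) \<ge> - T})"
    using assms by (intro of_nat_mono card_mono sub) blast
  also have "\<dots> \<le> K * exp (\<delta> * T)" using assms by blast
  finally have "real (card ?B) / exp (\<delta> * T) \<le> K" by (simp add: field_simps)
  then show "ecard ?B / ereal (exp (\<delta> * T)) \<le> ereal K" using fin by (simp add: ecard_def)
qed

lemma count_bounds:
  "\<exists>k>0. \<exists>K>0. \<forall>B U. openin (shift_top A) U \<longrightarrow> U \<subseteq> B \<longrightarrow>
    (\<forall>\<rho>\<in>X. ereal (k * measure m U) \<le> Liminf at_top (\<lambda>T. N_orbit A f B \<rho> T / ereal (exp (\<delta> * T))) \<and>
      Limsup at_top (\<lambda>T. N_orbit A f B \<rho> T / ereal (exp (\<delta> * T))) \<le> ereal K) \<and>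
    ereal (k * measure m U) \<le> Liminf at_top (\<lambda>T. N_per A f B T / ereal (exp (\<delta> * T))) \<and>
    Limsup at_top (\<lambda>T. N_per A f B T / ereal (exp (\<delta> * T))) \<le> ereal K"
proof -
  obtain K where K: "K > 0" "\<And>G p T. \<forall>w\<in>G. adm_word A w \<and> p w \<in> cyl A w \<Longrightarrow>
     finite {w\<in>G. birkhoff (length w) f (p w) \<ge> - T} \<and>
     real (card {w\<in>G. birkhoff (length w) f (p w) \<ge> - T}) \<le> K * exp (\<delta> * T)"
    using count_upper by blast
  obtain k where k: "k > 0" and low: "\<And>\<tau>. successively A \<tau> \<Longrightarrow> (\<exists>T0. \<forall>T\<ge>T0.
     (\<forall>\<rho>\<in>X. k * measure m (cyl A \<tau>) * exp (\<delta> * T) \<le>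
        real (card {w\<in>orbit_words \<rho>. birkhoff (length w) f (concat_seq w \<rho>) \<ge> - T \<and> concat_seq w \<rho> \<in> cyl A \<tau>})) \<and>
     k * measure m (cyl A \<tau>) * exp (\<delta> * T) \<le>
        real (card {w\<in>per_words. birkhoff (length w) f (per_seq w) \<ge> - T \<and> per_seq w \<in> cyl A \<tau>}))"
    using count_lower by blast
  have Go: "\<forall>w\<in>orbit_words \<rho>. adm_word A w \<and> concat_seq w \<rho> \<in> cyl A w" for \<rho>
    using orbit_in_cyl by (auto simp: orbit_words_def all_words_def)
  have Gp: "\<forall>w\<in>per_words. adm_word A w \<and> per_seq w \<in> cyl A w"
    using per_in_cyl by (auto simp: per_words_def all_words_def)
  have No: "N_orbit A f B \<rho> T =
      ecard {w\<in>orbit_words \<rho>. concat_seq w \<rho> \<in> B \<and> birkhoff (length w) f (concat_seq w \<rho>) \<ge> - T}" for B \<rho> T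
    unfolding N_orbit_def orbit_words_def by (rule arg_cong[where f = ecard]) auto
  have Np: "N_per A f B T = ecard {w\<in>per_words. per_seq w \<in> B \<and> birkhoff (length w) f (per_seq w) \<ge> - T}" for B T
    unfolding N_per_def per_words_def by (rule arg_cong[where f = ecard]) auto
  have "(\<forall>\<rho>\<in>X. ereal (k * measure m U) \<le> Liminf at_top (\<lambda>T. N_orbit A f B \<rho> T / ereal (exp (\<delta> * T))) \<and>
      Limsup at_top (\<lambda>T. N_orbit A f B \<rho> T / ereal (exp (\<delta> * T))) \<le> ereal K) \<and>
    ereal (k * measure m U) \<le> Liminf at_top (\<lambda>T. N_per A f B T / ereal (exp (\<delta> * T))) \<and>
    Limsup at_top (\<lambda>T. N_per A f B T / ereal (exp (\<delta> * T))) \<le> ereal K"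
    if U: "openin (shift_top A) U" "U \<subseteq> B" for B U
    unfolding No Np
  proof (intro conjI ballI)
    fix \<rho> assume "\<rho> \<in> X"
    then show "ereal (k * measure m U) \<le> Liminf at_top (\<lambda>T. ecard {w\<in>orbit_words \<rho>. concat_seq w \<rho> \<in> B \<and>
        birkhoff (length w) f (concat_seq w \<rho>) \<ge> - T} / ereal (exp (\<delta> * T)))"
      using low by (intro liminf_count[OF Go k _ U]) blast
    show "Limsup at_top (\<lambda>T. ecard {w\<in>orbit_words \<rho>. concat_seq w \<rho> \<in> B \<and>
        birkhoff (length w) f (concat_seq w \<rho>) \<ge> - T} / ereal (exp (\<delta> * T))) \<le> ereal K"
      by (rule limsup_count[OF K(2)[OF Go]])
  next
    show "ereal (k * measure m U) \<le> Liminf at_top (\<lambda>T. ecard {w\<in>per_words. per_seq w \<in> B \<and>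
        birkhoff (length w) f (per_seq w) \<ge> - T} / ereal (exp (\<delta> * T)))"
      using low by (intro liminf_count[OF Gp k _ U]) blast
    show "Limsup at_top (\<lambda>T. ecard {w\<in>per_words. per_seq w \<in> B \<and>
        birkhoff (length w) f (per_seq w) \<ge> - T} / ereal (exp (\<delta> * T))) \<le> ereal K"
      by (rule limsup_count[OF K(2)[OF Gp]])
  qed
  then show ?thesis using k K(1) by blast
qed

end

section \<open>The equilibrium state\<close>

context regular_shift
begin

lemma shift_measurable: "shift \<in> measurable m m"
proof (rule measurable_sigma_sets[where A = "range (cyl A)"])
  show "sets m = sigma_sets X (range (cyl A))" by (simp add: sets_m borel_sets_eq_cylinders)
  show "range (cyl A) \<subseteq> Pow X" using cyl_subset by blast
  show "shift \<in> space m \<rightarrow> X" using shift_in_shift_space by (auto simp: space_m)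
  fix C assume "C \<in> range (cyl A)"
  then obtain w where C: "C = cyl A w" by blast
  have "openin (shift_top A) (shift -` C \<inter> X)"
    unfolding openin_shift_top_iff
  proof (intro conjI ballI)
    fix x assume x: "x \<in> shift -` C \<inter> X"
    have "cyl A (pre (Suc (length w)) x) \<subseteq> shift -` C \<inter> X"
      using x by (auto simp: C cyl_def shift_def shift_space_def)
    then show "\<exists>n. cyl A (pre n x) \<subseteq> shift -` C \<inter> X" ..
  qed simp
  then show "shift -` C \<inter> space m \<in> sets m" using open_measurable by (simp add: space_m)
qed

text \<open>Truncations to finitely many letters increase to the function, and their integrals are
  partial sums of the letter moment.\<close>

lemma integrable_first_letter: "integrable m (\<lambda>x. \<bar>S [x 0]\<bar>)"
proof -
  define g where "g n x = (\<Sum>e\<in>{e. to_nat e < n}. \<bar>S [e]\<bar> * indicator (cyl A [e]) x)" for n :: nat and x :: "nat \<Rightarrow> 'e"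
  have fin: "finite {e::'e. to_nat e < n}" for n
    by (rule finite_subset[of _ "from_nat ` {..<n}"]) (auto simp: image_iff intro: from_nat_to_nat[symmetric])
  have g: "g n x = (if to_nat (x 0) < n then \<bar>S [x 0]\<bar> else 0)" if "x \<in> X" for n x
  proof -
    have "g n x = (\<Sum>e\<in>{e. to_nat e < n}. if e = x 0 then \<bar>S [e]\<bar> else 0)"
      unfolding g_def using that by (intro sum.cong) (auto simp: indicator_def cyl_def)
    also have "\<dots> = (if to_nat (x 0) < n then \<bar>S [x 0]\<bar> else 0)"
      using fin by (simp add: sum.delta')
    finally show ?thesis .
  qed
  have gm [measurable]: "g n \<in> borel_measurable m" for n unfolding g_def by measurable
  have lim: "(\<lambda>n. g n x) \<longlonglongrightarrow> \<bar>S [x 0]\<bar>" if "x \<in> X" for x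
  proof (rule tendsto_eventually)
    show "eventually (\<lambda>n. g n x = \<bar>S [x 0]\<bar>) sequentially"
      using eventually_gt_at_top[of "to_nat (x 0)"] by eventually_elim (simp add: g that)
  qed
  have meas: "(\<lambda>x. \<bar>S [x 0]\<bar>) \<in> borel_measurable m"
    by (rule borel_measurable_LIMSEQ_metric[OF gm]) (use lim in \<open>simp add: space_m\<close>)
  define B where "B = infsum (\<lambda>e. measure m (cyl A [e]) * \<bar>S [e]\<bar>) UNIV"
  have int: "(\<integral>\<^sup>+x. ennreal (g n x) \<partial>m) \<le> ennreal B" for n
  proof -
    have "integrable m (g n)" unfolding g_def by (auto simp: emeasure_eq_measure)
    moreover have "(\<integral>x. g n x \<partial>m) = (\<Sum>e\<in>{e. to_nat e < n}. measure m (cyl A [e]) * \<bar>S [e]\<bar>)"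
      unfolding g_def
      by (subst Bochner_Integration.integral_sum)
        (auto simp: emeasure_eq_measure Int_absorb2 cyl_subset space_m mult.commute)
    moreover have "\<dots> \<le> B" unfolding B_def
      by (rule finite_sum_le_infsum[OF letter_moment_summable]) (use fin in auto)
    moreover have "0 \<le> g n x" for x unfolding g_def by (intro sum_nonneg) auto
    ultimately show ?thesis by (subst nn_integral_eq_integral) (auto intro: ennreal_leI)
  qed
  have "(\<integral>\<^sup>+x. ennreal \<bar>S [x 0]\<bar> \<partial>m) \<le> (\<integral>\<^sup>+x. (SUP n. ennreal (g n x)) \<partial>m)"
  proof (rule nn_integral_mono)
    fix x assume "x \<in> space m"
    then have "g (Suc (to_nat (x 0))) x = \<bar>S [x 0]\<bar>" by (simp add: g space_m)
    then show "ennreal \<bar>S [x 0]\<bar> \<le> (SUP n. ennreal (g n x))" by (metis SUP_upper UNIV_I)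
  qed
  also have "\<dots> = (SUP n. \<integral>\<^sup>+x. ennreal (g n x) \<partial>m)"
  proof (rule nn_integral_monotone_convergence_SUP)
    show "incseq (\<lambda>n x. ennreal (g n x))"
    proof (rule incseq_SucI, rule le_funI, rule ennreal_leI)
      fix n x show "g n x \<le> g (Suc n) x"
        unfolding g_def using fin by (intro sum_mono2) auto
    qed
  qed simp
  also have "\<dots> \<le> ennreal B" by (rule SUP_least) (rule int)
  finally have "(\<integral>\<^sup>+x. ennreal (norm \<bar>S [x 0]\<bar>) \<partial>m) < \<infinity>"
    by (simp add: order_le_less_trans)
  then show ?thesis by (rule integrableI_bounded[OF meas])
qed

lemma f_measurable: "f \<in> borel_measurable m"
  by (rule holder_measurable[OF hold])

text \<open>On the cylinder of its first letter \<open>f\<close> stays within \<open>D\<close> of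
  the supremum, so the letter moment controls it although it may be unbounded below.\<close>

lemma integrable_f: "integrable m f"
proof (rule Bochner_Integration.integrable_bound[OF _ f_measurable])
  show "integrable m (\<lambda>x. \<bar>S [x 0]\<bar> + D)" using integrable_first_letter by simp
  have "\<bar>f x\<bar> \<le> \<bar>\<bar>S [x 0]\<bar> + D\<bar>" if "x \<in> X" for x
  proof -
    have x: "x \<in> cyl A [x 0]" using that by (simp add: cyl_def)
    show ?thesis using birkhoff_le_S[OF x] S_le_birkhoff[OF x] D_nonneg by (simp add: birkhoff_Suc)
  qed
  then show "AE x in m. norm (f x) \<le> norm (\<bar>S [x 0]\<bar> + D)" by (auto simp: space_m)
qed

end

section \<open>Bounds for the eigenfunction, invariance and positivity of chi\<close>

locale equilibrium_shift = regular_shift A \<alpha> f \<delta> m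
  for A :: "'e::countable \<Rightarrow> 'e \<Rightarrow> bool" and \<alpha> :: real and f :: "(nat \<Rightarrow> 'e) \<Rightarrow> real"
    and \<delta> :: real and m :: "(nat \<Rightarrow> 'e) measure" +
  fixes h :: "(nat \<Rightarrow> 'e) \<Rightarrow> real"
  assumes h_hold: "holder_space A \<alpha> h"
    and h_pos: "\<And>\<rho>. \<rho> \<in> shift_space A \<Longrightarrow> h \<rho> > 0"
    and h_eig: "\<And>\<rho>. \<rho> \<in> shift_space A \<Longrightarrow> transfer_op A \<delta> f h \<rho> = h \<rho>"
    and h_norm: "(\<integral>\<rho>. h \<rho> \<partial>m) = 1"
begin

lemma h_measurable [measurable]: "h \<in> borel_measurable m"
  using h_hold by (intro holder_measurable) (simp add: holder_space_def)

lemma h_integrable: "integrable m h"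
  using h_norm not_integrable_integral_eq by force

lemma h_bounded: "\<exists>H>0. \<forall>x\<in>X. h x \<le> H"
proof -
  obtain M where M: "\<forall>x\<in>X. norm (h x) \<le> M" using h_hold by (auto simp: holder_space_def)
  then have "\<forall>x\<in>X. h x \<le> \<bar>M\<bar> + 1" by force
  then show ?thesis by (intro exI[of _ "\<bar>M\<bar> + 1"]) auto
qed

text \<open>\<open>infsum\<close> of a family that is not summable is 0 by convention; positivity of
  \<open>h\<close> excludes this, so the eigenvalue equation really is a convergent series.\<close>

lemma h_has_sum:
  assumes "x \<in> X"
  shows "((\<lambda>e. exp (\<delta> * f (concat_seq [e] x)) * h (concat_seq [e] x)) has_sum h x) {e. A e (x 0)}"
proof -
  let ?g = "\<lambda>e. exp (\<delta> * f (concat_seq [e] x)) * h (concat_seq [e] x)"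
  have eq: "h x = infsum ?g {e. A e (x 0)}"
    using h_eig[OF assms] by (simp add: transfer_op_def)
  have "?g summable_on {e. A e (x 0)}"
  proof (rule ccontr)
    assume "\<not> ?thesis"
    then have "h x = 0" unfolding eq by (rule infsum_not_exists)
    then show False using h_pos[OF assms] by simp
  qed
  then show ?thesis unfolding eq by (rule has_sum_infsum)
qed

lemma h_ge_branch:
  assumes "x \<in> X" "A e (x 0)"
  shows "exp (\<delta> * f (concat_seq [e] x)) * h (concat_seq [e] x) \<le> h x"
proof -
  let ?g = "\<lambda>e. exp (\<delta> * f (concat_seq [e] x)) * h (concat_seq [e] x)"
  have eq: "infsum ?g {e. A e (x 0)} = h x"
    using h_has_sum[OF assms(1)] by (rule infsumI)
  have "?g summable_on {e. A e (x 0)}"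
    using h_has_sum[OF assms(1)] by (rule has_sum_imp_summable)
  then have "sum ?g {e} \<le> infsum ?g {e. A e (x 0)}"
  proof (rule finite_sum_le_infsum)
    fix e' assume "e' \<in> {e. A e (x 0)} - {e}"
    then have "concat_seq [e'] x \<in> X" using assms(1) by (simp add: concat_in_shift_space)
    then show "0 \<le> ?g e'" using h_pos by (simp add: less_imp_le)
  qed (use assms in auto)
  then show ?thesis by (simp add: eq)
qed

text \<open>A single branch of the iterated eigenvalue equation, all other branches being
  nonnegative.\<close>

lemma h_ge_word:
  "concat_seq w x \<in> X \<Longrightarrow> exp (\<delta> * birkhoff (length w) f (concat_seq w x)) * h (concat_seq w x) \<le> h x"
proof (induction w)
  case (Cons e w)
  let ?y = "concat_seq w x"
  have y: "?y \<in> X" "A e (?y 0)" using Cons.prems by (auto simp: concat_Cons_in_shift_space)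
  have ey: "concat_seq [e] ?y = concat_seq (e # w) x" using concat_seq_append[of "[e]" w x] by simp
  have "exp (\<delta> * birkhoff (length (e # w)) f (concat_seq (e # w) x)) * h (concat_seq (e # w) x)
      = exp (\<delta> * birkhoff (length w) f ?y) * (exp (\<delta> * f (concat_seq [e] ?y)) * h (concat_seq [e] ?y))"
    by (simp add: birkhoff_Suc ey distrib_left exp_add)
  also have "\<dots> \<le> exp (\<delta> * birkhoff (length w) f ?y) * h ?y"
    by (intro mult_left_mono h_ge_branch y) auto
  also have "\<dots> \<le> h x" by (rule Cons.IH[OF y(1)])
  finally show ?case .
qed simp

text \<open>By continuity \<open>h\<close> is at least half of \<open>h z\<close> on some cylinder
  around \<open>z\<close>. Every point has a preimage in that cylinder, reached by prepending the
  word and a connector, and the Birkhoff sum along this branch is bounded below uniformly.\<close>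

lemma h_bounded_below: "\<exists>h0>0. \<forall>x\<in>X. h0 \<le> h x"
proof -
  obtain z where z: "z \<in> X" using exists_from by blast
  interpret g: holder_shift A \<alpha> h
    by unfold_locales (use alpha h_hold in \<open>auto simp: holder_space_def\<close>)
  have "h z / 2 > 0" using h_pos[OF z] by simp
  then obtain n where n: "g.V * exp (- \<alpha> * real n) < h z / 2" using exp_alpha_small by blast
  define p where "p = pre (Suc n) z"
  have hp: "h z / 2 \<le> h y" if y: "y \<in> cyl A p" for y
  proof -
    have "\<bar>h y - h z\<bar> \<le> g.V * exp (- \<alpha> * real n)"
      using y z by (intro g.V(2)) (auto simp: cyl_def p_def)
    then show ?thesis using n by linarith
  qed
  have p: "adm_word A p" using successively_pre[OF z, of "Suc n"]
    by (auto simp: adm_word_iff p_def simp flip: length_greater_0_conv)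
  obtain \<theta> and R :: real where
    t: "\<And>a b. \<theta> a b \<in> connectors \<and> successively A (\<theta> a b) \<and> \<theta> a b \<noteq> [] \<and> A a (hd (\<theta> a b)) \<and> A (last (\<theta> a b)) b"
    and R: "\<And>w b x. adm_word A w \<Longrightarrow> x \<in> cyl A (w @ \<theta> (last w) b) \<Longrightarrow>
        S w - R \<le> birkhoff (length (w @ \<theta> (last w) b)) f x"
    using connect_words by (elim exE conjE) blast
  have "exp (\<delta> * (S p - R)) * (h z / 2) \<le> h x" if x: "x \<in> X" for x
  proof -
    let ?w = "p @ \<theta> (last p) (x 0)"
    have w: "concat_seq ?w x \<in> X"
      using adm_word_append[OF p] t[of "last p" "x 0"] x
      by (auto simp: concat_in_shift_space adm_word_iff)
    then have c: "concat_seq ?w x \<in> cyl A ?w" unfolding mem_cyl_iff by (metis pre_concat_seq)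
    have "exp (\<delta> * (S p - R)) * (h z / 2) \<le>
        exp (\<delta> * birkhoff (length ?w) f (concat_seq ?w x)) * h (concat_seq ?w x)"
    proof (rule mult_mono)
      show "exp (\<delta> * (S p - R)) \<le> exp (\<delta> * birkhoff (length ?w) f (concat_seq ?w x))"
        using R[OF p c] delta by simp
      show "h z / 2 \<le> h (concat_seq ?w x)" using hp c cyl_append_subset by blast
    qed (use h_pos[OF z] in auto)
    also have "\<dots> \<le> h x" by (rule h_ge_word[OF w])
    finally show ?thesis .
  qed
  then show ?thesis using h_pos[OF z] by (intro exI[of _ "exp (\<delta> * (S p - R)) * (h z / 2)"]) auto
qed

definition equil where "equil = density m (\<lambda>\<rho>. ennreal (h \<rho>))"

lemma space_equil: "space equil = X" and sets_equil [measurable_cong]: "sets equil = sets m"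
  by (simp_all add: equil_def space_m)

lemma emeasure_equil: "Q \<in> sets m \<Longrightarrow> emeasure equil Q = ennreal (\<integral>x. h x * indicator Q x \<partial>m)"
proof -
  assume Q: "Q \<in> sets m"
  have "integrable m (\<lambda>x. h x * indicator Q x)"
    by (rule integrable_real_mult_indicator[OF Q h_integrable])
  moreover have "0 \<le> h x * indicator Q x" if "x \<in> space m" for x
    using h_pos[of x] that by (simp add: space_m less_imp_le)
  moreover have "emeasure equil Q = (\<integral>\<^sup>+x. ennreal (h x * indicator Q x) \<partial>m)"
    unfolding equil_def using Q
    by (subst emeasure_density) (auto intro!: nn_integral_cong simp: indicator_def)
  ultimately show ?thesis by (simp add: nn_integral_eq_integral)
qed

lemma prob_equil: "prob_space equil"
proof
  have "(\<integral>x. h x * indicator X x \<partial>m) = (\<integral>x. h x \<partial>m)"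
    by (rule Bochner_Integration.integral_cong) (auto simp: space_m)
  moreover have "X \<in> sets m" using cyl_measurable[of "[]"] by simp
  ultimately show "emeasure equil (space equil) = 1" using h_norm by (simp add: space_equil emeasure_equil)
qed

lemma integrable_equil: "integrable equil f"
proof -
  have nn: "AE x in m. 0 \<le> h x" using h_pos by (auto simp: space_m less_imp_le)
  obtain H where H: "H > 0" "\<forall>x\<in>X. h x \<le> H" using h_bounded by blast
  have "integrable m (\<lambda>x. h x * f x)"
  proof (rule Bochner_Integration.integrable_bound)
    show "integrable m (\<lambda>x. H * f x)" using integrable_f by simp
    show "(\<lambda>x. h x * f x) \<in> borel_measurable m" using f_measurable by measurable
    have "\<bar>h x * f x\<bar> \<le> \<bar>H * f x\<bar>" if "x \<in> X" for x
      using H h_pos[OF that] that by (simp add: abs_mult mult_right_mono)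
    then show "AE x in m. norm (h x * f x) \<le> norm (H * f x)" by (auto simp: space_m)
  qed
  then show "integrable equil f" unfolding equil_def
    by (subst integrable_density[OF f_measurable h_measurable nn]) simp
qed

text \<open>The counting bounds are phrased with \<open>m\<close>; for periodic points the lower
  bound of the theorem uses the equilibrium state, whose mass is dominated this way.\<close>

lemma measure_equil_le: "\<exists>H>0. \<forall>Q\<in>sets m. measure equil Q \<le> H * measure m Q"
proof -
  obtain H where H: "H > 0" "\<forall>x\<in>X. h x \<le> H" using h_bounded by blast
  have "measure equil Q \<le> H * measure m Q" if Q: "Q \<in> sets m" for Q
  proof -
    have int: "integrable m (\<lambda>x. h x * indicator Q x)"
      by (rule integrable_real_mult_indicator[OF Q h_integrable])
    have "0 \<le> (\<integral>x. h x * indicator Q x \<partial>m)"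
      using h_pos by (intro integral_nonneg_AE) (auto simp: space_m less_imp_le)
    then have "measure equil Q = (\<integral>x. h x * indicator Q x \<partial>m)"
      using emeasure_equil[OF Q] by (simp add: measure_def)
    also have "\<dots> \<le> (\<integral>x. H * indicator Q x \<partial>m)"
      by (rule integral_mono[OF int])
        (use H Q in \<open>auto simp: emeasure_eq_measure space_m intro!: mult_right_mono\<close>)
    also have "\<dots> = H * measure m Q"
      using Q sets.sets_into_space by (simp add: Int_absorb2)
    finally show ?thesis .
  qed
  then show ?thesis using H(1) by blast
qed

text \<open>The operator maps the product of \<open>h\<close> and g o shift to the product of
  \<open>h\<close> and g, since g o shift is constant along all branches over a point. With g an
  indicator, conformality gives invariance.\<close>

lemma equil_invariant_cyl:
  "(\<integral>x. h x * indicator (cyl A w) (shift x) \<partial>m) = (\<integral>x. h x * indicator (cyl A w) x \<partial>m)"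
proof -
  let ?g = "\<lambda>x. complex_of_real (if x \<in> shift -` cyl A w then h x else 0)"
  have hold: "holder_space A \<alpha> ?g"
    by (rule holder_space_restrict[OF alpha h_hold, where N = "Suc (length w)"])
      (auto simp: cyl_def shift_def shift_space_def)
  have op: "transfer_op A \<delta> f ?g \<rho> = complex_of_real (h \<rho> * indicator (cyl A w) \<rho>)" if r: "\<rho> \<in> X" for \<rho>
  proof -
    have "((\<lambda>e. complex_of_real (indicator (cyl A w) \<rho> * (exp (\<delta> * f (concat_seq [e] \<rho>)) * h (concat_seq [e] \<rho>))))
        has_sum complex_of_real (indicator (cyl A w) \<rho> * h \<rho>)) {e. A e (\<rho> 0)}"
      by (intro has_sum_of_real has_sum_cmult_right h_has_sum[OF r])
    then have "(\<Sum>\<^sub>\<infinity>e\<in>{e. A e (\<rho> 0)}.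
        complex_of_real (indicator (cyl A w) \<rho> * (exp (\<delta> * f (concat_seq [e] \<rho>)) * h (concat_seq [e] \<rho>))))
        = complex_of_real (h \<rho> * indicator (cyl A w) \<rho>)"
      by (simp only: infsumI mult.commute)
    moreover have "transfer_op A \<delta> f ?g \<rho> = (\<Sum>\<^sub>\<infinity>e\<in>{e. A e (\<rho> 0)}.
        complex_of_real (indicator (cyl A w) \<rho> * (exp (\<delta> * f (concat_seq [e] \<rho>)) * h (concat_seq [e] \<rho>))))"
      unfolding transfer_op_def by (rule infsum_cong) (auto simp: indicator_def)
    ultimately show ?thesis by simp
  qed
  have "complex_of_real (\<integral>x. h x * indicator (cyl A w) (shift x) \<partial>m) = (\<integral>x. ?g x \<partial>m)"
    by (subst integral_complex_of_real[symmetric], rule Bochner_Integration.integral_cong)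
      (auto simp: indicator_def)
  also have "\<dots> = (\<integral>\<rho>. transfer_op A \<delta> f ?g \<rho> \<partial>m)" by (rule m_conf[OF hold, symmetric])
  also have "\<dots> = (\<integral>\<rho>. complex_of_real (h \<rho> * indicator (cyl A w) \<rho>) \<partial>m)"
    by (rule Bochner_Integration.integral_cong[OF refl]) (simp only: op space_m)
  also have "\<dots> = complex_of_real (\<integral>x. h x * indicator (cyl A w) x \<partial>m)"
    by (rule integral_complex_of_real)
  finally show ?thesis by (simp only: of_real_eq_iff)
qed

lemma shift_measurable_equil: "shift \<in> measurable equil equil"
  using shift_measurable by (simp add: measurable_def space_equil sets_equil space_m)

text \<open>Two probability measures that agree on the pi-system of cylinders coincide.\<close>

lemma equil_invariant: "distr equil equil shift = equil"
proof (rule measure_eqI_generator_eq[OF Int_stable_cylinders[of A], where \<Omega> = X and A = "\<lambda>_. X"])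
  have sg: "sets m = sigma_sets X (insert {} (range (cyl A)))"
  proof -
    have "sigma_sets X (insert {} (range (cyl A))) = sigma_sets X (range (cyl A))"
      by (rule sigma_sets_eqI) (auto intro: sigma_sets.intros)
    then show ?thesis by (simp add: sets_m borel_sets_eq_cylinders)
  qed
  show "sets (distr equil equil shift) = sigma_sets X (insert {} (range (cyl A)))" "sets equil = sigma_sets X (insert {} (range (cyl A)))"
    using sg by (simp_all add: sets_equil)
  show "insert {} (range (cyl A)) \<subseteq> Pow X" using cyl_subset by auto
  show "range (\<lambda>_. X) \<subseteq> insert {} (range (cyl A))" using cyl_Nil by blast
  show "(\<Union>i::nat. X) = X" by simp
  interpret mu: prob_space equil by (rule prob_equil)
  interpret dm: prob_space "distr equil equil shift" by (rule mu.prob_space_distr[OF shift_measurable_equil])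
  show "emeasure (distr equil equil shift) X \<noteq> \<infinity>" by simp
  fix Q assume "Q \<in> insert {} (range (cyl A))"
  then consider "Q = {}" | w where "Q = cyl A w" by auto
  then show "emeasure (distr equil equil shift) Q = emeasure equil Q"
  proof cases
    case 2
    have "shift -` cyl A w \<inter> X \<in> sets m" using measurable_sets[OF shift_measurable cyl_measurable] by (simp add: space_m)
    moreover have "(\<integral>x. h x * indicator (shift -` cyl A w \<inter> X) x \<partial>m) = (\<integral>x. h x * indicator (cyl A w) (shift x) \<partial>m)"
      by (rule Bochner_Integration.integral_cong) (auto simp: indicator_def space_m)
    ultimately have "emeasure equil (shift -` cyl A w \<inter> X) = emeasure equil (cyl A w)"
      by (simp add: emeasure_equil equil_invariant_cyl)
    then show ?thesis using 2 by (simp add: emeasure_distr[OF shift_measurable_equil] sets_equil space_equil)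
  qed simp
qed

lemma birkhoff_integral: "integrable equil (birkhoff n f) \<and> (\<integral>x. birkhoff n f x \<partial>equil) = n * (\<integral>x. f x \<partial>equil)"
proof (induction n)
  case 0
  have "birkhoff 0 f = (\<lambda>_. 0)" by (simp add: fun_eq_iff)
  then show ?case by simp
next
  case (Suc n)
  have eq: "birkhoff (Suc n) f = (\<lambda>x. f x + birkhoff n f (shift x))" by (simp add: fun_eq_iff birkhoff_Suc)
  have i: "integrable equil (birkhoff n f)" using Suc by blast
  then have meas: "birkhoff n f \<in> borel_measurable equil" by simp
  have "integrable equil (\<lambda>x. birkhoff n f (shift x))"
    using integrable_distr[OF shift_measurable_equil, of "birkhoff n f"] i by (simp add: equil_invariant)
  moreover have "(\<integral>x. birkhoff n f (shift x) \<partial>equil) = (\<integral>x. birkhoff n f x \<partial>equil)"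
    using integral_distr[OF shift_measurable_equil meas] by (simp add: equil_invariant)
  ultimately show ?case using Suc integrable_equil unfolding eq by (simp add: algebra_simps)
qed

text \<open>For some fixed n the Birkhoff sum is at most -1 everywhere by linear decay, and by
  invariance its integral is n times that of \<open>f\<close>.\<close>

lemma chi_pos: "- (\<integral>x. f x \<partial>equil) > 0"
proof -
  interpret mu: prob_space equil by (rule prob_equil)
  obtain c C where c: "c > 0" and dec: "\<And>x n. x \<in> X \<Longrightarrow> birkhoff n f x \<le> C - c * real n"
    using birkhoff_decay by blast
  obtain n where "(C + 1) / c < real n" using reals_Archimedean2 by blast
  then have n: "C - c * real n \<le> -1" using c by (simp add: field_simps)
  have "(\<integral>x. birkhoff n f x \<partial>equil) \<le> (\<integral>x. -1 \<partial>equil)"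
  proof (rule integral_mono)
    fix x assume "x \<in> space equil"
    then show "birkhoff n f x \<le> - 1" using dec[of x n] n by (simp add: space_equil)
  qed (use birkhoff_integral in auto)
  then have "real n * (\<integral>x. f x \<partial>equil) \<le> -1" using birkhoff_integral[of n] mu.prob_space by simp
  then have "\<not> 0 \<le> (\<integral>x. f x \<partial>equil)"
    by (metis mult_nonneg_nonneg of_nat_0_le_iff neg_0_le_iff_le order_trans not_one_le_zero)
  then show ?thesis by simp
qed

end

section \<open>The constant c and the choice of y0\<close>

lemma tauberian_constant_le:
  fixes d y :: real
  assumes d: "d > 0" and y: "y > 0"
  shows "1 / (y * (exp (d / y) - 1)) \<le> 2 * y / d\<^sup>2"
    and "0 \<le> 1 / (y * (exp (d / y) - 1))"
proof -
  \<comment> \<open>The quadratic term is what counts: it beats the factor 1 / y and makes the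
    constant vanish linearly as y tends to 0.\<close>
  have "1 + d / y + (d / y)\<^sup>2 / 2 \<le> exp (d / y)"
    by (rule exp_lower_Taylor_quadratic) (use d y in simp)
  moreover have "0 < d / y" using d y by simp
  ultimately have ge: "(d / y)\<^sup>2 / 2 \<le> exp (d / y) - 1" and pos: "0 < exp (d / y) - 1" by auto
  have q: "0 < y * ((d / y)\<^sup>2 / 2)" using d y by simp
  have "1 / (y * (exp (d / y) - 1)) \<le> 1 / (y * ((d / y)\<^sup>2 / 2))"
    using ge q y by (intro divide_left_mono mult_left_mono mult_pos_pos pos) auto
  also have "\<dots> = 2 * y / d\<^sup>2" using d y by (simp add: field_simps power2_eq_square)
  finally show "1 / (y * (exp (d / y) - 1)) \<le> 2 * y / d\<^sup>2" .
  show "0 \<le> 1 / (y * (exp (d / y) - 1))" using pos y by simp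
qed

theorem mainTheorem1:
  fixes A :: "'e::countable \<Rightarrow> 'e \<Rightarrow> bool"
    and \<alpha> \<delta> :: real
    and f :: "(nat \<Rightarrow> 'e) \<Rightarrow> real"
    and m :: "(nat \<Rightarrow> 'e) measure"
    and h :: "(nat \<Rightarrow> 'e) \<Rightarrow> real"
  assumes irr: "finitely_irreducible A"
    and alpha: "\<alpha> > 0"
    and hold: "holder_type A \<alpha> f"
    and sreg: "strongly_regular A f"
    and delta: "\<delta> > 0" "pressure A (\<lambda>\<rho>. \<delta> * f \<rho>) = 0"
    and m_prob: "prob_space m" "space m = shift_space A" "sets m = borel_sets_of (shift_top A)"
    and m_conf: "\<And>g :: (nat \<Rightarrow> 'e) \<Rightarrow> complex. holder_space A \<alpha> g \<Longrightarrow>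
                   (\<integral>\<rho>. transfer_op A \<delta> f g \<rho> \<partial>m) = (\<integral>\<rho>. g \<rho> \<partial>m)"
    and h_hold: "holder_space A \<alpha> h"
    and h_pos: "\<And>\<rho>. \<rho> \<in> shift_space A \<Longrightarrow> h \<rho> > 0"
    and h_eig: "\<And>\<rho>. \<rho> \<in> shift_space A \<Longrightarrow> transfer_op A \<delta> f h \<rho> = h \<rho>"
    and h_norm: "(\<integral>\<rho>. h \<rho> \<partial>m) = 1"
  defines "\<mu> \<equiv> density m (\<lambda>\<rho>. ennreal (h \<rho>))"
    and "chi \<equiv> - (\<integral>\<rho>. f \<rho> \<partial>density m (\<lambda>\<rho>. ennreal (h \<rho>)))"
  shows "\<exists>y0 > 0. let c = 1 / (y0 * (exp (\<delta> / y0) - 1)) in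
     (\<forall>B \<in> borel_sets_of (shift_top A). \<forall>\<rho> \<in> shift_space A.
        ereal (c * h \<rho> / chi * measure m (shift_top A interior_of B))
          \<le> Liminf at_top (\<lambda>T. N_orbit A f B \<rho> T / ereal (exp (\<delta> * T)))
      \<and> Liminf at_top (\<lambda>T. N_orbit A f B \<rho> T / ereal (exp (\<delta> * T)))
          \<le> Limsup at_top (\<lambda>T. N_orbit A f B \<rho> T / ereal (exp (\<delta> * T)))
      \<and> Limsup at_top (\<lambda>T. N_orbit A f B \<rho> T / ereal (exp (\<delta> * T)))
          \<le> ereal (c * h \<rho> / chi * measure m (shift_top A closure_of B) + (1 / y0) * h \<rho> / chi))
   \<and> (\<forall>B \<in> borel_sets_of (shift_top A).
        ereal (c * (1 / chi) * measure \<mu> (shift_top A interior_of B))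
          \<le> Liminf at_top (\<lambda>T. N_per A f B T / ereal (exp (\<delta> * T)))
      \<and> Liminf at_top (\<lambda>T. N_per A f B T / ereal (exp (\<delta> * T)))
          \<le> Limsup at_top (\<lambda>T. N_per A f B T / ereal (exp (\<delta> * T)))
      \<and> Limsup at_top (\<lambda>T. N_per A f B T / ereal (exp (\<delta> * T)))
          \<le> ereal (c * (1 / chi) * measure \<mu> (shift_top A closure_of B) + (1 / y0) * (1 / chi)))"
proof -
  interpret E: equilibrium_shift A \<alpha> f \<delta> m h
    by (intro equilibrium_shift.intro equilibrium_shift_axioms.intro regular_shift.intro
        regular_shift_axioms.intro conformal_shift.intro conformal_shift_axioms.intro
        holder_shift.intro holder_shift_axioms.intro irreducible_shift.intro)
      (fact irr alpha hold sreg delta(1) m_prob m_conf h_hold h_pos h_eig h_norm)+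
  have mu: "\<mu> = E.equil" by (simp add: \<mu>_def E.equil_def)
  have chi: "chi > 0" using E.chi_pos by (simp add: chi_def E.equil_def)
  obtain k K where k: "k > 0" and K: "K > 0"
    and count: "\<forall>B U. openin (shift_top A) U \<longrightarrow> U \<subseteq> B \<longrightarrow>
    (\<forall>\<rho>\<in>shift_space A. ereal (k * measure m U) \<le> Liminf at_top (\<lambda>T. N_orbit A f B \<rho> T / ereal (exp (\<delta> * T))) \<and>
      Limsup at_top (\<lambda>T. N_orbit A f B \<rho> T / ereal (exp (\<delta> * T))) \<le> ereal K) \<and>
    ereal (k * measure m U) \<le> Liminf at_top (\<lambda>T. N_per A f B T / ereal (exp (\<delta> * T))) \<and>
    Limsup at_top (\<lambda>T. N_per A f B T / ereal (exp (\<delta> * T))) \<le> ereal K"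
    using E.count_bounds by blast
  obtain H1 where H1: "H1 > 0" "\<forall>Q\<in>sets m. measure \<mu> Q \<le> H1 * measure m Q"
    using E.measure_equil_le mu by auto
  obtain H2 where H2: "H2 > 0" "\<forall>x\<in>shift_space A. h x \<le> H2" using E.h_bounded by blast
  obtain h0 where h0: "h0 > 0" "\<forall>x\<in>shift_space A. h0 \<le> h x" using E.h_bounded_below by blast
  \<comment> \<open>One bound for both lower estimates: \<open>H2\<close> bounds
    \<open>h \<rho>\<close> in the orbit count, \<open>H1\<close> compares the measures in the
    periodic count.\<close>
  define H where "H = max H1 H2"
  have H: "H > 0" using H1(1) by (simp add: H_def)
  \<comment> \<open>The first entry makes \<open>c * H / chi\<close> at most \<open>k\<close>; the
    other two make the additive terms of the orbit and of the periodic estimate at least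
    \<open>K\<close>.\<close>
  define y0 where "y0 = min (k * chi * \<delta>\<^sup>2 / (2 * H)) (min (h0 / (K * chi)) (1 / (K * chi)))"
  have y0: "y0 > 0" using k K chi delta(1) H h0 by (simp add: y0_def)
  have y0_le: "y0 \<le> k * chi * \<delta>\<^sup>2 / (2 * H)" "y0 \<le> h0 / (K * chi)" "y0 \<le> 1 / (K * chi)"
    by (auto simp: y0_def)
  define c where "c = 1 / (y0 * (exp (\<delta> / y0) - 1))"
  have c0: "c \<ge> 0" unfolding c_def by (rule tauberian_constant_le(2)[OF delta(1) y0])
  have "c \<le> 2 * y0 / \<delta>\<^sup>2" unfolding c_def by (rule tauberian_constant_le(1)[OF delta(1) y0])
  also have "\<dots> \<le> k * chi / H" using y0_le(1) delta(1) H by (simp add: field_simps)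
  finally have cH: "c * H / chi \<le> k" using H chi by (simp add: field_simps)
  have K1: "K \<le> (1 / y0) * h0 / chi" and K2: "K \<le> (1 / y0) * (1 / chi)"
    using y0_le(2,3) y0 K chi by (simp_all add: field_simps)
  have U: "openin (shift_top A) (shift_top A interior_of B)" "shift_top A interior_of B \<subseteq> B" for B
    by (simp_all add: interior_of_subset)
  have nontriv: "(at_top :: real filter) \<noteq> bot" by simp
  show ?thesis
    unfolding Let_def
  proof (rule exI[of _ y0], fold c_def, intro conjI ballI)
    show "y0 > 0" by (rule y0)
  next
    fix B \<rho> assume r: "\<rho> \<in> shift_space A"
    let ?U = "shift_top A interior_of B"
    have hr: "h \<rho> \<le> H" "h0 \<le> h \<rho>" using r H2(2) h0(2) by (auto simp: H_def le_max_iff_disj)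
    have "c * h \<rho> / chi \<le> c * H / chi" using c0 hr chi by (intro divide_right_mono mult_left_mono) auto
    also have "\<dots> \<le> k" by (rule cH)
    finally have "c * h \<rho> / chi * measure m ?U \<le> k * measure m ?U" by (intro mult_right_mono) auto
    then have "ereal (c * h \<rho> / chi * measure m ?U) \<le> ereal (k * measure m ?U)" by simp
    also have "\<dots> \<le> Liminf at_top (\<lambda>T. N_orbit A f B \<rho> T / ereal (exp (\<delta> * T)))"
      using count U r by blast
    finally show "ereal (c * h \<rho> / chi * measure m ?U) \<le> Liminf at_top (\<lambda>T. N_orbit A f B \<rho> T / ereal (exp (\<delta> * T)))" .
    show "Liminf at_top (\<lambda>T. N_orbit A f B \<rho> T / ereal (exp (\<delta> * T)))
        \<le> Limsup at_top (\<lambda>T. N_orbit A f B \<rho> T / ereal (exp (\<delta> * T)))"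
      by (rule Liminf_le_Limsup[OF nontriv])
    have "Limsup at_top (\<lambda>T. N_orbit A f B \<rho> T / ereal (exp (\<delta> * T))) \<le> ereal K"
      using count U[of B] r by blast
    also have "K \<le> c * h \<rho> / chi * measure m (shift_top A closure_of B) + (1 / y0) * h \<rho> / chi"
    proof -
      have "0 \<le> c * h \<rho> / chi * measure m (shift_top A closure_of B)"
        using c0 chi h0(1) hr by (intro mult_nonneg_nonneg divide_nonneg_nonneg) auto
      moreover have "(1 / y0) * h0 / chi \<le> (1 / y0) * h \<rho> / chi"
        using y0 chi hr by (intro divide_right_mono mult_left_mono) auto
      ultimately show ?thesis using K1 by linarith
    qed
    finally show "Limsup at_top (\<lambda>T. N_orbit A f B \<rho> T / ereal (exp (\<delta> * T)))
        \<le> ereal (c * h \<rho> / chi * measure m (shift_top A closure_of B) + (1 / y0) * h \<rho> / chi)"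
      by simp
  next
    fix B
    let ?U = "shift_top A interior_of B"
    have "measure \<mu> ?U \<le> H1 * measure m ?U" using H1(2) E.open_measurable[OF U(1)] by blast
    also have "\<dots> \<le> H * measure m ?U" by (intro mult_right_mono) (auto simp: H_def)
    finally have "c * (1 / chi) * measure \<mu> ?U \<le> c * (1 / chi) * (H * measure m ?U)"
      using c0 chi by (intro mult_left_mono) auto
    also have "\<dots> = c * H / chi * measure m ?U" by simp
    also have "\<dots> \<le> k * measure m ?U" by (intro mult_right_mono cH) auto
    finally have "ereal (c * (1 / chi) * measure \<mu> ?U) \<le> ereal (k * measure m ?U)" by simp
    also have "\<dots> \<le> Liminf at_top (\<lambda>T. N_per A f B T / ereal (exp (\<delta> * T)))"
      using count U by blast
    finally show "ereal (c * (1 / chi) * measure \<mu> ?U) \<le> Liminf at_top (\<lambda>T. N_per A f B T / ereal (exp (\<delta> * T)))" .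
    show "Liminf at_top (\<lambda>T. N_per A f B T / ereal (exp (\<delta> * T)))
        \<le> Limsup at_top (\<lambda>T. N_per A f B T / ereal (exp (\<delta> * T)))"
      by (rule Liminf_le_Limsup[OF nontriv])
    have "Limsup at_top (\<lambda>T. N_per A f B T / ereal (exp (\<delta> * T))) \<le> ereal K"
      using count U[of B] by blast
    also have "K \<le> c * (1 / chi) * measure \<mu> (shift_top A closure_of B) + (1 / y0) * (1 / chi)"
    proof -
      have "0 \<le> c * (1 / chi) * measure \<mu> (shift_top A closure_of B)"
        using c0 chi by (intro mult_nonneg_nonneg) auto
      then show ?thesis using K2 by linarith
    qed
    finally show "Limsup at_top (\<lambda>T. N_per A f B T / ereal (exp (\<delta> * T)))
        \<le> ereal (c * (1 / chi) * measure \<mu> (shift_top A closure_of B) + (1 / y0) * (1 / chi))"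
      by simp
  qed
qed

end
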